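(* Let $n\ge1$ and let $h\colon\mathbb{R}^n\to\mathbb{R}$ belong to $\mathcal{D}^{(4)}$. Set $\mu_h(dx)=e^{-h(x)}dx$ and let $(\mathcal{P}_t)_{t\ge0}$ be the semi-group associated to the diffusion operator $\Delta-\nabla h\cdot\nabla$. Put $$W(x):=\frac{|x|^2}{2}-h(x),\qquad V(x):=\tfrac12\bigl(n-\Delta h(x)\bigr)-\tfrac14\bigl(|x|^2-|\nabla h(x)|^2\bigr),\qquad x\in\mathbb{R}^n,$$ and assume that $V$ is bounded from below. Let $f\in\mathbb{L}^2(\mu_h)\setminus\{0\}$ be non-negative. Then for all $t>0$ and $x\in\mathbb{R}^n$, $$\begin{aligned}\mathrm{Hess}(\log\mathcal{P}_tf)(x)=\;&-\tfrac12\bigl(\mathrm{Id}-\mathrm{Hess}(h)(x)\bigr)+\mathbb{E}^W_{f,x}(A_t^x\otimes A_t^x)-\mathbb{E}^W_{f,x}(A_t^x)\otimes\mathbb{E}^W_{f,x}(A_t^x)\\&-c_t^2\,\mathrm{Id}-\int_0^t\Bigl(\frac{\sinh(t-s)}{\sinh(t)}\Bigr)^2\mathbb{E}^W_{f,x}\bigl(\mathrm{Hess}V(X_s^x)\bigr)\,ds,\end{aligned}$$ where $$A_t^x:=-\int_0^t\nabla V(X_s^x)\frac{\sinh(t-s)}{\sinh(t)}\,ds+\frac{e^{-t}}{1-e^{-2t}}\,(X_t^x-e^{-t}x),\qquad c_t:=\frac{e^{-t}}{\sqrt{1-e^{-2t}}}.$$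
   Context: $\mathcal{D}^{(k)}$ denotes the set of $\mathcal{C}^k$ real-valued functions which, together with their derivatives (up to order $k$), have polynomial growth. For $u,v\in\mathbb{R}^n$, $u\otimes v:=uv^T$. $\mathrm{Id}$ is the $n\times n$ identity matrix. Let $(B_t)_{t\ge0}$ be a standard Brownian motion on $\mathbb{R}^n$ on a filtered probability space $(\Omega,\mathbb{P})$ and, for $x\in\mathbb{R}^n$, let $(X_s^x)_{s\ge0}$ be the Ornstein-Uhlenbeck process solving $X_t^x=x+\sqrt2\,B_t-\int_0^tX_s^x\,ds$. Let $\gamma_n$ be the standard Gaussian measure on $\mathbb{R}^n$. For $g\in\mathbb{L}^2(\gamma_n)$ let $P_t^Vg(x)=\mathbb{E}\bigl[g(X_t^x)e^{-\int_0^tV(X_s^x)\,ds}\bigr]$. For non-negative $g\in\mathbb{L}^2(\gamma_n)\setminus\{0\}$, $t>0$ and $x\in\mathbb{R}^n$, the probability measure $\mathbb{Q}_{g,x}$ on $\Omega$ (depending also on $t$ and $V$) is $$\mathbb{Q}_{g,x}(\Gamma)=\frac{1}{P_t^Vg(x)}\int_\Gamma g(X_t^x)e^{-\int_0^tV(X_s^x)ds}\,d\mathbb{P}.$$ $\mathbb{E}^W_{f,x}$ denotes the expectation with respect to $\mathbb{Q}_{e^{W/2}f,\,x}$ (note that $f\in\mathbb{L}^2(\mu_h)$ if and only if $e^{W/2}f\in\mathbb{L}^2(\gamma_n)$). The operator $\Delta-\nabla h\cdot\nabla$ is essentially self-adjoint on $\mathcal{C}^\infty_K$ in $\mathbb{L}^2(\mu_h)$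 and $(\mathcal{P}_t)_{t\ge0}$ is the semi-group on $\mathbb{L}^2(\mu_h)$ it generates; for $t>0$ it is understood pointwise through $\mathcal{P}_tf=e^{-W/2}P_t^V(e^{W/2}f)$. *)

theory Defs
  imports "HOL-Probability.Probability"
begin

subsection \<open>Differential calculus on Euclidean space\<close>

definition partial_deriv :: "'n \<Rightarrow> (real ^ 'n \<Rightarrow> real) \<Rightarrow> real ^ 'n \<Rightarrow> real" where
  "partial_deriv i f x = frechet_derivative f (at x) (axis i 1)"

definition grad :: "(real ^ 'n \<Rightarrow> real) \<Rightarrow> real ^ 'n \<Rightarrow> real ^ 'n" where
  "grad f x = (\<chi> i. partial_deriv i f x)"

definition Hess :: "(real ^ 'n \<Rightarrow> real) \<Rightarrow> real ^ 'n \<Rightarrow> real ^ 'n ^ 'n" where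
  "Hess f x = (\<chi> i j. partial_deriv i (partial_deriv j f) x)"

definition laplacian :: "(real ^ 'n \<Rightarrow> real) \<Rightarrow> real ^ 'n \<Rightarrow> real" where
  "laplacian f x = (\<Sum>i\<in>UNIV. partial_deriv i (partial_deriv i f) x)"

(* Since frechet_derivative is a total function, an equation for Hess f x is only meaningful
   together with this predicate. *)
definition twice_differentiable_at :: "(real ^ 'n \<Rightarrow> real) \<Rightarrow> real ^ 'n \<Rightarrow> bool" where
  "twice_differentiable_at f x \<longleftrightarrow>
     (\<forall>\<^sub>F y in nhds x. f differentiable (at y)) \<and> grad f differentiable (at x)"

definition outer_product :: "real ^ 'n \<Rightarrow> real ^ 'n \<Rightarrow> real ^ 'n ^ 'n"  (infixl "\<otimes>\<^sub>o" 70) where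
  "u \<otimes>\<^sub>o v = (columnvector u :: real ^ 1 ^ 'n) ** (rowvector v :: real ^ 'n ^ 1)"

definition poly_growth :: "(real ^ 'n \<Rightarrow> real) \<Rightarrow> bool" where
  "poly_growth f \<longleftrightarrow> (\<exists>C N. \<forall>x. \<bar>f x\<bar> \<le> C * (1 + norm x) ^ N)"

(* D_class k: the C^k functions all of whose partial derivatives of order at most k (order 0
   included) have polynomial growth.  In the recursive clause, continuity of f is implied by
   differentiability. *)
fun D_class :: "nat \<Rightarrow> (real ^ 'n \<Rightarrow> real) set" where
  "D_class 0 = {f. continuous_on UNIV f \<and> poly_growth f}"
| "D_class (Suc k) =
     {f. (\<forall>x. f differentiable (at x)) \<and> poly_growth f \<and> (\<forall>i. partial_deriv i f \<in> D_class k)}"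


subsection \<open>Measures and square-integrable functions\<close>

definition L2_fun :: "'b measure \<Rightarrow> ('b \<Rightarrow> real) set" where
  "L2_fun N = {f \<in> borel_measurable N. integrable N (\<lambda>x. (f x)\<^sup>2)}"

definition std_gaussian :: "(real ^ 'n) measure" where
  "std_gaussian = density lborel (\<lambda>x. ennreal (\<Prod>i\<in>UNIV. std_normal_density (x $ i)))"

definition mu_h :: "(real ^ 'n \<Rightarrow> real) \<Rightarrow> (real ^ 'n) measure" where
  "mu_h h = density lborel (\<lambda>x. ennreal (exp (- h x)))"


subsection \<open>Brownian motion and the Ornstein-Uhlenbeck process\<close>

(* Time is real; only the indices t \<ge> 0 matter. *)
definition filtered_prob_space :: "'a measure \<Rightarrow> (real \<Rightarrow> 'a measure) \<Rightarrow> bool" where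
  "filtered_prob_space M F \<longleftrightarrow>
     prob_space M \<and> (\<forall>t\<ge>0. subalgebra M (F t)) \<and>
     (\<forall>s t. 0 \<le> s \<longrightarrow> s \<le> t \<longrightarrow> sets (F s) \<subseteq> sets (F t))"

definition standard_brownian_motion ::
  "'a measure \<Rightarrow> (real \<Rightarrow> 'a measure) \<Rightarrow> (real \<Rightarrow> 'a \<Rightarrow> real ^ 'n) \<Rightarrow> bool" where
  "standard_brownian_motion M F B \<longleftrightarrow>
     (\<forall>t\<ge>0. B t \<in> borel_measurable (F t)) \<and>
     (AE \<omega> in M. B 0 \<omega> = 0) \<and>
     (AE \<omega> in M. continuous_on {0..} (\<lambda>t. B t \<omega>)) \<and>
     (\<forall>s t. 0 \<le> s \<longrightarrow> s < t \<longrightarrow>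
        distr M borel (\<lambda>\<omega>. (B t \<omega> - B s \<omega>) /\<^sub>R sqrt (t - s)) = std_gaussian \<and>
        prob_space.indep_set M (sets (F s))
          (sets (vimage_algebra (space M) (\<lambda>\<omega>. B t \<omega> - B s \<omega>) borel)))"

definition OU_process ::
  "'a measure \<Rightarrow> (real \<Rightarrow> 'a measure) \<Rightarrow> (real \<Rightarrow> 'a \<Rightarrow> real ^ 'n) \<Rightarrow> real ^ 'n \<Rightarrow>
     (real \<Rightarrow> 'a \<Rightarrow> real ^ 'n) \<Rightarrow> bool" where
  "OU_process M F B x Y \<longleftrightarrow>
     (\<forall>t\<ge>0. Y t \<in> borel_measurable (F t)) \<and>
     (AE \<omega> in M. continuous_on {0..} (\<lambda>t. Y t \<omega>) \<and>
        (\<forall>t\<ge>0. Y t \<omega> = x + sqrt 2 *\<^sub>R B t \<omega> - integral {0..t} (\<lambda>s. Y s \<omega>)))"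


subsection \<open>Feynman-Kac semigroup and the tilted measures\<close>

(* Below, X is a family of processes with X x s \<omega> standing for X_s^x(\<omega>).  Paths are
   continuous only almost surely, so a path functional such as \<integral>_0^t V(X_s^x) ds need only be
   measurable for the completion of M; hence expectations are taken in completion M.  On
   M-measurable functions this changes nothing. *)

definition FK_density ::
  "(real ^ 'n \<Rightarrow> real \<Rightarrow> 'a \<Rightarrow> real ^ 'n) \<Rightarrow> (real ^ 'n \<Rightarrow> real) \<Rightarrow> real \<Rightarrow> (real ^ 'n \<Rightarrow> real) \<Rightarrow>
     real ^ 'n \<Rightarrow> 'a \<Rightarrow> real" where
  "FK_density X V t g x \<omega> = g (X x t \<omega>) * exp (- integral {0..t} (\<lambda>s. V (X x s \<omega>)))"

definition FK_semigroup ::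
  "'a measure \<Rightarrow> (real ^ 'n \<Rightarrow> real \<Rightarrow> 'a \<Rightarrow> real ^ 'n) \<Rightarrow> (real ^ 'n \<Rightarrow> real) \<Rightarrow> real \<Rightarrow>
     (real ^ 'n \<Rightarrow> real) \<Rightarrow> real ^ 'n \<Rightarrow> real" where
  "FK_semigroup M X V t g x = (\<integral>\<omega>. FK_density X V t g x \<omega> \<partial>completion M)"

definition Q_measure ::
  "'a measure \<Rightarrow> (real ^ 'n \<Rightarrow> real \<Rightarrow> 'a \<Rightarrow> real ^ 'n) \<Rightarrow> (real ^ 'n \<Rightarrow> real) \<Rightarrow> real \<Rightarrow>
     (real ^ 'n \<Rightarrow> real) \<Rightarrow> real ^ 'n \<Rightarrow> 'a measure" where
  "Q_measure M X V t g x =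
     density (completion M) (\<lambda>\<omega>. ennreal (FK_density X V t g x \<omega> / FK_semigroup M X V t g x))"

definition W_of :: "(real ^ 'n \<Rightarrow> real) \<Rightarrow> real ^ 'n \<Rightarrow> real" where
  "W_of h x = (norm x)\<^sup>2 / 2 - h x"

definition V_of :: "(real ^ 'n \<Rightarrow> real) \<Rightarrow> real ^ 'n \<Rightarrow> real" where
  "V_of h x = 1 / 2 * (real CARD('n) - laplacian h x) - 1 / 4 * ((norm x)\<^sup>2 - (norm (grad h x))\<^sup>2)"

(* The pointwise version, for t > 0, of the semigroup generated in L^2(mu_h) by
   \<Delta> - \<nabla>h \<cdot> \<nabla>. *)
definition P_semigroup ::
  "'a measure \<Rightarrow> (real ^ 'n \<Rightarrow> real \<Rightarrow> 'a \<Rightarrow> real ^ 'n) \<Rightarrow> (real ^ 'n \<Rightarrow> real) \<Rightarrow> real \<Rightarrow>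
     (real ^ 'n \<Rightarrow> real) \<Rightarrow> real ^ 'n \<Rightarrow> real" where
  "P_semigroup M X h t f x =
     exp (- W_of h x / 2) * FK_semigroup M X (V_of h) t (\<lambda>y. exp (W_of h y / 2) * f y) x"

definition QW_measure ::
  "'a measure \<Rightarrow> (real ^ 'n \<Rightarrow> real \<Rightarrow> 'a \<Rightarrow> real ^ 'n) \<Rightarrow> (real ^ 'n \<Rightarrow> real) \<Rightarrow> real \<Rightarrow>
     (real ^ 'n \<Rightarrow> real) \<Rightarrow> real ^ 'n \<Rightarrow> 'a measure" where
  "QW_measure M X h t f x = Q_measure M X (V_of h) t (\<lambda>y. exp (W_of h y / 2) * f y) x"

definition A_var ::
  "(real ^ 'n \<Rightarrow> real \<Rightarrow> 'a \<Rightarrow> real ^ 'n) \<Rightarrow> (real ^ 'n \<Rightarrow> real) \<Rightarrow> real \<Rightarrow> real ^ 'n \<Rightarrow>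
     'a \<Rightarrow> real ^ 'n" where
  "A_var X V t x \<omega> =
     - integral {0..t} (\<lambda>s. (sinh (t - s) / sinh t) *\<^sub>R grad V (X x s \<omega>))
     + (exp (- t) / (1 - exp (- 2 * t))) *\<^sub>R (X x t \<omega> - exp (- t) *\<^sub>R x)"

definition c_coef :: "real \<Rightarrow> real" where
  "c_coef t = exp (- t) / sqrt (1 - exp (- 2 * t))"

end

theory Submission
  imports Defs
begin

text \<open>
  Write \<open>X\<^sub>s\<^sup>y = exp(-s) y + N\<^sub>s\<close> with \<open>N = X\<^sup>0\<close>, let \<open>g = exp(W/2) f\<close>, and let
  \<open>u(y) = E[g(X\<^sub>t\<^sup>y) exp(-\<integral>V(X\<^sub>s\<^sup>y)ds)]\<close> be the Feynman-Kac semigroup, so that the logarithm of the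
  semigroup of the theorem is \<open>- W / 2 + ln u\<close>.  Since \<open>g\<close> is only square integrable, \<open>u\<close> cannot be
  differentiated by moving derivatives onto \<open>g\<close>.  Instead the starting point is moved by a change of
  measure.  Put \<open>\<phi>(s) = sinh(t - s) / sinh t\<close>.  Then the process started at \<open>x + z\<close> is the path
  \<open>X\<^sub>s\<^sup>x + \<phi>(s) z\<close>, which has the same end point as \<open>X\<^sup>x\<close>, plus the deterministic path
  \<open>exp(-t) (sinh s / sinh t) z\<close>.  The latter is the covariance of \<open>N\<^sub>s\<close> and \<open>N\<^sub>t\<close> times a fixed vector, hence the law of \<open>N\<close> shifted by it has a
  density that depends on \<open>N\<^sub>t\<close> only, and

    \<open>u(x + z) = E[g(X\<^sub>t\<^sup>x) exp(-\<integral>V(X\<^sub>s\<^sup>x + \<phi>(s) z)ds + \<kappa> z\<bullet>N\<^sub>t - c2 |z|\<^sup>2 / 2)]\<close>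

  with \<open>\<kappa> = exp(-t) / (1 - exp(-2t))\<close> and \<open>c2 = exp(-2t) / (1 - exp(-2t))\<close>
  (lemma \<open>cameron_martin_path\<close>).  The right-hand side is smooth in \<open>z\<close>.  At \<open>z = 0\<close> the gradient of
  the exponent is the random vector \<open>A\<close> of the theorem, and its Hessian is
  \<open>-\<integral>\<phi>(s)\<^sup>2 Hess V(X\<^sub>s\<^sup>x)ds - c2 Id\<close>.  Differentiating twice under the expectation
  (lemma \<open>integral_E_has_derivative\<close>) gives \<open>\<nabla>u / u\<close> and \<open>Hess u / u\<close> as expectations under the tilted
  measure, and \<open>Hess (ln u) = Hess u / u - (\<nabla>u / u) \<otimes> (\<nabla>u / u)\<close> is the asserted formula.

  The change of measure is obtained without stochastic calculus.  The innovations
  \<open>N\<^sub>t - exp(-(t - s)) N\<^sub>s\<close> are almost sure limits of sums of independent Brownian increments, so they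
  are Gaussian with covariance \<open>(1 - exp(-2(t - s))) Id\<close> and independent of the past
  (lemma \<open>indep_law_innovation\<close>).  Integrating them out one after the other proves the formula for
  products of functions of \<open>N\<close> at finitely many times (lemma \<open>cameron_martin_grid\<close>); the exponentials of
  the Riemann sums of \<open>\<integral>V(X\<^sub>s)ds\<close> are such products, and dominated convergence concludes.

  The dominations rest on two estimates.  All exponential moments of \<open>|N\<^sub>s|\<close> are bounded uniformly in
  \<open>s\<close>, which absorbs the polynomial growth of the derivatives of \<open>V\<close>.  And \<open>g(X\<^sub>t\<^sup>x)\<close> is square
  integrable, because the density of \<open>X\<^sub>t\<^sup>x\<close> with respect to the standard Gaussian measure is bounded
  (lemma \<open>g_square_integrable\<close>).
\<close>

section \<open>Partial derivatives and functions of polynomial growth\<close>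

lemma partial_deriv_eqI:
  fixes f :: "real ^ 'n \<Rightarrow> real"
  assumes "(f has_derivative D) (at x)"
  shows "partial_deriv i f x = D (axis i 1)"
  using frechet_derivative_at[OF assms] by (simp add: partial_deriv_def)

lemma has_derivative_grad:
  fixes f :: "real ^ 'n \<Rightarrow> real"
  assumes "f differentiable (at x)"
  shows "(f has_derivative (\<lambda>v. grad f x \<bullet> v)) (at x)"
proof -
  let ?D = "frechet_derivative f (at x)"
  have D: "(f has_derivative ?D) (at x)"
    using assms frechet_derivative_works by blast
  then interpret bounded_linear ?D by (rule has_derivative_bounded_linear)
  have "?D v = grad f x \<bullet> v" for v
  proof -
    have "?D v = ?D (\<Sum>i\<in>UNIV. v $ i *\<^sub>R axis i 1)"
      by (simp add: basis_expansion[of v, unfolded scalar_mult_eq_scaleR])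
    also have "\<dots> = (\<Sum>i\<in>UNIV. v $ i * ?D (axis i 1))"
      by (simp add: sum scaleR)
    finally show ?thesis
      by (simp add: grad_def partial_deriv_def inner_vec_def mult.commute)
  qed
  then show ?thesis using D by presburger
qed

lemma partial_deriv_nth [simp]: "partial_deriv i (\<lambda>x. x $ j) x = (if i = j then 1 else 0)"
  for i j :: "'n::finite"
proof -
  have "((\<lambda>x::real^'n. x $ j) has_derivative (\<lambda>x. x $ j)) (at x)"
    by (rule bounded_linear.has_derivative[OF bounded_linear_vec_nth]) simp
  from partial_deriv_eqI[OF this] show ?thesis by (simp add: axis_def)
qed

lemma partial_deriv_const [simp]: "partial_deriv i (\<lambda>x. c) = (\<lambda>x. 0)"
  for i :: "'n::finite"
proof
  fix x :: "real^'n"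
  have "((\<lambda>x::real^'n. c) has_derivative (\<lambda>x. 0)) (at x)" by simp
  from partial_deriv_eqI[OF this] show "partial_deriv i (\<lambda>x. c) x = 0" .
qed

lemma partial_deriv_add:
  fixes f g :: "real ^ 'n \<Rightarrow> real"
  assumes "\<And>x. f differentiable (at x)" "\<And>x. g differentiable (at x)"
  shows "partial_deriv i (\<lambda>x. f x + g x) = (\<lambda>x. partial_deriv i f x + partial_deriv i g x)"
proof
  fix x
  have "((\<lambda>x. f x + g x) has_derivative (\<lambda>v. grad f x \<bullet> v + grad g x \<bullet> v)) (at x)"
    by (intro has_derivative_add has_derivative_grad assms)
  from partial_deriv_eqI[OF this]
  show "partial_deriv i (\<lambda>x. f x + g x) x = partial_deriv i f x + partial_deriv i g x"
    by (simp add: inner_axis grad_def)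
qed

lemma partial_deriv_mult:
  fixes f g :: "real ^ 'n \<Rightarrow> real"
  assumes "\<And>x. f differentiable (at x)" "\<And>x. g differentiable (at x)"
  shows "partial_deriv i (\<lambda>x. f x * g x) = (\<lambda>x. f x * partial_deriv i g x + partial_deriv i f x * g x)"
proof
  fix x
  have "((\<lambda>x. f x * g x) has_derivative (\<lambda>v. f x * (grad g x \<bullet> v) + (grad f x \<bullet> v) * g x)) (at x)"
    by (intro has_derivative_mult has_derivative_grad assms)
  from partial_deriv_eqI[OF this]
  show "partial_deriv i (\<lambda>x. f x * g x) x = f x * partial_deriv i g x + partial_deriv i f x * g x"
    by (simp add: inner_axis grad_def)
qed

lemma poly_growth_add:
  assumes "poly_growth f" "poly_growth g"
  shows "poly_growth (\<lambda>x. f x + g x)"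
proof -
  obtain C N C' N' where *: "\<And>x. \<bar>f x\<bar> \<le> C * (1 + norm x) ^ N" "\<And>x. \<bar>g x\<bar> \<le> C' * (1 + norm x) ^ N'"
    using assms unfolding poly_growth_def by metis
  have "\<bar>f x + g x\<bar> \<le> (\<bar>C\<bar> + \<bar>C'\<bar>) * (1 + norm x) ^ (N + N')" for x
  proof -
    have "C * (1 + norm x) ^ N \<le> \<bar>C\<bar> * (1 + norm x) ^ (N + N')"
      "C' * (1 + norm x) ^ N' \<le> \<bar>C'\<bar> * (1 + norm x) ^ (N + N')"
      by (intro mult_mono power_increasing; simp)+
    then show ?thesis using *[of x] by (simp add: algebra_simps)
  qed
  then show ?thesis unfolding poly_growth_def by blast
qed

lemma poly_growth_mult:
  assumes "poly_growth f" "poly_growth g"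
  shows "poly_growth (\<lambda>x. f x * g x)"
proof -
  obtain C N C' N' where *: "\<And>x. \<bar>f x\<bar> \<le> C * (1 + norm x) ^ N" "\<And>x. \<bar>g x\<bar> \<le> C' * (1 + norm x) ^ N'"
    using assms unfolding poly_growth_def by metis
  have "\<bar>f x * g x\<bar> \<le> (C * C') * (1 + norm x) ^ (N + N')" for x
  proof -
    have "\<bar>f x * g x\<bar> \<le> (C * (1 + norm x) ^ N) * (C' * (1 + norm x) ^ N')"
      unfolding abs_mult using * by (intro mult_mono) (auto intro: order_trans[OF abs_ge_zero])
    then show ?thesis by (simp add: power_add mult_ac)
  qed
  then show ?thesis unfolding poly_growth_def by blast
qed

lemma poly_growth_const [simp]: "poly_growth (\<lambda>x. c)"
  unfolding poly_growth_def by (rule exI[of _ "\<bar>c\<bar>"], rule exI[of _ 0]) simp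

lemma poly_growth_nth [simp]: "poly_growth (\<lambda>x. x $ i)"
  unfolding poly_growth_def
proof (intro exI[of _ 1] exI allI)
  fix x :: "real^'a" show "\<bar>x $ i\<bar> \<le> 1 * (1 + norm x) ^ 1"
    using component_le_norm_cart[of x i] by simp
qed

lemma D_class_SucD: "f \<in> D_class (Suc k) \<Longrightarrow> f \<in> D_class k"
proof (induction k arbitrary: f)
  case 0
  then show ?case by (auto simp: continuous_on_eq_continuous_at differentiable_imp_continuous_within)
next
  case (Suc k)
  then show ?case by simp
qed

lemma D_class_partial_deriv: "f \<in> D_class (Suc k) \<Longrightarrow> partial_deriv i f \<in> D_class k"
  by simp

lemma D_class_const [simp]: "(\<lambda>x. c) \<in> D_class k"
  by (induction k arbitrary: c) auto

lemma D_class_nth [simp]: "(\<lambda>x. x $ i) \<in> D_class k"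
proof (cases k)
  case 0
  then show ?thesis by (auto intro!: continuous_intros)
next
  case (Suc k)
  have "(\<lambda>x::real^'a. x $ i) differentiable (at x)" for x
    by (rule linear_imp_differentiable[OF bounded_linear.linear[OF bounded_linear_vec_nth]])
  moreover have "partial_deriv j (\<lambda>x::real^'a. x $ i) \<in> D_class k" for j
  proof -
    have "partial_deriv j (\<lambda>x::real^'a. x $ i) = (\<lambda>x. if j = i then 1 else 0)" by auto
    then show ?thesis by simp
  qed
  ultimately show ?thesis using Suc by simp
qed

lemma D_class_add: "f \<in> D_class k \<Longrightarrow> g \<in> D_class k \<Longrightarrow> (\<lambda>x. f x + g x) \<in> D_class k"
proof (induction k arbitrary: f g)
  case 0
  then show ?case by (auto intro!: continuous_intros poly_growth_add)
next
  case (Suc k)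
  then show ?case by (simp add: partial_deriv_add poly_growth_add)
qed

lemma D_class_mult: "f \<in> D_class k \<Longrightarrow> g \<in> D_class k \<Longrightarrow> (\<lambda>x. f x * g x) \<in> D_class k"
proof (induction k arbitrary: f g)
  case 0
  then show ?case by (auto intro!: continuous_intros poly_growth_mult)
next
  case (Suc k)
  from Suc.prems have "f \<in> D_class k" "g \<in> D_class k" by (auto dest!: D_class_SucD simp del: D_class.simps)
  with Suc show ?case by (simp add: partial_deriv_mult poly_growth_mult D_class_add)
qed

lemma D_class_sum: "(\<And>i. i \<in> I \<Longrightarrow> f i \<in> D_class k) \<Longrightarrow> (\<lambda>x. \<Sum>i\<in>I. f i x) \<in> D_class k"
  by (induction I rule: infinite_finite_induct) (auto intro: D_class_add simp del: D_class.simps)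

text \<open>The potential involves two derivatives of \<open>h\<close>, so two orders of regularity are lost.\<close>

lemma V_of_D_class:
  fixes h :: "real ^ 'n \<Rightarrow> real"
  assumes "h \<in> D_class (Suc (Suc k))"
  shows "V_of h \<in> D_class k"
proof -
  have 1: "partial_deriv i h \<in> D_class (Suc k)" for i
    using assms by simp
  have 2: "partial_deriv i h \<in> D_class k" for i
    using D_class_SucD[OF 1] .
  have 3: "partial_deriv i (partial_deriv i h) \<in> D_class k" for i
    using 1[of i] by simp
  have "V_of h = (\<lambda>x. 1 / 2 * (real CARD('n) + (-1) * (\<Sum>i\<in>UNIV. partial_deriv i (partial_deriv i h) x))
      + (-1 / 4) * ((\<Sum>i\<in>UNIV. x $ i * x $ i) + (-1) * (\<Sum>i\<in>UNIV. partial_deriv i h x * partial_deriv i h x)))"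
    by (rule ext) (simp add: V_of_def laplacian_def power2_norm_eq_inner inner_vec_def grad_def algebra_simps)
  also have "\<dots> \<in> D_class k"
    by (intro D_class_add D_class_mult D_class_sum D_class_const D_class_nth 2 3)
  finally show ?thesis .
qed

section \<open>Differentiation under the integral sign\<close>

text \<open>The derivative is represented by its gradient \<open>G\<close>, which need only be measurable at the point of
  differentiation \<open>z0\<close> but has to be dominated on a whole ball around it.\<close>

lemma has_derivative_integral_dominated:
  fixes f :: "'b::euclidean_space \<Rightarrow> 'a \<Rightarrow> real" and G :: "'b \<Rightarrow> 'a \<Rightarrow> 'b"
  assumes r: "0 < r"
    and der: "\<And>z \<omega>. z \<in> ball z0 r \<Longrightarrow> \<omega> \<in> space M \<Longrightarrow> ((\<lambda>z. f z \<omega>) has_derivative (\<lambda>v. G z \<omega> \<bullet> v)) (at z)"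
    and int: "\<And>z. z \<in> ball z0 r \<Longrightarrow> integrable M (f z)"
    and meas: "G z0 \<in> borel_measurable M"
    and bound: "\<And>z \<omega>. z \<in> ball z0 r \<Longrightarrow> \<omega> \<in> space M \<Longrightarrow> norm (G z \<omega>) \<le> D \<omega>"
    and D: "integrable M D"
  shows "integrable M (G z0)"
    and "((\<lambda>z. \<integral>\<omega>. f z \<omega> \<partial>M) has_derivative (\<lambda>v. (\<integral>\<omega>. G z0 \<omega> \<partial>M) \<bullet> v)) (at z0)"
proof -
  have z0: "z0 \<in> ball z0 r" using r by simp
  show G: "integrable M (G z0)"
    by (rule Bochner_Integration.integrable_bound[OF D meas])
       (use bound[OF z0] in \<open>auto intro!: AE_I2 intro: order_trans[OF _ abs_ge_self]\<close>)
  (* mean value inequality on the ball, which is convex *)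
  have lip: "\<bar>f z \<omega> - f z0 \<omega>\<bar> \<le> D \<omega> * norm (z - z0)" if "z \<in> ball z0 r" "\<omega> \<in> space M" for z \<omega>
  proof -
    have "norm (f z \<omega> - f z0 \<omega>) \<le> D \<omega> * norm (z - z0)"
    proof (rule differentiable_bound[of "ball z0 r" "\<lambda>z. f z \<omega>" "\<lambda>z v. G z \<omega> \<bullet> v" "D \<omega>" z z0])
      fix y assume y: "y \<in> ball z0 r"
      show "((\<lambda>z. f z \<omega>) has_derivative (\<lambda>v. G y \<omega> \<bullet> v)) (at y within ball z0 r)"
        by (rule has_derivative_at_withinI[OF der[OF y that(2)]])
      show "onorm (\<lambda>v. G y \<omega> \<bullet> v) \<le> D \<omega>"
      proof (rule onorm_le)
        fix v show "norm (G y \<omega> \<bullet> v) \<le> D \<omega> * norm v"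
          using Cauchy_Schwarz_ineq2[of "G y \<omega>" v] mult_right_mono[OF bound[OF y that(2)], of "norm v"] by simp
      qed
    qed (use that z0 in auto)
    then show ?thesis by simp
  qed
  show "((\<lambda>z. \<integral>\<omega>. f z \<omega> \<partial>M) has_derivative (\<lambda>v. (\<integral>\<omega>. G z0 \<omega> \<partial>M) \<bullet> v)) (at z0)"
    unfolding has_derivative_iff_norm
  proof (intro conjI)
    show "bounded_linear (\<lambda>v. (\<integral>\<omega>. G z0 \<omega> \<partial>M) \<bullet> v)" by (rule bounded_linear_inner_right)
    let ?R = "\<lambda>z. norm ((\<integral>\<omega>. f z \<omega> \<partial>M) - (\<integral>\<omega>. f z0 \<omega> \<partial>M) - (\<integral>\<omega>. G z0 \<omega> \<partial>M) \<bullet> (z - z0)) / norm (z - z0)"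
    let ?q = "\<lambda>z \<omega>. (f z \<omega> - f z0 \<omega> - G z0 \<omega> \<bullet> (z - z0)) / norm (z - z0)"
    show "((\<lambda>z. ?R z) \<longlongrightarrow> 0) (at z0)"
      unfolding tendsto_at_iff_sequentially
    proof (intro allI impI)
      fix X :: "nat \<Rightarrow> 'b"
      assume X: "\<forall>i. X i \<in> UNIV - {z0}" "X \<longlonglongrightarrow> z0"
      have ev: "\<forall>\<^sub>F i in sequentially. X i \<in> ball z0 r"
        using X(2) topological_tendstoD[OF X(2) open_ball z0] by simp
      then obtain n0 where n0: "\<And>i. i \<ge> n0 \<Longrightarrow> X i \<in> ball z0 r"
        unfolding eventually_sequentially by blast
      have Xb: "X (i + n0) \<in> ball z0 r" for i by (rule n0) simp
      have "(\<lambda>i. \<integral>\<omega>. ?q (X (i + n0)) \<omega> \<partial>M) \<longlonglongrightarrow> (\<integral>\<omega>. 0 \<partial>M)"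
      proof (rule integral_dominated_convergence[where w="\<lambda>\<omega>. 2 * D \<omega>"])
        show "?q (X (i + n0)) \<in> borel_measurable M" for i
        proof -
          have [measurable]: "f (X (i + n0)) \<in> borel_measurable M" "f z0 \<in> borel_measurable M" "G z0 \<in> borel_measurable M"
            using int[OF Xb[of i]] int[OF z0] meas by (simp_all only: borel_measurable_integrable)
          show ?thesis by measurable
        qed
        show "integrable M (\<lambda>\<omega>. 2 * D \<omega>)" using D by simp
        show "AE \<omega> in M. (\<lambda>i. ?q (X (i + n0)) \<omega>) \<longlonglongrightarrow> 0"
        proof (rule AE_I2)
          fix \<omega> assume "\<omega> \<in> space M"
          then have "((\<lambda>z. norm (f z \<omega> - f z0 \<omega> - G z0 \<omega> \<bullet> (z - z0)) / norm (z - z0)) \<longlongrightarrow> 0) (at z0)"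
            using der[OF z0] unfolding has_derivative_iff_norm by blast
          then have "((\<lambda>z. norm (f z \<omega> - f z0 \<omega> - G z0 \<omega> \<bullet> (z - z0)) / norm (z - z0)) \<circ> X) \<longlonglongrightarrow> 0"
            using X unfolding tendsto_at_iff_sequentially by blast
          then have "(\<lambda>i. norm (?q (X i) \<omega>)) \<longlonglongrightarrow> 0" by (simp add: o_def)
          then have "(\<lambda>i. ?q (X i) \<omega>) \<longlonglongrightarrow> 0" by (rule tendsto_norm_zero_cancel)
          then show "(\<lambda>i. ?q (X (i + n0)) \<omega>) \<longlonglongrightarrow> 0"
            by (rule LIMSEQ_ignore_initial_segment)
        qed
        show "AE \<omega> in M. norm (?q (X (i + n0)) \<omega>) \<le> 2 * D \<omega>" for i
        proof (rule AE_I2)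
          fix \<omega> assume w: "\<omega> \<in> space M"
          let ?z = "X (i + n0)"
          have z: "?z \<in> ball z0 r" by (rule Xb)
          have nz: "norm (?z - z0) > 0" using X by simp
          have "\<bar>f ?z \<omega> - f z0 \<omega> - G z0 \<omega> \<bullet> (?z - z0)\<bar> \<le> D \<omega> * norm (?z - z0) + norm (G z0 \<omega>) * norm (?z - z0)"
            using lip[OF z w] Cauchy_Schwarz_ineq2[of "G z0 \<omega>" "?z - z0"] by linarith
          also have "\<dots> \<le> 2 * D \<omega> * norm (?z - z0)"
            using mult_right_mono[OF bound[OF z0 w] less_imp_le[OF nz]] by linarith
          finally show "norm (?q ?z \<omega>) \<le> 2 * D \<omega>"
            using nz by (simp add: divide_simps)
        qed
      qed simp_all
      then have "(\<lambda>i. norm (\<integral>\<omega>. ?q (X (i + n0)) \<omega> \<partial>M)) \<longlonglongrightarrow> 0"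
        by (intro tendsto_norm_zero) simp
      moreover have "norm (\<integral>\<omega>. ?q (X (i + n0)) \<omega> \<partial>M) =
          ?R (X (i + n0))" for i
        using int[OF Xb[of i]] int[OF z0] G by simp
      ultimately have "(\<lambda>i. ?R (X (i + n0))) \<longlonglongrightarrow> 0"
        by (simp only:)
      from LIMSEQ_offset[OF this]
      show "((\<lambda>z. ?R z) \<circ> X) \<longlonglongrightarrow> 0"
        by (simp only: o_def)
    qed
  qed
qed

section \<open>Riemann sums\<close>

lemma riemann_sum_tendsto:
  fixes f :: "real \<Rightarrow> 'b::banach"
  assumes "continuous_on {a..b} f" "a \<le> b"
  shows "(\<lambda>m. \<Sum>j<m. ((b - a) / real m) *\<^sub>R f (a + real j * ((b - a) / real m))) \<longlonglongrightarrow> integral {a..b} f"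
proof (rule LIMSEQ_I)
  fix e :: real assume e: "0 < e"
  (* the length is increased by one so that dividing by it is harmless when a = b *)
  let ?L = "b - a + 1"
  have L: "?L > 0" using assms(2) by simp
  have "uniformly_continuous_on {a..b} f"
    using compact_uniformly_continuous[OF assms(1)] by simp
  then obtain d where d: "d > 0" "\<And>x y. x \<in> {a..b} \<Longrightarrow> y \<in> {a..b} \<Longrightarrow> dist y x < d \<Longrightarrow> dist (f y) (f x) < e / ?L"
    using divide_pos_pos[OF e L] unfolding uniformly_continuous_on_def by metis
  obtain n0 :: nat where n0: "real n0 > (b - a) / d" using reals_Archimedean2 by blast
  show "\<exists>no. \<forall>m\<ge>no. norm ((\<Sum>j<m. ((b - a) / real m) *\<^sub>R f (a + real j * ((b - a) / real m))) - integral {a..b} f) < e"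
  proof (intro exI allI impI)
    fix m assume m: "m \<ge> Suc n0"
    define \<delta> where "\<delta> = (b - a) / real m"
    have \<delta>: "0 \<le> \<delta>" "\<delta> < d" "real m * \<delta> = b - a"
    proof -
      show "0 \<le> \<delta>" "real m * \<delta> = b - a" using assms(2) m by (auto simp: \<delta>_def)
      have "b - a < real n0 * d" using n0 d(1) by (simp add: divide_simps)
      also have "\<dots> \<le> real m * d" using m d(1) by (intro mult_right_mono) auto
      finally show "\<delta> < d" using m by (simp add: \<delta>_def divide_simps mult.commute)
    qed
    have sums: "norm ((\<Sum>j<k. \<delta> *\<^sub>R f (a + real j * \<delta>)) - integral {a..a + real k * \<delta>} f) \<le> real k * \<delta> * (e / ?L)" if "k \<le> m" for k
      using that
    proof (induction k)
      case (Suc k)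
      let ?s = "a + real k * \<delta>" and ?s' = "a + real (Suc k) * \<delta>"
      have s: "a \<le> ?s" "?s \<le> ?s'" "?s' \<le> b"
      proof -
        have "real (Suc k) * \<delta> \<le> real m * \<delta>" using Suc.prems \<delta>(1) by (intro mult_right_mono) auto
        then show "?s' \<le> b" using \<delta>(3) by linarith
      qed (use \<delta>(1) in \<open>auto simp: algebra_simps\<close>)
      have int: "f integrable_on {a..?s'}" "f integrable_on {?s..?s'}"
        using s by (auto intro!: integrable_continuous_interval continuous_on_subset[OF assms(1)])
      have eq: "integral {a..?s'} f = integral {a..?s} f + integral {?s..?s'} f"
        using Henstock_Kurzweil_Integration.integral_combine[OF s(1,2) int(1)] by simp
      have "norm (integral {?s..?s'} (\<lambda>x. f ?s - f x)) \<le> (e / ?L) * (?s' - ?s)"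
      proof (rule integral_bound)
        show "norm (f ?s - f x) \<le> e / ?L" if "x \<in> {?s..?s'}" for x
        proof -
          have "a \<le> x" "x \<le> b" "?s \<le> b" using that s by (simp_all only: atLeastAtMost_iff) linarith+
          moreover have "dist ?s x < d" using that \<delta>(2) by (auto simp: dist_real_def distrib_right)
          ultimately have "x \<in> {a..b}" "?s \<in> {a..b}" "dist ?s x < d" using s(1) by simp_all
          then show ?thesis using d(2)[of x ?s] by (simp add: dist_norm)
        qed
      qed (use s in \<open>auto intro!: continuous_intros continuous_on_subset[OF assms(1)]\<close>)
      moreover have "integral {?s..?s'} (\<lambda>x. f ?s - f x) = \<delta> *\<^sub>R f ?s - integral {?s..?s'} f"
        using int s by (subst integral_diff) (auto simp: algebra_simps)
      moreover have "?s' - ?s = \<delta>" by (simp add: algebra_simps)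
      ultimately have 2: "norm (\<delta> *\<^sub>R f ?s - integral {?s..?s'} f) \<le> (e / ?L) * \<delta>" by metis
      have IH: "norm ((\<Sum>j<k. \<delta> *\<^sub>R f (a + real j * \<delta>)) - integral {a..?s} f) \<le> real k * \<delta> * (e / ?L)"
        using Suc by simp
      have "(\<Sum>j<Suc k. \<delta> *\<^sub>R f (a + real j * \<delta>)) - integral {a..?s'} f
          = ((\<Sum>j<k. \<delta> *\<^sub>R f (a + real j * \<delta>)) - integral {a..?s} f) + (\<delta> *\<^sub>R f ?s - integral {?s..?s'} f)"
        unfolding eq by (simp add: algebra_simps)
      then have "norm ((\<Sum>j<Suc k. \<delta> *\<^sub>R f (a + real j * \<delta>)) - integral {a..?s'} f)
          \<le> real k * \<delta> * (e / ?L) + (e / ?L) * \<delta>"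
        using norm_triangle_mono[OF IH 2] by metis
      also have "real k * \<delta> * (e / ?L) + (e / ?L) * \<delta> = real (Suc k) * \<delta> * (e / ?L)"
        by (simp only: of_nat_Suc distrib_right) (simp only: mult_ac add_ac mult_1_left mult_1_right)
      finally show ?case .
    qed simp
    from sums[of m] have "norm ((\<Sum>j<m. \<delta> *\<^sub>R f (a + real j * \<delta>)) - integral {a..b} f) \<le> (b - a) * (e / ?L)"
      using \<delta>(3) by simp
    also have "\<dots> < e" using e L by (simp add: divide_simps)
    finally show "norm ((\<Sum>j<m. ((b - a) / real m) *\<^sub>R f (a + real j * ((b - a) / real m))) - integral {a..b} f) < e"
      unfolding \<delta>_def .
  qed
qed

section \<open>The standard Gaussian measure\<close>

lemma std_gaussian_density:
  "(\<Prod>i\<in>UNIV. std_normal_density (x $ i)) = (1 / sqrt (2 * pi)) ^ CARD('n) * exp (- (norm x)\<^sup>2 / 2)"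
  for x :: "real ^ 'n"
proof -
  have "(\<Prod>i\<in>UNIV. std_normal_density (x $ i)) = (\<Prod>i\<in>UNIV. (1 / sqrt (2 * pi)) * exp (- (x $ i)\<^sup>2 / 2))"
    by (simp add: std_normal_density_def)
  also have "\<dots> = (1 / sqrt (2 * pi)) ^ CARD('n) * exp (\<Sum>i\<in>UNIV. - (x $ i)\<^sup>2 / 2)"
    by (simp only: prod.distrib exp_sum[OF finite] prod_constant)
  also have "(\<Sum>i\<in>UNIV. - (x $ i)\<^sup>2 / 2) = - (norm x)\<^sup>2 / 2"
    unfolding power2_norm_eq_inner inner_vec_def
    by (simp add: sum_negf power2_eq_square flip: sum_divide_distrib)
  finally show ?thesis .
qed

text \<open>The normalising constant of the standard Gaussian density on \<open>real ^ 'n\<close>; only its positivity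
  matters.  The dimension is passed as a type token.\<close>

definition gauss_const :: "'n itself \<Rightarrow> real" where
  "gauss_const _ = (1 / sqrt (2 * pi)) ^ CARD('n)"

lemma gauss_const_pos: "gauss_const TYPE('n) > 0"
  by (simp add: gauss_const_def)

lemma std_gaussian_eq:
  "(std_gaussian :: (real^'n) measure) = density lborel (\<lambda>x. ennreal (gauss_const TYPE('n) * exp (- (norm x)\<^sup>2 / 2)))"
  unfolding std_gaussian_def std_gaussian_density gauss_const_def ..

lemma sets_std_gaussian [simp, measurable_cong]: "sets std_gaussian = sets borel"
  and space_std_gaussian [simp]: "space std_gaussian = UNIV"
  by (simp_all add: std_gaussian_def)

lemma nn_integral_std_gaussian:
  fixes \<psi> :: "real ^ 'n \<Rightarrow> ennreal"
  assumes [measurable]: "\<psi> \<in> borel_measurable borel"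
  shows "(\<integral>\<^sup>+z. \<psi> z \<partial>std_gaussian) = (\<integral>\<^sup>+z. ennreal (gauss_const TYPE('n) * exp (- (norm z)\<^sup>2 / 2)) * \<psi> z \<partial>lborel)"
  unfolding std_gaussian_eq by (subst nn_integral_density) auto

lemma nn_integral_lborel_affine:
  fixes f :: "'a::euclidean_space \<Rightarrow> ennreal"
  assumes [measurable]: "f \<in> borel_measurable borel" and c: "c \<noteq> 0"
  shows "(\<integral>\<^sup>+x. f x \<partial>lborel) = (\<integral>\<^sup>+x. ennreal (\<bar>c\<bar> ^ DIM('a)) * f (t + c *\<^sub>R x) \<partial>lborel)"
  by (subst lborel_affine[OF c, of t])
     (simp add: nn_integral_density nn_integral_distr ennreal_power)

lemma nn_integral_std_gaussian_affine:
  fixes \<psi> :: "real ^ 'n \<Rightarrow> ennreal"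
  assumes [measurable]: "\<psi> \<in> borel_measurable borel" and \<sigma>: "\<sigma> > 0"
  shows "(\<integral>\<^sup>+z. \<psi> (m + \<sigma> *\<^sub>R z) \<partial>std_gaussian) =
    (\<integral>\<^sup>+y. ennreal (gauss_const TYPE('n) / \<sigma> ^ CARD('n) * exp (- (norm (y - m))\<^sup>2 / (2 * \<sigma>\<^sup>2))) * \<psi> y \<partial>lborel)"
proof -
  have "(\<integral>\<^sup>+y. ennreal (gauss_const TYPE('n) / \<sigma> ^ CARD('n) * exp (- (norm (y - m))\<^sup>2 / (2 * \<sigma>\<^sup>2))) * \<psi> y \<partial>lborel)
     = (\<integral>\<^sup>+z. ennreal (\<bar>\<sigma>\<bar> ^ DIM(real^'n)) * (ennreal (gauss_const TYPE('n) / \<sigma> ^ CARD('n) * exp (- (norm ((m + \<sigma> *\<^sub>R z) - m))\<^sup>2 / (2 * \<sigma>\<^sup>2))) * \<psi> (m + \<sigma> *\<^sub>R z)) \<partial>lborel)"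
    using \<sigma> by (intro nn_integral_lborel_affine) auto
  also have "\<dots> = (\<integral>\<^sup>+z. ennreal (gauss_const TYPE('n) * exp (- (norm z)\<^sup>2 / 2)) * \<psi> (m + \<sigma> *\<^sub>R z) \<partial>lborel)"
    using \<sigma> gauss_const_pos[where 'n='n]
    by (intro nn_integral_cong)
       (simp add: mult.assoc[symmetric] ennreal_mult[symmetric] power_mult_distrib)
  also have "\<dots> = (\<integral>\<^sup>+z. \<psi> (m + \<sigma> *\<^sub>R z) \<partial>std_gaussian)"
    by (rule nn_integral_std_gaussian[symmetric]) measurable
  finally show ?thesis ..
qed

text \<open>The finite-dimensional Cameron-Martin formula.\<close>

lemma nn_integral_std_gaussian_shift:
  fixes \<psi> :: "real ^ 'n \<Rightarrow> ennreal"
  assumes [measurable]: "\<psi> \<in> borel_measurable borel"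
  shows "(\<integral>\<^sup>+z. \<psi> (z + a) \<partial>std_gaussian) = (\<integral>\<^sup>+z. ennreal (exp (a \<bullet> z - (norm a)\<^sup>2 / 2)) * \<psi> z \<partial>std_gaussian)"
proof -
  have "(\<integral>\<^sup>+z. \<psi> (z + a) \<partial>std_gaussian) = (\<integral>\<^sup>+z. \<psi> (a + 1 *\<^sub>R z) \<partial>std_gaussian)"
    by (simp add: add.commute)
  also have "\<dots> = (\<integral>\<^sup>+y. ennreal (gauss_const TYPE('n) * exp (- (norm (y - a))\<^sup>2 / 2)) * \<psi> y \<partial>lborel)"
    by (subst nn_integral_std_gaussian_affine) auto
  also have "\<dots> = (\<integral>\<^sup>+y. ennreal (gauss_const TYPE('n) * exp (- (norm y)\<^sup>2 / 2)) * (ennreal (exp (a \<bullet> y - (norm a)\<^sup>2 / 2)) * \<psi> y) \<partial>lborel)"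
  proof (intro nn_integral_cong)
    fix y :: "real^'n"
    have "- (norm (y - a))\<^sup>2 / 2 = - (norm y)\<^sup>2 / 2 + (a \<bullet> y - (norm a)\<^sup>2 / 2)"
      by (simp add: power2_norm_eq_inner inner_diff inner_commute algebra_simps add_divide_distrib diff_divide_distrib)
    then have "gauss_const TYPE('n) * exp (- (norm (y - a))\<^sup>2 / 2)
      = gauss_const TYPE('n) * exp (- (norm y)\<^sup>2 / 2) * exp (a \<bullet> y - (norm a)\<^sup>2 / 2)"
      by (simp only: exp_add mult.assoc)
    then show "ennreal (gauss_const TYPE('n) * exp (- (norm (y - a))\<^sup>2 / 2)) * \<psi> y
      = ennreal (gauss_const TYPE('n) * exp (- (norm y)\<^sup>2 / 2)) * (ennreal (exp (a \<bullet> y - (norm a)\<^sup>2 / 2)) * \<psi> y)"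
      using gauss_const_pos[where 'n='n]
      by (simp add: mult.assoc[symmetric] ennreal_mult[symmetric])
  qed
  also have "\<dots> = (\<integral>\<^sup>+z. ennreal (exp (a \<bullet> z - (norm a)\<^sup>2 / 2)) * \<psi> z \<partial>std_gaussian)"
    by (rule nn_integral_std_gaussian[symmetric]) measurable
  finally show ?thesis .
qed

lemma prob_space_std_gaussian: "prob_space (std_gaussian :: (real^'n) measure)"
proof
  have "emeasure (std_gaussian :: (real^'n) measure) UNIV
      = (\<integral>\<^sup>+x. ennreal (\<Prod>i\<in>UNIV. std_normal_density (x $ i)) \<partial>(lborel :: (real^'n) measure))"
    by (simp add: std_gaussian_def emeasure_density)
  also have "\<dots> = (\<integral>\<^sup>+x. (\<Prod>b\<in>Basis. ennreal (std_normal_density (x \<bullet> b))) \<partial>(lborel :: (real^'n) measure))"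
  proof (intro nn_integral_cong)
    fix x :: "real^'n"
    have B: "(Basis :: (real^'n) set) = (\<lambda>i. axis i 1) ` UNIV" by (auto simp: Basis_vec_def)
    have "(\<Prod>b\<in>Basis. ennreal (std_normal_density (x \<bullet> b))) = (\<Prod>i\<in>UNIV. ennreal (std_normal_density (x $ i)))"
      unfolding B by (subst prod.reindex) (auto simp: inj_on_def axis_eq_axis inner_axis)
    then show "ennreal (\<Prod>i\<in>UNIV. std_normal_density (x $ i)) = (\<Prod>b\<in>Basis. ennreal (std_normal_density (x \<bullet> b)))"
      by (simp add: prod_ennreal)
  qed
  also have "\<dots> = (\<Prod>b\<in>(Basis :: (real^'n) set). \<integral>\<^sup>+x. ennreal (std_normal_density x) \<partial>lborel)"
    by (rule nn_integral_lborel_prod) auto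
  also have "(\<integral>\<^sup>+x. ennreal (std_normal_density x) \<partial>lborel) = 1"
    using prob_space.emeasure_space_1[OF prob_space_normal_density[of 1 0]]
    by (simp add: emeasure_density)
  finally show "emeasure (std_gaussian :: (real^'n) measure) (space std_gaussian) = 1" by simp
qed

lemma nn_integral_exp_norm_std_gaussian:
  "(\<integral>\<^sup>+z. ennreal (exp (c * norm z)) \<partial>(std_gaussian :: (real^'n) measure)) < \<infinity>"
proof -
  interpret prob_space "std_gaussian :: (real^'n) measure" by (rule prob_space_std_gaussian)
  have exp_lin: "(\<integral>\<^sup>+z. ennreal (exp (a \<bullet> z)) \<partial>std_gaussian) < \<infinity>" for a :: "real^'n"
  proof -
    have "1 = (\<integral>\<^sup>+z. ennreal (exp (a \<bullet> z - (norm a)\<^sup>2 / 2)) * 1 \<partial>std_gaussian)"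
      using nn_integral_std_gaussian_shift[of "\<lambda>_. 1" a] emeasure_space_1 by simp
    also have "\<dots> = (\<integral>\<^sup>+z. ennreal (exp (- (norm a)\<^sup>2 / 2)) * ennreal (exp (a \<bullet> z)) \<partial>std_gaussian)"
      by (intro nn_integral_cong) (simp add: ennreal_mult[symmetric] exp_add[symmetric])
    also have "\<dots> = ennreal (exp (- (norm a)\<^sup>2 / 2)) * (\<integral>\<^sup>+z. ennreal (exp (a \<bullet> z)) \<partial>std_gaussian)"
      by (rule nn_integral_cmult) measurable
    finally have "ennreal (exp (- (norm a)\<^sup>2 / 2)) * (\<integral>\<^sup>+z. ennreal (exp (a \<bullet> z)) \<partial>std_gaussian) \<noteq> \<infinity>"
      by (metis ennreal_one_neq_top infinity_ennreal_def)
    then show ?thesis by (auto simp: ennreal_mult_eq_top_iff top.not_eq_extremum)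
  qed
  (* the norm is at most CARD('n) times the largest coordinate, whose exponential is dominated by
     the exponentials of the linear forms K z_i and -K z_i *)
  define K where "K = \<bar>c\<bar> * real CARD('n)"
  have "(\<integral>\<^sup>+z. ennreal (exp (c * norm z)) \<partial>(std_gaussian :: (real^'n) measure))
    \<le> (\<integral>\<^sup>+z. (\<Sum>i\<in>UNIV. ennreal (exp (axis i K \<bullet> z)) + ennreal (exp (axis i (-K) \<bullet> z))) \<partial>(std_gaussian :: (real^'n) measure))"
  proof (intro nn_integral_mono)
    fix z :: "real^'n"
    obtain i where i: "\<And>j. \<bar>z $ j\<bar> \<le> \<bar>z $ i\<bar>"
    proof -
      have "Max (range (\<lambda>j. \<bar>z $ j\<bar>)) \<in> range (\<lambda>j. \<bar>z $ j\<bar>)" by (intro Max_in) auto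
      then obtain i where "\<bar>z $ i\<bar> = Max (range (\<lambda>j. \<bar>z $ j\<bar>))" by (metis imageE)
      then have "\<bar>z $ j\<bar> \<le> \<bar>z $ i\<bar>" for j by simp
      then show thesis by (rule that)
    qed
    have "norm z \<le> (\<Sum>j\<in>UNIV. \<bar>z $ j\<bar>)" by (rule norm_le_l1_cart)
    also have "\<dots> \<le> real CARD('n) * \<bar>z $ i\<bar>" using sum_bounded_above[of UNIV "\<lambda>j. \<bar>z $ j\<bar>" "\<bar>z $ i\<bar>"] i by simp
    finally have "c * norm z \<le> K * \<bar>z $ i\<bar>"
      unfolding K_def mult.assoc by (intro mult_mono) auto
    then have "exp (c * norm z) \<le> exp (K * \<bar>z $ i\<bar>)" by simp
    also have "\<dots> \<le> exp (axis i K \<bullet> z) + exp (axis i (-K) \<bullet> z)"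
      by (cases "z $ i \<ge> 0") (auto simp: inner_axis' add_increasing add_increasing2)
    finally have "ennreal (exp (c * norm z)) \<le> ennreal (exp (axis i K \<bullet> z)) + ennreal (exp (axis i (-K) \<bullet> z))"
      by (simp add: ennreal_plus[symmetric] ennreal_leI del: ennreal_plus)
    also have "\<dots> \<le> (\<Sum>i\<in>UNIV. ennreal (exp (axis i K \<bullet> z)) + ennreal (exp (axis i (-K) \<bullet> z)))"
      by (rule member_le_sum) auto
    finally show "ennreal (exp (c * norm z)) \<le> (\<Sum>i\<in>UNIV. ennreal (exp (axis i K \<bullet> z)) + ennreal (exp (axis i (-K) \<bullet> z)))" .
  qed
  also have "\<dots> = (\<Sum>i\<in>UNIV. (\<integral>\<^sup>+z. ennreal (exp (axis i K \<bullet> z)) \<partial>std_gaussian) + (\<integral>\<^sup>+z. ennreal (exp (axis i (-K) \<bullet> z)) \<partial>(std_gaussian :: (real^'n) measure)))"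
    by (subst nn_integral_sum; simp add: nn_integral_add)
  also have "\<dots> < \<infinity>" using exp_lin by (simp add: less_top)
  finally show ?thesis .
qed

text \<open>The centred Gaussian law with covariance matrix \<open>v\<close> times the identity.\<close>

definition gauss :: "real \<Rightarrow> (real ^ 'n) measure" where
  "gauss v = distr std_gaussian borel (\<lambda>z. sqrt v *\<^sub>R z)"

lemma sets_gauss [simp, measurable_cong]: "sets (gauss v) = sets borel"
  and space_gauss [simp]: "space (gauss v) = UNIV"
  by (simp_all add: gauss_def)

lemma nn_integral_gauss:
  "\<psi> \<in> borel_measurable borel \<Longrightarrow> (\<integral>\<^sup>+z. \<psi> z \<partial>gauss v) = (\<integral>\<^sup>+z. \<psi> (sqrt v *\<^sub>R z) \<partial>std_gaussian)"
  unfolding gauss_def by (subst nn_integral_distr) auto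

lemma prob_space_gauss: "prob_space (gauss v :: (real^'n) measure)"
  unfolding gauss_def by (rule prob_space.prob_space_distr[OF prob_space_std_gaussian]) measurable

lemma nn_integral_gauss_shift:
  fixes \<psi> :: "real ^ 'n \<Rightarrow> ennreal"
  assumes [measurable]: "\<psi> \<in> borel_measurable borel" and v: "v > 0"
  shows "(\<integral>\<^sup>+z. \<psi> (z + a) \<partial>gauss v) = (\<integral>\<^sup>+z. ennreal (exp (a \<bullet> z / v - (norm a)\<^sup>2 / (2 * v))) * \<psi> z \<partial>gauss v)"
proof -
  have sv: "inverse (sqrt v) = sqrt v / v" using v by (simp add: field_simps)
  have vv: "v * y / (v\<^sup>2 * 2) = y / (2 * v)" for y using v by (simp add: power2_eq_square)
  have "(\<integral>\<^sup>+z. \<psi> (z + a) \<partial>gauss v) = (\<integral>\<^sup>+z. \<psi> (sqrt v *\<^sub>R (z + a /\<^sub>R sqrt v)) \<partial>std_gaussian)"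
    using v by (subst nn_integral_gauss) (auto simp: scaleR_add_right)
  also have "\<dots> = (\<integral>\<^sup>+z. ennreal (exp ((a /\<^sub>R sqrt v) \<bullet> z - (norm (a /\<^sub>R sqrt v))\<^sup>2 / 2)) * \<psi> (sqrt v *\<^sub>R z) \<partial>std_gaussian)"
    by (rule nn_integral_std_gaussian_shift) measurable
  also have "\<dots> = (\<integral>\<^sup>+z. ennreal (exp (a \<bullet> (sqrt v *\<^sub>R z) / v - (norm a)\<^sup>2 / (2 * v))) * \<psi> (sqrt v *\<^sub>R z) \<partial>std_gaussian)"
    using v by (intro nn_integral_cong) (simp add: power_mult_distrib power_divide sv vv)
  also have "\<dots> = (\<integral>\<^sup>+z. ennreal (exp (a \<bullet> z / v - (norm a)\<^sup>2 / (2 * v))) * \<psi> z \<partial>gauss v)"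
    by (subst nn_integral_gauss) auto
  finally show ?thesis .
qed

text \<open>Finite Borel measures on a metric space are determined by the integrals of bounded
  continuous functions: closed sets are approximated from above.\<close>

lemma measure_eqI_bounded_continuous:
  fixes \<mu> \<nu> :: "'a::metric_space measure"
  assumes [simp]: "sets \<mu> = sets borel" "sets \<nu> = sets borel"
    and fin: "finite_measure \<mu>" "finite_measure \<nu>"
    and eq: "\<And>\<phi> :: 'a \<Rightarrow> real. continuous_on UNIV \<phi> \<Longrightarrow> (\<And>x. 0 \<le> \<phi> x \<and> \<phi> x \<le> 1) \<Longrightarrow> (\<integral>x. \<phi> x \<partial>\<mu>) = (\<integral>x. \<phi> x \<partial>\<nu>)"
  shows "\<mu> = \<nu>"
proof -
  interpret \<mu>: finite_measure \<mu> by fact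
  interpret \<nu>: finite_measure \<nu> by fact
  have [simp]: "space \<mu> = UNIV" "space \<nu> = UNIV" using sets_eq_imp_space_eq[of \<mu> borel] sets_eq_imp_space_eq[of \<nu> borel] by auto
  have [measurable_cong]: "sets \<mu> = sets borel" "sets \<nu> = sets borel" by auto
  have tot: "measure \<mu> UNIV = measure \<nu> UNIV" using eq[of "\<lambda>_. 1"] by simp
  have closed: "emeasure \<mu> C = emeasure \<nu> C" if C: "closed C" for C
  proof (cases "C = {}")
    case False
    define \<phi> where "\<phi> k x = max 0 (1 - real k * infdist x C)" for k x
    have cont: "continuous_on UNIV (\<phi> k)" for k
      unfolding \<phi>_def by (intro continuous_intros)
    have bnd: "0 \<le> \<phi> k x \<and> \<phi> k x \<le> 1" for k x
      unfolding \<phi>_def using infdist_nonneg[of x C] by auto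
    have lim: "(\<lambda>k. \<phi> k x) \<longlonglongrightarrow> indicator C x" for x
    proof (cases "x \<in> C")
      case True then show ?thesis by (simp add: \<phi>_def)
    next
      case False
      then have pos: "infdist x C > 0" using C \<open>C \<noteq> {}\<close> by (metis in_closed_iff_infdist_zero infdist_nonneg less_eq_real_def)
      obtain k0 :: nat where k0: "1 / infdist x C < real k0" using reals_Archimedean2 by blast
      have "\<phi> k x = 0" if "k \<ge> k0" for k
      proof -
        have "1 < real k0 * infdist x C" using k0 pos by (simp add: divide_simps)
        also have "\<dots> \<le> real k * infdist x C" using that pos by (intro mult_right_mono) auto
        finally show ?thesis by (simp add: \<phi>_def)
      qed
      then have "(\<lambda>k. \<phi> k x) \<longlonglongrightarrow> 0"
        by (intro tendsto_eventually) (auto simp: eventually_sequentially)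
      then show ?thesis using False by simp
    qed
    have [measurable]: "C \<in> sets borel" using C by simp
    have [measurable]: "\<phi> k \<in> borel_measurable borel" for k
      by (rule borel_measurable_continuous_onI[OF cont])
    have "(\<lambda>k. \<integral>x. \<phi> k x \<partial>\<mu>) \<longlonglongrightarrow> (\<integral>x. indicator C x \<partial>\<mu>)"
      by (rule integral_dominated_convergence[where w="\<lambda>_. 1"]) (use lim bnd in auto)
    moreover have "(\<lambda>k. \<integral>x. \<phi> k x \<partial>\<nu>) \<longlonglongrightarrow> (\<integral>x. indicator C x \<partial>\<nu>)"
      by (rule integral_dominated_convergence[where w="\<lambda>_. 1"]) (use lim bnd in auto)
    ultimately have "(\<integral>x. indicator C x \<partial>\<mu>) = (\<integral>x. (indicator C x :: real) \<partial>\<nu>)"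
      unfolding eq[OF cont bnd] by (rule LIMSEQ_unique)
    then have "measure \<mu> C = measure \<nu> C" by simp
    then show ?thesis by (simp add: \<mu>.emeasure_eq_measure \<nu>.emeasure_eq_measure)
  qed simp
  show ?thesis
  proof (rule measure_eqI_generator_eq[where E="Collect closed" and \<Omega>=UNIV and A="\<lambda>_. UNIV"])
    show "sets \<mu> = sigma_sets UNIV (Collect closed)" "sets \<nu> = sigma_sets UNIV (Collect closed)"
      by (simp_all add: borel_eq_closed)
  qed (auto simp: Int_stable_def closed)
qed

section \<open>Variables independent of a sub-sigma-algebra\<close>

text \<open>\<open>D\<close> is independent of the sub-sigma-algebra \<open>G\<close> and has law \<open>\<nu>\<close>, in one product formula: the
  choice \<open>A = space M\<close> gives the law.\<close>

definition indep_law :: "'a measure \<Rightarrow> 'a measure \<Rightarrow> ('a \<Rightarrow> 'b::topological_space) \<Rightarrow> 'b measure \<Rightarrow> bool" where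
  "indep_law M G D \<nu> \<longleftrightarrow> D \<in> borel_measurable M \<and>
     (\<forall>A\<in>sets G. \<forall>C\<in>sets borel. emeasure M (A \<inter> (D -` C \<inter> space M)) = emeasure M A * emeasure \<nu> C)"

text \<open>Freezing: a variable that is independent of \<open>G\<close> may be integrated out while the
  \<open>G\<close>-measurable quantities are kept fixed.\<close>

lemma nn_integral_indep_law:
  fixes D :: "'a \<Rightarrow> 'b::topological_space"
  assumes M: "prob_space M" and G: "subalgebra M G"
    and D: "indep_law M G D \<nu>" and \<nu>: "prob_space \<nu>" "sets \<nu> = sets borel"
    and \<Phi>: "case_prod \<Phi> \<in> borel_measurable (G \<Otimes>\<^sub>M borel)"
  shows "(\<integral>\<^sup>+\<omega>. \<Phi> \<omega> (D \<omega>) \<partial>M) = (\<integral>\<^sup>+\<omega>. \<integral>\<^sup>+w. \<Phi> \<omega> w \<partial>\<nu> \<partial>M)"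
proof -
  let ?R = "restr_to_subalg M G"
  interpret R: prob_space ?R
    using prob_space_restr_to_subalg[OF G M] .
  interpret \<nu>: prob_space \<nu> by fact
  have sp: "space G = space M" and sub: "sets G \<subseteq> sets M" using G by (auto simp: subalgebra_def)
  have D_meas: "D \<in> borel_measurable M" using D by (simp add: indep_law_def)
  have idG: "(\<lambda>\<omega>. \<omega>) \<in> measurable M G"
    using G by (intro measurableI) (auto simp: subalgebra_def dest: sets.sets_into_space intro!: sets.Int)
  have pair: "(\<lambda>\<omega>. (\<omega>, D \<omega>)) \<in> measurable M (G \<Otimes>\<^sub>M borel)"
    using idG D_meas by (rule measurable_Pair)
  have sets_R: "sets ?R = sets G" using G by (rule sets_restr_to_subalg)
  have eq: "?R \<Otimes>\<^sub>M \<nu> = distr M (G \<Otimes>\<^sub>M borel) (\<lambda>\<omega>. (\<omega>, D \<omega>))"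
  proof (rule pair_measure_eqI)
    show "sigma_finite_measure ?R" "sigma_finite_measure \<nu>" by unfold_locales
    show "sets (?R \<Otimes>\<^sub>M \<nu>) = sets (distr M (G \<Otimes>\<^sub>M borel) (\<lambda>\<omega>. (\<omega>, D \<omega>)))"
      using sets_R \<nu>(2) by (simp cong: sets_pair_measure_cong)
    fix A C assume A: "A \<in> sets ?R" and C: "C \<in> sets \<nu>"
    have A': "A \<in> sets G" using A sets_R by simp
    have C': "C \<in> sets borel" using C \<nu>(2) by simp
    have "emeasure (distr M (G \<Otimes>\<^sub>M borel) (\<lambda>\<omega>. (\<omega>, D \<omega>))) (A \<times> C)
        = emeasure M ((\<lambda>\<omega>. (\<omega>, D \<omega>)) -` (A \<times> C) \<inter> space M)"
      using A' C' by (intro emeasure_distr pair) simp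
    also have "(\<lambda>\<omega>. (\<omega>, D \<omega>)) -` (A \<times> C) \<inter> space M = A \<inter> (D -` C \<inter> space M)" by auto
    also have "emeasure M \<dots> = emeasure M A * emeasure \<nu> C"
      using D A' C' by (simp add: indep_law_def)
    also have "emeasure M A = emeasure ?R A" using G A' by (simp add: emeasure_restr_to_subalg)
    finally show "emeasure ?R A * emeasure \<nu> C = emeasure (distr M (G \<Otimes>\<^sub>M borel) (\<lambda>\<omega>. (\<omega>, D \<omega>))) (A \<times> C)" ..
  qed
  have sets_pair: "sets (?R \<Otimes>\<^sub>M \<nu>) = sets (G \<Otimes>\<^sub>M borel)" using sets_R \<nu>(2) by (simp cong: sets_pair_measure_cong)
  have \<Phi>': "case_prod \<Phi> \<in> borel_measurable (?R \<Otimes>\<^sub>M \<nu>)"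
    using \<Phi> by (simp cong: measurable_cong_sets[OF sets_pair refl])
  have "(\<integral>\<^sup>+\<omega>. \<Phi> \<omega> (D \<omega>) \<partial>M) = (\<integral>\<^sup>+p. case_prod \<Phi> p \<partial>distr M (G \<Otimes>\<^sub>M borel) (\<lambda>\<omega>. (\<omega>, D \<omega>)))"
    by (subst nn_integral_distr[OF pair]) (use \<Phi> in simp_all)
  also have "\<dots> = (\<integral>\<^sup>+p. case_prod \<Phi> p \<partial>(?R \<Otimes>\<^sub>M \<nu>))" unfolding eq ..
  also have "\<dots> = (\<integral>\<^sup>+\<omega>. \<integral>\<^sup>+w. \<Phi> \<omega> w \<partial>\<nu> \<partial>?R)"
    using \<nu>.nn_integral_fst[OF \<Phi>'] by simp
  also have "\<dots> = (\<integral>\<^sup>+\<omega>. \<integral>\<^sup>+w. \<Phi> \<omega> w \<partial>\<nu> \<partial>M)"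
  proof (rule nn_integral_subalgebra2[OF G])
    have "(\<lambda>\<omega>. \<integral>\<^sup>+w. \<Phi> \<omega> w \<partial>\<nu>) \<in> borel_measurable ?R"
      using \<nu>.borel_measurable_nn_integral_fst[OF \<Phi>'] by simp
    then show "(\<lambda>\<omega>. \<integral>\<^sup>+w. \<Phi> \<omega> w \<partial>\<nu>) \<in> borel_measurable G"
      by (simp cong: measurable_cong_sets[OF sets_R refl])
  qed
  finally show ?thesis .
qed

lemma nn_integral_indep_law_marginal:
  fixes D :: "'a \<Rightarrow> 'b::topological_space"
  assumes M: "prob_space M" and G: "subalgebra M G"
    and D: "indep_law M G D \<nu>" and \<nu>: "prob_space \<nu>" "sets \<nu> = sets borel"
    and [measurable]: "\<psi> \<in> borel_measurable borel"
  shows "(\<integral>\<^sup>+\<omega>. \<psi> (D \<omega>) \<partial>M) = (\<integral>\<^sup>+w. \<psi> w \<partial>\<nu>)"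
proof -
  interpret prob_space M by fact
  show ?thesis
    using nn_integral_indep_law[OF M G D \<nu>, of "\<lambda>_. \<psi>"] by (simp add: emeasure_space_1)
qed

lemma indep_law_scaleR:
  fixes D :: "'a \<Rightarrow> real^'n"
  assumes D: "indep_law M G D (gauss v)" and c: "c \<ge> 0"
  shows "indep_law M G (\<lambda>\<omega>. c *\<^sub>R D \<omega>) (gauss (c\<^sup>2 * v))"
  unfolding indep_law_def
proof (intro conjI ballI)
  have [measurable]: "D \<in> borel_measurable M" using D by (simp add: indep_law_def)
  show "(\<lambda>\<omega>. c *\<^sub>R D \<omega>) \<in> borel_measurable M" by measurable
  fix A and C :: "(real^'n) set" assume A: "A \<in> sets G" and C[measurable]: "C \<in> sets borel"
  have C': "(\<lambda>z. c *\<^sub>R z) -` C \<in> sets borel"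
    using measurable_sets_borel[of "\<lambda>z::real^'n. c *\<^sub>R z" borel C] C by simp
  have "(\<lambda>\<omega>. c *\<^sub>R D \<omega>) -` C \<inter> space M = D -` ((\<lambda>z. c *\<^sub>R z) -` C) \<inter> space M" by auto
  moreover have "emeasure (gauss (c\<^sup>2 * v)) C = emeasure (gauss v) ((\<lambda>z. c *\<^sub>R z) -` C)"
    unfolding gauss_def using C C' c
    by (simp add: emeasure_distr real_sqrt_mult vimage_def)
  ultimately show "emeasure M (A \<inter> ((\<lambda>\<omega>. c *\<^sub>R D \<omega>) -` C \<inter> space M)) = emeasure M A * emeasure (gauss (c\<^sup>2 * v)) C"
    using D A C' by (simp add: indep_law_def)
qed

text \<open>Almost sure limits of centred isotropic Gaussian variables independent of \<open>G\<close> are of the same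
  kind, provided that the variances converge.\<close>

lemma indep_law_gauss_limit:
  fixes \<xi> :: "'a \<Rightarrow> real^'n"
  assumes M: "prob_space M" and G: "subalgebra M G"
    and \<xi>k: "\<And>k. indep_law M G (\<xi>k k) (gauss (vk k))"
    and \<xi>[measurable]: "\<xi> \<in> borel_measurable M"
    and lim: "AE \<omega> in M. (\<lambda>k. \<xi>k k \<omega>) \<longlonglongrightarrow> \<xi> \<omega>" and v: "vk \<longlonglongrightarrow> v"
  shows "indep_law M G \<xi> (gauss v)"
  unfolding indep_law_def
proof (intro conjI ballI)
  show "\<xi> \<in> borel_measurable M" by fact
  interpret prob_space M by fact
  interpret \<gamma>: prob_space "std_gaussian :: (real^'n) measure" by (rule prob_space_std_gaussian)
  interpret gv: prob_space "gauss v :: (real^'n) measure" by (rule prob_space_gauss)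
  fix A and C :: "(real^'n) set" assume A: "A \<in> sets G" and C[measurable]: "C \<in> sets borel"
  have A'[measurable]: "A \<in> sets M" using A G by (auto simp: subalgebra_def)
  have [measurable]: "\<xi>k k \<in> borel_measurable M" for k using \<xi>k[of k] by (simp add: indep_law_def)
  define \<mu> where "\<mu> = distr (density M (\<lambda>\<omega>. ennreal (indicator A \<omega>))) borel \<xi>"
  define \<nu> where "\<nu> = density (gauss v :: (real^'n) measure) (\<lambda>_. ennreal (prob A))"
  have "\<mu> = \<nu>"
  proof (rule measure_eqI_bounded_continuous)
    show "sets \<mu> = sets borel" "sets \<nu> = sets borel" by (simp_all add: \<mu>_def \<nu>_def)
    have \<mu>_eq: "emeasure \<mu> D = emeasure M (A \<inter> (\<xi> -` D \<inter> space M))" if [measurable]: "D \<in> sets borel" for D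
    proof -
      have "emeasure \<mu> D = (\<integral>\<^sup>+\<omega>. ennreal (indicator A \<omega>) * indicator (\<xi> -` D \<inter> space M) \<omega> \<partial>M)"
        unfolding \<mu>_def by (subst emeasure_distr) (auto simp: emeasure_density)
      also have "\<dots> = (\<integral>\<^sup>+\<omega>. indicator (A \<inter> (\<xi> -` D \<inter> space M)) \<omega> \<partial>M)"
        by (intro nn_integral_cong) (auto simp: indicator_def)
      finally show ?thesis by simp
    qed
    show "finite_measure \<mu>"
      by (intro finite_measureI) (simp add: \<mu>_def[THEN arg_cong, of space] \<mu>_eq[of UNIV, simplified])
    show "finite_measure \<nu>"
      by (intro finite_measureI) (simp add: \<nu>_def emeasure_density nn_integral_cmult ennreal_mult_eq_top_iff)
    fix \<phi> :: "real^'n \<Rightarrow> real" assume cont: "continuous_on UNIV \<phi>" and bnd: "\<And>x. 0 \<le> \<phi> x \<and> \<phi> x \<le> 1"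
    have [measurable]: "\<phi> \<in> borel_measurable borel" using cont by (rule borel_measurable_continuous_onI)
    have eqk: "(\<integral>\<omega>. indicator A \<omega> * \<phi> (\<xi>k k \<omega>) \<partial>M) = prob A * (\<integral>z. \<phi> (sqrt (vk k) *\<^sub>R z) \<partial>std_gaussian)" for k
    proof -
      have AG[measurable]: "A \<in> sets G" by (rule A)
      have "(\<integral>\<^sup>+\<omega>. indicator A \<omega> * ennreal (\<phi> (\<xi>k k \<omega>)) \<partial>M) = (\<integral>\<^sup>+\<omega>. \<integral>\<^sup>+w. indicator A \<omega> * ennreal (\<phi> w) \<partial>gauss (vk k) \<partial>M)"
        by (rule nn_integral_indep_law[OF M G \<xi>k prob_space_gauss]) (simp, measurable)
      also have "\<dots> = (\<integral>\<^sup>+\<omega>. indicator A \<omega> * (\<integral>\<^sup>+w. ennreal (\<phi> w) \<partial>gauss (vk k)) \<partial>M)"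
        by (intro nn_integral_cong nn_integral_cmult) simp
      also have "\<dots> = emeasure M A * (\<integral>\<^sup>+w. ennreal (\<phi> w) \<partial>gauss (vk k))"
        by (subst nn_integral_multc) auto
      also have "(\<integral>\<^sup>+w. ennreal (\<phi> w) \<partial>gauss (vk k)) = (\<integral>\<^sup>+z. ennreal (\<phi> (sqrt (vk k) *\<^sub>R z)) \<partial>std_gaussian)"
        by (subst nn_integral_gauss) auto
      finally have *: "(\<integral>\<^sup>+\<omega>. indicator A \<omega> * ennreal (\<phi> (\<xi>k k \<omega>)) \<partial>M) = emeasure M A * (\<integral>\<^sup>+z. ennreal (\<phi> (sqrt (vk k) *\<^sub>R z)) \<partial>std_gaussian)" .
      have "(\<integral>\<omega>. indicator A \<omega> * \<phi> (\<xi>k k \<omega>) \<partial>M) = enn2real (\<integral>\<^sup>+\<omega>. ennreal (indicator A \<omega> * \<phi> (\<xi>k k \<omega>)) \<partial>M)"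
        using bnd by (intro integral_eq_nn_integral) auto
      also have "(\<integral>\<^sup>+\<omega>. ennreal (indicator A \<omega> * \<phi> (\<xi>k k \<omega>)) \<partial>M) = (\<integral>\<^sup>+\<omega>. indicator A \<omega> * ennreal (\<phi> (\<xi>k k \<omega>)) \<partial>M)"
        by (intro nn_integral_cong) (auto simp: indicator_def)
      also have "enn2real \<dots> = prob A * (\<integral>z. \<phi> (sqrt (vk k) *\<^sub>R z) \<partial>std_gaussian)"
        unfolding * using bnd by (subst integral_eq_nn_integral) (auto simp: enn2real_mult measure_def)
      finally show ?thesis .
    qed
    have cont_seq: "(\<lambda>k. \<phi> (f k)) \<longlonglongrightarrow> \<phi> l" if "f \<longlonglongrightarrow> l" for f l
      using cont that by (auto intro: isCont_tendsto_compose simp: continuous_on_eq_continuous_at)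
    have "(\<lambda>k. \<integral>\<omega>. indicator A \<omega> * \<phi> (\<xi>k k \<omega>) \<partial>M) \<longlonglongrightarrow> (\<integral>\<omega>. indicator A \<omega> * \<phi> (\<xi> \<omega>) \<partial>M)"
    proof (rule integral_dominated_convergence[where w="\<lambda>_. 1"])
      show "AE \<omega> in M. (\<lambda>k. indicator A \<omega> * \<phi> (\<xi>k k \<omega>)) \<longlonglongrightarrow> indicator A \<omega> * \<phi> (\<xi> \<omega>)"
        using lim by eventually_elim (intro tendsto_mult tendsto_const cont_seq)
    qed (use bnd in \<open>auto simp: indicator_def\<close>)
    moreover have "(\<lambda>k. prob A * (\<integral>z. \<phi> (sqrt (vk k) *\<^sub>R z) \<partial>std_gaussian)) \<longlonglongrightarrow> prob A * (\<integral>z. \<phi> (sqrt v *\<^sub>R z) \<partial>std_gaussian)"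
    proof (intro tendsto_mult tendsto_const integral_dominated_convergence[where w="\<lambda>_. 1"])
      show "AE z in std_gaussian. (\<lambda>k. \<phi> (sqrt (vk k) *\<^sub>R z)) \<longlonglongrightarrow> \<phi> (sqrt v *\<^sub>R z)"
        using v by (intro AE_I2 cont_seq tendsto_intros)
    qed (use bnd in auto)
    ultimately have "(\<integral>\<omega>. indicator A \<omega> * \<phi> (\<xi> \<omega>) \<partial>M) = prob A * (\<integral>z. \<phi> (sqrt v *\<^sub>R z) \<partial>std_gaussian)"
      unfolding eqk by (rule LIMSEQ_unique)
    then show "(\<integral>x. \<phi> x \<partial>\<mu>) = (\<integral>x. \<phi> x \<partial>\<nu>)"
      unfolding \<mu>_def \<nu>_def
      by (subst integral_distr) (auto simp: integral_density gauss_def integral_distr)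
  qed
  then have "emeasure \<mu> C = emeasure \<nu> C" by simp
  moreover have "emeasure \<mu> C = emeasure M (A \<inter> (\<xi> -` C \<inter> space M))"
  proof -
    have "emeasure \<mu> C = (\<integral>\<^sup>+\<omega>. ennreal (indicator A \<omega>) * indicator (\<xi> -` C \<inter> space M) \<omega> \<partial>M)"
      unfolding \<mu>_def by (subst emeasure_distr) (auto simp: emeasure_density)
    also have "\<dots> = (\<integral>\<^sup>+\<omega>. indicator (A \<inter> (\<xi> -` C \<inter> space M)) \<omega> \<partial>M)"
      by (intro nn_integral_cong) (auto simp: indicator_def)
    finally show ?thesis by simp
  qed
  moreover have "emeasure \<nu> C = emeasure M A * emeasure (gauss v) C"
    by (simp add: \<nu>_def emeasure_density nn_integral_cmult emeasure_eq_measure)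
  ultimately show "emeasure M (A \<inter> (\<xi> -` C \<inter> space M)) = emeasure M A * emeasure (gauss v) C" by simp
qed

section \<open>Brownian motion and the Ornstein-Uhlenbeck family\<close>

text \<open>The equation is solved pathwise: \<open>exp(t) \<integral>\<^sub>0\<^sup>t y\<close> has derivative \<open>exp(t) (x + sqrt 2 b(t))\<close>.\<close>

lemma ou_path_explicit:
  fixes b y :: "real \<Rightarrow> 'v::euclidean_space"
  assumes b: "continuous_on {0..} b" and y: "continuous_on {0..} y"
    and eq: "\<And>t. t \<ge> 0 \<Longrightarrow> y t = x + sqrt 2 *\<^sub>R b t - integral {0..t} y" and t: "t \<ge> 0"
  shows "y t = exp (-t) *\<^sub>R x + sqrt 2 *\<^sub>R (b t - exp (-t) *\<^sub>R integral {0..t} (\<lambda>r. exp r *\<^sub>R b r))"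
proof -
  have cy: "continuous_on {0..t} y" and cb: "continuous_on {0..t} b"
    using y b by (auto elim: continuous_on_subset)
  let ?I = "\<lambda>u. integral {0..u} y"
  have "((\<lambda>u. exp u *\<^sub>R (x + sqrt 2 *\<^sub>R b u)) has_integral (exp t *\<^sub>R ?I t - exp 0 *\<^sub>R ?I 0)) {0..t}"
  proof (rule fundamental_theorem_of_calculus[OF t])
    fix u assume u: "u \<in> {0..t}"
    have "(?I has_vector_derivative y u) (at u within {0..t})"
      by (rule integral_has_vector_derivative[OF cy u])
    then have "((\<lambda>u. exp u *\<^sub>R ?I u) has_vector_derivative (exp u *\<^sub>R y u + exp u *\<^sub>R ?I u)) (at u within {0..t})"
      by (intro has_vector_derivative_scaleR) (auto intro!: DERIV_subset[OF DERIV_exp])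
    also have "exp u *\<^sub>R y u + exp u *\<^sub>R ?I u = exp u *\<^sub>R (x + sqrt 2 *\<^sub>R b u)"
      using u by (subst eq) (auto simp: scaleR_right_diff_distrib)
    finally show "((\<lambda>u. exp u *\<^sub>R ?I u) has_vector_derivative exp u *\<^sub>R (x + sqrt 2 *\<^sub>R b u)) (at u within {0..t})" .
  qed
  then have 1: "exp t *\<^sub>R ?I t = integral {0..t} (\<lambda>u. exp u *\<^sub>R (x + sqrt 2 *\<^sub>R b u))"
    by (simp add: integral_unique)
  have "(exp has_integral (exp t - exp 0)) {0..t}"
    by (rule fundamental_theorem_of_calculus[OF t])
       (auto simp: has_real_derivative_iff_has_vector_derivative[symmetric] intro!: DERIV_subset[OF DERIV_exp])
  then have ex: "((\<lambda>u. exp u *\<^sub>R x) has_integral ((exp t - 1) *\<^sub>R x)) {0..t}"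
    using has_integral_scaleR_left[of exp "exp t - exp 0" "{0..t}" x] by simp
  have "integral {0..t} (\<lambda>u. exp u *\<^sub>R (x + sqrt 2 *\<^sub>R b u))
      = integral {0..t} (\<lambda>u. exp u *\<^sub>R x + sqrt 2 *\<^sub>R (exp u *\<^sub>R b u))"
    by (simp add: scaleR_right_distrib mult.commute)
  also have "\<dots> = integral {0..t} (\<lambda>u. exp u *\<^sub>R x) + integral {0..t} (\<lambda>u. sqrt 2 *\<^sub>R (exp u *\<^sub>R b u))"
    using cb by (intro integral_add integrable_continuous_interval continuous_intros)
  also have "\<dots> = (exp t - 1) *\<^sub>R x + sqrt 2 *\<^sub>R integral {0..t} (\<lambda>u. exp u *\<^sub>R b u)"
    using ex by (simp add: integral_unique del: scaleR_scaleR)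
  finally have 2: "exp t *\<^sub>R ?I t = (exp t - 1) *\<^sub>R x + sqrt 2 *\<^sub>R integral {0..t} (\<lambda>u. exp u *\<^sub>R b u)"
    using 1 by simp
  have "?I t = exp (-t) *\<^sub>R (exp t *\<^sub>R ?I t)"
    by (simp add: exp_minus)
  also have "\<dots> = (1 - exp (-t)) *\<^sub>R x + sqrt 2 *\<^sub>R (exp (-t) *\<^sub>R integral {0..t} (\<lambda>u. exp u *\<^sub>R b u))"
    unfolding 2 by (simp add: scaleR_right_distrib exp_minus algebra_simps)
  finally show ?thesis
    by (subst eq[OF t]) (simp add: algebra_simps)
qed

text \<open>The limit is the integral of \<open>exp(u - t)\<close> against \<open>df(u)\<close> over \<open>[s, t]\<close>, integrated by parts so that it
  makes sense for continuous \<open>f\<close>.\<close>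

lemma ou_innovation_sum_tendsto:
  fixes f :: "real \<Rightarrow> 'v::euclidean_space"
  assumes f: "continuous_on {0..} f" and st: "0 \<le> s" "s < t"
  defines "r \<equiv> \<lambda>m j. s + real j * ((t - s) / real m)"
  shows "(\<lambda>m. \<Sum>j<m. exp (r m j - t) *\<^sub>R (f (r m (Suc j)) - f (r m j))) \<longlonglongrightarrow>
    f t - exp (s - t) *\<^sub>R f s - exp (-t) *\<^sub>R integral {s..t} (\<lambda>u. exp u *\<^sub>R f u)"
proof -
  define \<delta> where "\<delta> m = (t - s) / real m" for m
  define E where "E m j = exp (r m j - t)" for m j
  (* summation by parts; on a uniform grid the weights are geometric, so their increments are
     multiples of the weights themselves and a plain Riemann sum remains *)
  have abel: "(\<Sum>j<m. E m j *\<^sub>R (f (r m (Suc j)) - f (r m j)))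
      = ((exp (- \<delta> m) - 1) / \<delta> m) *\<^sub>R (\<Sum>j<m. \<delta> m *\<^sub>R (E m j *\<^sub>R f (r m j)))
        + exp (- \<delta> m) *\<^sub>R (f t - exp (s - t) *\<^sub>R f s)" if m: "m > 0" for m
  proof -
    have \<delta>: "\<delta> m > 0" using m st by (simp add: \<delta>_def)
    have E: "E m j = exp (- \<delta> m) * E m (Suc j)" for j
    proof -
      have "r m j - t = - \<delta> m + (r m (Suc j) - t)" by (simp add: r_def \<delta>_def distrib_right add_divide_distrib)
      then show ?thesis unfolding E_def exp_add[symmetric] by simp
    qed
    have rm: "r m m = t" "r m 0 = s" using m by (auto simp: r_def)
    have "(\<Sum>j<m. E m j *\<^sub>R (f (r m (Suc j)) - f (r m j)))
       = (\<Sum>j<m. E m j *\<^sub>R f (r m (Suc j))) - (\<Sum>j<m. E m j *\<^sub>R f (r m j))"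
      by (simp add: scaleR_right_diff_distrib sum_subtractf)
    also have "(\<Sum>j<m. E m j *\<^sub>R f (r m (Suc j))) = exp (- \<delta> m) *\<^sub>R (\<Sum>j<m. E m (Suc j) *\<^sub>R f (r m (Suc j)))"
      unfolding scaleR_sum_right scaleR_scaleR E[symmetric] ..
    also have "(\<Sum>j<m. E m (Suc j) *\<^sub>R f (r m (Suc j))) = (\<Sum>j<m. E m j *\<^sub>R f (r m j)) + (E m m *\<^sub>R f (r m m) - E m 0 *\<^sub>R f (r m 0))"
    proof -
      have "(\<Sum>j<Suc m. E m j *\<^sub>R f (r m j)) = E m 0 *\<^sub>R f (r m 0) + (\<Sum>j<m. E m (Suc j) *\<^sub>R f (r m (Suc j)))"
        by (rule sum.lessThan_Suc_shift)
      then show ?thesis by (simp add: algebra_simps)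
    qed
    also have "E m m *\<^sub>R f (r m m) - E m 0 *\<^sub>R f (r m 0) = f t - exp (s - t) *\<^sub>R f s"
      by (simp add: E_def rm)
    also have "exp (- \<delta> m) *\<^sub>R ((\<Sum>j<m. E m j *\<^sub>R f (r m j)) + (f t - exp (s - t) *\<^sub>R f s)) - (\<Sum>j<m. E m j *\<^sub>R f (r m j))
      = (exp (- \<delta> m) - 1) *\<^sub>R (\<Sum>j<m. E m j *\<^sub>R f (r m j)) + exp (- \<delta> m) *\<^sub>R (f t - exp (s - t) *\<^sub>R f s)"
      by (simp add: algebra_simps)
    also have "(exp (- \<delta> m) - 1) *\<^sub>R (\<Sum>j<m. E m j *\<^sub>R f (r m j)) = ((exp (- \<delta> m) - 1) / \<delta> m) *\<^sub>R (\<Sum>j<m. \<delta> m *\<^sub>R (E m j *\<^sub>R f (r m j)))"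
      using \<delta> unfolding scaleR_sum_right[symmetric] by simp
    finally show ?thesis .
  qed
  have \<delta>0: "\<delta> \<longlonglongrightarrow> 0" unfolding \<delta>_def
    by (rule tendsto_divide_0[OF tendsto_const]) (simp add: filterlim_real_sequentially filterlim_at_top_imp_at_infinity)
  have der: "((\<lambda>h. (exp (- h) - 1) / h) \<longlongrightarrow> -1) (at (0::real))"
  proof -
    have "((\<lambda>h::real. exp (- h)) has_field_derivative (-1)) (at 0)"
      by (auto intro!: derivative_eq_intros)
    then show ?thesis by (simp add: DERIV_def)
  qed
  have "filterlim \<delta> (at 0) sequentially"
    using \<delta>0 st by (auto simp: filterlim_at \<delta>_def eventually_sequentially intro!: exI[of _ 1])
  then have quot: "(\<lambda>m. (exp (- \<delta> m) - 1) / \<delta> m) \<longlonglongrightarrow> -1"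
    by (rule filterlim_compose[OF der])
  have riem: "(\<lambda>m. \<Sum>j<m. \<delta> m *\<^sub>R (E m j *\<^sub>R f (r m j))) \<longlonglongrightarrow> integral {s..t} (\<lambda>u. exp (u - t) *\<^sub>R f u)"
    unfolding \<delta>_def E_def r_def
    by (rule riemann_sum_tendsto)
       (use st in \<open>auto intro!: continuous_intros continuous_on_subset[OF f]\<close>)
  have int: "integral {s..t} (\<lambda>u. exp (u - t) *\<^sub>R f u) = exp (-t) *\<^sub>R integral {s..t} (\<lambda>u. exp u *\<^sub>R f u)"
    by (subst integral_cmul[symmetric]) (simp add: exp_diff exp_minus field_simps)
  have "(\<lambda>m. ((exp (- \<delta> m) - 1) / \<delta> m) *\<^sub>R (\<Sum>j<m. \<delta> m *\<^sub>R (E m j *\<^sub>R f (r m j)))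
        + exp (- \<delta> m) *\<^sub>R (f t - exp (s - t) *\<^sub>R f s))
     \<longlonglongrightarrow> (-1) *\<^sub>R integral {s..t} (\<lambda>u. exp (u - t) *\<^sub>R f u) + exp (- 0) *\<^sub>R (f t - exp (s - t) *\<^sub>R f s)"
    by (intro tendsto_intros quot riem \<delta>0)
  then have "(\<lambda>m. \<Sum>j<m. E m j *\<^sub>R (f (r m (Suc j)) - f (r m j)))
     \<longlonglongrightarrow> (-1) *\<^sub>R integral {s..t} (\<lambda>u. exp (u - t) *\<^sub>R f u) + exp (- 0) *\<^sub>R (f t - exp (s - t) *\<^sub>R f s)"
    by (rule Lim_transform_eventually)
       (use abel in \<open>auto simp: eventually_sequentially intro!: exI[of _ 1]\<close>)
  then show ?thesis by (simp add: E_def int)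
qed

text \<open>A filtered probability space with a Brownian motion and, for each starting point \<open>y\<close>, an
  Ornstein-Uhlenbeck process \<open>X y\<close> driven by it.\<close>

locale ou_family =
  fixes M :: "'a measure" and F :: "real \<Rightarrow> 'a measure" and B :: "real \<Rightarrow> 'a \<Rightarrow> real ^ 'n"
    and X :: "real ^ 'n \<Rightarrow> real \<Rightarrow> 'a \<Rightarrow> real ^ 'n"
  assumes filtered: "filtered_prob_space M F"
    and brownian: "standard_brownian_motion M F B"
    and ou: "\<And>y. OU_process M F B y (X y)"
begin

sublocale prob_space M using filtered by (simp add: filtered_prob_space_def)

lemma subalg: "0 \<le> s \<Longrightarrow> subalgebra M (F s)"
  using filtered by (simp add: filtered_prob_space_def)

lemma subalg_mono: "0 \<le> s \<Longrightarrow> s \<le> t \<Longrightarrow> subalgebra (F t) (F s)"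
  using filtered subalg[of s] subalg[of t] by (auto simp: filtered_prob_space_def subalgebra_def)

lemma B_adapted: "0 \<le> s \<Longrightarrow> s \<le> t \<Longrightarrow> B s \<in> borel_measurable (F t)"
  by (rule measurable_from_subalg[OF subalg_mono]) (use brownian in \<open>unfold standard_brownian_motion_def, blast+\<close>)

lemma X_adapted: "0 \<le> s \<Longrightarrow> s \<le> t \<Longrightarrow> X y s \<in> borel_measurable (F t)"
  by (rule measurable_from_subalg[OF subalg_mono]) (use ou[of y] in \<open>unfold OU_process_def, blast+\<close>)

lemma B_measurable: "0 \<le> s \<Longrightarrow> B s \<in> borel_measurable M"
  by (rule measurable_from_subalg[OF subalg B_adapted[OF _ order_refl]])

lemma X_measurable: "0 \<le> s \<Longrightarrow> X y s \<in> borel_measurable M"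
  by (rule measurable_from_subalg[OF subalg X_adapted[OF _ order_refl]])

lemma indep_law_increment:
  assumes st: "0 \<le> s" "s < t"
  shows "indep_law M (F s) (\<lambda>\<omega>. B t \<omega> - B s \<omega>) (gauss (t - s))"
  unfolding indep_law_def
proof (intro conjI ballI)
  have [measurable]: "B t \<in> borel_measurable M" "B s \<in> borel_measurable M"
    using st by (auto intro: B_measurable)
  show "(\<lambda>\<omega>. B t \<omega> - B s \<omega>) \<in> borel_measurable M" by measurable
  fix A and C :: "(real^'n) set" assume A: "A \<in> sets (F s)" and C[measurable]: "C \<in> sets borel"
  let ?D = "\<lambda>\<omega>. B t \<omega> - B s \<omega>"
  have nn_integral_OU_law: "distr M borel (\<lambda>\<omega>. ?D \<omega> /\<^sub>R sqrt (t - s)) = std_gaussian"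
    and ind: "indep_set (sets (F s)) (sets (vimage_algebra (space M) ?D borel))"
    using brownian st by (auto simp: standard_brownian_motion_def)
  have "prob (A \<inter> (?D -` C \<inter> space M)) = prob A * prob (?D -` C \<inter> space M)"
    using ind A by (rule indep_setD) (rule in_vimage_algebra[OF C])
  then have "emeasure M (A \<inter> (?D -` C \<inter> space M)) = emeasure M A * emeasure M (?D -` C \<inter> space M)"
    by (simp add: emeasure_eq_measure ennreal_mult[symmetric])
  also have "emeasure M (?D -` C \<inter> space M) = emeasure (gauss (t - s)) C"
    unfolding gauss_def nn_integral_OU_law[symmetric] using st
    by (subst distr_distr) (auto simp: o_def emeasure_distr)
  finally show "emeasure M (A \<inter> (?D -` C \<inter> space M)) = emeasure M A * emeasure (gauss (t - s)) C" .
qed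

text \<open>The convolution of Gaussian laws is read off from the Brownian motion, whose increments over
  adjacent intervals add up to an increment.\<close>

lemma gauss_convolution:
  fixes \<psi> :: "real ^ 'n \<Rightarrow> ennreal"
  assumes [measurable]: "\<psi> \<in> borel_measurable borel" and ab: "0 \<le> a" "0 < b"
  shows "(\<integral>\<^sup>+x. \<integral>\<^sup>+y. \<psi> (x + y) \<partial>gauss b \<partial>gauss a) = (\<integral>\<^sup>+x. \<psi> x \<partial>gauss (a + b))"
proof (cases "a = 0")
  case True
  interpret \<gamma>: prob_space "std_gaussian :: (real^'n) measure" by (rule prob_space_std_gaussian)
  interpret gb: prob_space "gauss b :: (real^'n) measure" by (rule prob_space_gauss)
  have "(\<integral>\<^sup>+x. \<integral>\<^sup>+y. \<psi> (x + y) \<partial>gauss b \<partial>gauss a) = (\<integral>\<^sup>+x. \<integral>\<^sup>+y. \<psi> (sqrt a *\<^sub>R x + y) \<partial>gauss b \<partial>std_gaussian)"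
    by (rule nn_integral_gauss) measurable
  then show ?thesis using True \<gamma>.emeasure_space_1 by simp
next
  case False
  then have a: "0 < a" using ab by simp
  have [measurable]: "B 0 \<in> borel_measurable (F a)" "B a \<in> borel_measurable (F a)"
    using a by (auto intro: B_adapted)
  have inc: "indep_law M (F 0) (\<lambda>\<omega>. B a \<omega> - B 0 \<omega>) (gauss a)"
    "indep_law M (F 0) (\<lambda>\<omega>. B (a + b) \<omega> - B 0 \<omega>) (gauss (a + b))"
    "indep_law M (F a) (\<lambda>\<omega>. B (a + b) \<omega> - B a \<omega>) (gauss b)"
    using indep_law_increment[of 0 a] indep_law_increment[of 0 "a+b"] indep_law_increment[of a "a+b"] a ab by auto
  interpret gb: prob_space "gauss b :: (real^'n) measure" by (rule prob_space_gauss)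
  note marg = nn_integral_indep_law_marginal[OF prob_space_axioms subalg _ prob_space_gauss sets_gauss]
  have "(\<integral>\<^sup>+x. \<integral>\<^sup>+y. \<psi> (x + y) \<partial>gauss b \<partial>gauss a) = (\<integral>\<^sup>+\<omega>. \<integral>\<^sup>+y. \<psi> ((B a \<omega> - B 0 \<omega>) + y) \<partial>gauss b \<partial>M)"
    by (rule marg[OF order_refl inc(1), symmetric]) measurable
  also have "\<dots> = (\<integral>\<^sup>+\<omega>. \<psi> ((B a \<omega> - B 0 \<omega>) + (B (a + b) \<omega> - B a \<omega>)) \<partial>M)"
    using a by (intro nn_integral_indep_law[OF prob_space_axioms subalg inc(3) prob_space_gauss sets_gauss, symmetric]) auto
  also have "\<dots> = (\<integral>\<^sup>+\<omega>. \<psi> (B (a + b) \<omega> - B 0 \<omega>) \<partial>M)" by simp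
  also have "\<dots> = (\<integral>\<^sup>+x. \<psi> x \<partial>gauss (a + b))"
    by (rule marg[OF order_refl inc(2)]) measurable
  finally show ?thesis .
qed

lemma indep_law_increment_sum:
  fixes r c :: "nat \<Rightarrow> real"
  assumes r0: "0 \<le> r 0" and r: "\<And>j. j < m \<Longrightarrow> r j < r (Suc j)" and c: "\<And>j. 0 < c j"
  shows "indep_law M (F (r 0)) (\<lambda>\<omega>. \<Sum>j<m. c j *\<^sub>R (B (r (Suc j)) \<omega> - B (r j) \<omega>))
     (gauss (\<Sum>j<m. (c j)\<^sup>2 * (r (Suc j) - r j)))"
  using r
proof (induction m)
  case 0
  interpret \<gamma>: prob_space "std_gaussian :: (real^'n) measure" by (rule prob_space_std_gaussian)
  show ?case unfolding indep_law_def
  proof (intro conjI ballI)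
    fix A and C :: "(real^'n) set" assume A: "A \<in> sets (F (r 0))" and C: "C \<in> sets borel"
    have "A \<subseteq> space M" using A subalg[OF r0] sets.sets_into_space[OF A] by (auto simp: subalgebra_def)
    then show "emeasure M (A \<inter> ((\<lambda>\<omega>. \<Sum>j<0. c j *\<^sub>R (B (r (Suc j)) \<omega> - B (r j) \<omega>)) -` C \<inter> space M))
       = emeasure M A * emeasure (gauss (\<Sum>j<0. (c j)\<^sup>2 * (r (Suc j) - r j))) C"
      using C \<gamma>.emeasure_space_1
      by (cases "0 \<in> C") (auto simp: gauss_def emeasure_distr Int_absorb2)
  qed simp
next
  case (Suc m)
  let ?S1 = "\<lambda>\<omega>. \<Sum>j<Suc m. c j *\<^sub>R (B (r (Suc j)) \<omega> - B (r j) \<omega>)"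
  let ?S = "\<lambda>\<omega>. \<Sum>j<m. c j *\<^sub>R (B (r (Suc j)) \<omega> - B (r j) \<omega>)"
  let ?D = "\<lambda>\<omega>. c m *\<^sub>R (B (r (Suc m)) \<omega> - B (r m) \<omega>)"
  let ?a = "\<Sum>j<m. (c j)\<^sup>2 * (r (Suc j) - r j)" and ?b = "(c m)\<^sup>2 * (r (Suc m) - r m)"
  have rr: "0 \<le> r j \<and> r 0 \<le> r j" if "j \<le> Suc m" for j using that
  proof (induction j)
    case (Suc j)
    then show ?case using Suc.prems \<open>\<And>j. j < Suc m \<Longrightarrow> r j < r (Suc j)\<close>[of j] by simp
  qed (use r0 in simp)
  have rm: "r i \<le> r j" if "i \<le> j" "j \<le> Suc m" for i j using that(2,1)
  proof (induction j)
    case (Suc j)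
    then show ?case using Suc.prems \<open>\<And>j. j < Suc m \<Longrightarrow> r j < r (Suc j)\<close>[of j] by (cases "i = Suc j") auto
  qed simp
  have IH: "indep_law M (F (r 0)) ?S (gauss ?a)" using Suc by simp
  have D: "indep_law M (F (r m)) ?D (gauss ?b)"
    using indep_law_scaleR[OF indep_law_increment[of "r m" "r (Suc m)"], of "c m"] Suc.prems[of m] rr[of m] c[of m]
    by simp
  have a: "?a \<ge> 0" using Suc.prems by (intro sum_nonneg mult_nonneg_nonneg) (auto intro: less_imp_le)
  have b: "?b > 0" using c[of m] Suc.prems[of m] by simp
  have S_meas: "?S \<in> borel_measurable (F (r m))"
    using rr rm by (intro borel_measurable_sum borel_measurable_scaleR borel_measurable_diff borel_measurable_const B_adapted) auto
  have SM[measurable]: "?S \<in> borel_measurable M" "?D \<in> borel_measurable M"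
    using IH D by (auto simp: indep_law_def)
  show ?case unfolding indep_law_def
  proof (intro conjI ballI)
    have SD: "(\<lambda>\<omega>. ?S \<omega> + ?D \<omega>) \<in> borel_measurable M"
      using SM by (rule borel_measurable_add)
    then show "?S1 \<in> borel_measurable M"
      by simp
    fix A and C :: "(real^'n) set" assume A[measurable]: "A \<in> sets (F (r 0))" and C[measurable]: "C \<in> sets borel"
    have Am[measurable]: "A \<in> sets (F (r m))" using A subalg_mono[OF r0, of "r m"] rr[of m] by (auto simp: subalgebra_def)
    have AM[measurable]: "A \<in> sets M" using A subalg[OF r0] by (auto simp: subalgebra_def)
    interpret gb: prob_space "gauss ?b :: (real^'n) measure" by (rule prob_space_gauss)
    let ?H = "\<lambda>x :: real^'n. \<integral>\<^sup>+w. indicator C (x + w) \<partial>gauss ?b"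
    have "emeasure M (A \<inter> (?S1 -` C \<inter> space M))
        = (\<integral>\<^sup>+\<omega>. indicator (A \<inter> ((\<lambda>\<omega>. ?S \<omega> + ?D \<omega>) -` C \<inter> space M)) \<omega> \<partial>M)"
      using sets.Int[OF AM measurable_sets[OF SD C]] by simp
    also have "\<dots> = (\<integral>\<^sup>+\<omega>. indicator A \<omega> * indicator C (?S \<omega> + ?D \<omega>) \<partial>M)"
      by (intro nn_integral_cong) (auto simp: indicator_def)
    also have "\<dots> = (\<integral>\<^sup>+\<omega>. \<integral>\<^sup>+w. indicator A \<omega> * indicator C (?S \<omega> + w) \<partial>gauss ?b \<partial>M)"
      using rr[of m] S_meas by (intro nn_integral_indep_law[OF prob_space_axioms subalg D prob_space_gauss sets_gauss]) auto
    also have "\<dots> = (\<integral>\<^sup>+\<omega>. indicator A \<omega> * ?H (?S \<omega>) \<partial>M)"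
      by (intro nn_integral_cong nn_integral_cmult) simp
    also have "\<dots> = (\<integral>\<^sup>+\<omega>. \<integral>\<^sup>+w. indicator A \<omega> * ?H w \<partial>gauss ?a \<partial>M)"
      by (intro nn_integral_indep_law[OF prob_space_axioms subalg[OF r0] IH prob_space_gauss sets_gauss]) measurable
    also have "\<dots> = (\<integral>\<^sup>+\<omega>. indicator A \<omega> * (\<integral>\<^sup>+w. ?H w \<partial>gauss ?a) \<partial>M)"
      by (intro nn_integral_cong nn_integral_cmult) measurable
    also have "\<dots> = emeasure M A * (\<integral>\<^sup>+w. ?H w \<partial>gauss ?a)"
      by (subst nn_integral_multc) auto
    also have "(\<integral>\<^sup>+w. ?H w \<partial>gauss ?a) = (\<integral>\<^sup>+w. indicator C w \<partial>gauss (?a + ?b))"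
      by (rule gauss_convolution[OF _ a b]) measurable
    also have "\<dots> = emeasure (gauss (\<Sum>j<Suc m. (c j)\<^sup>2 * (r (Suc j) - r j))) C" by simp
    finally show "emeasure M (A \<inter> (?S1 -` C \<inter> space M))
        = emeasure M A * emeasure (gauss (\<Sum>j<Suc m. (c j)\<^sup>2 * (r (Suc j) - r j))) C" .
  qed
qed

lemma AE_path:
  "AE \<omega> in M. continuous_on {0..} (\<lambda>s. B s \<omega>) \<and> continuous_on {0..} (\<lambda>s. X y s \<omega>) \<and>
     (\<forall>s\<ge>0. X y s \<omega> = exp (-s) *\<^sub>R y + sqrt 2 *\<^sub>R (B s \<omega> - exp (-s) *\<^sub>R integral {0..s} (\<lambda>r. exp r *\<^sub>R B r \<omega>)))"
proof -
  have "AE \<omega> in M. continuous_on {0..} (\<lambda>s. B s \<omega>)" using brownian by (simp add: standard_brownian_motion_def)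
  moreover have "AE \<omega> in M. continuous_on {0..} (\<lambda>t. X y t \<omega>) \<and>
        (\<forall>t\<ge>0. X y t \<omega> = y + sqrt 2 *\<^sub>R B t \<omega> - integral {0..t} (\<lambda>s. X y s \<omega>))"
    using ou[of y] by (simp add: OU_process_def)
  ultimately show ?thesis
  proof eventually_elim
    case (elim \<omega>)
    then show ?case using ou_path_explicit[of "\<lambda>s. B s \<omega>" "\<lambda>s. X y s \<omega>" y] by blast
  qed
qed

lemma AE_X_eq: "AE \<omega> in M. continuous_on {0..} (\<lambda>s. X 0 s \<omega>) \<and> (\<forall>s\<ge>0. X y s \<omega> = exp (-s) *\<^sub>R y + X 0 s \<omega>)"
  using AE_path[of y] AE_path[of 0] by eventually_elim auto

lemma AE_X0_0: "AE \<omega> in M. X 0 0 \<omega> = 0"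
proof -
  have "AE \<omega> in M. B 0 \<omega> = 0" using brownian by (simp add: standard_brownian_motion_def)
  with AE_path[of 0] show ?thesis by eventually_elim auto
qed

text \<open>The innovation of the Ornstein-Uhlenbeck process between two times is \<open>sqrt 2\<close> times the
  integral of \<open>exp(u - t)\<close> against \<open>dB\<^sub>u\<close>; the variances of the approximating sums are Riemann sums of
  \<open>2 exp(2(u - t))\<close>, which explains the variance of the limit.\<close>

lemma indep_law_innovation:
  assumes st: "0 \<le> s" "s < t"
  shows "indep_law M (F s) (\<lambda>\<omega>. X 0 t \<omega> - exp (-(t - s)) *\<^sub>R X 0 s \<omega>) (gauss (1 - exp (-2 * (t - s))))"
proof -
  define r where "r m j = s + real j * ((t - s) / real m)" for m j
  define c where "c m j = sqrt 2 * exp (r m j - t)" for m j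
  let ?\<xi> = "\<lambda>m \<omega>. \<Sum>j<m. c m j *\<^sub>R (B (r m (Suc j)) \<omega> - B (r m j) \<omega>)"
  let ?v = "\<lambda>m. \<Sum>j<m. (c m j)\<^sup>2 * (r m (Suc j) - r m j)"
  have [measurable]: "X 0 t \<in> borel_measurable M" "X 0 s \<in> borel_measurable M"
    using st by (auto intro: X_measurable)
  show ?thesis
  proof (rule indep_law_gauss_limit[OF prob_space_axioms subalg, where \<xi>k="\<lambda>k. ?\<xi> (Suc k)" and vk="\<lambda>k. ?v (Suc k)"])
    show "0 \<le> s" by fact
    show "(\<lambda>\<omega>. X 0 t \<omega> - exp (-(t - s)) *\<^sub>R X 0 s \<omega>) \<in> borel_measurable M" by measurable
    (* Suc k rather than k: with no subinterval the grid would not be increasing *)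
    show "indep_law M (F s) (?\<xi> (Suc k)) (gauss (?v (Suc k)))" for k
    proof -
      have "r (Suc k) 0 = s" by (simp add: r_def)
      moreover have "r (Suc k) j < r (Suc k) (Suc j)" for j
        using st by (simp add: r_def divide_simps)
      ultimately show ?thesis
        using indep_law_increment_sum[of "r (Suc k)" "Suc k" "c (Suc k)"] st by (simp only: c_def) auto
    qed
    show "AE \<omega> in M. (\<lambda>k. ?\<xi> (Suc k) \<omega>) \<longlonglongrightarrow> X 0 t \<omega> - exp (-(t - s)) *\<^sub>R X 0 s \<omega>"
      using AE_path[of 0]
    proof eventually_elim
      case (elim \<omega>)
      let ?J = "\<lambda>u. integral {0..u} (\<lambda>r. exp r *\<^sub>R B r \<omega>)"
      have int: "(\<lambda>r. exp r *\<^sub>R B r \<omega>) integrable_on {0..t}"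
        using elim by (intro integrable_continuous_interval continuous_intros) (auto elim: continuous_on_subset)
      have J: "integral {s..t} (\<lambda>r. exp r *\<^sub>R B r \<omega>) = ?J t - ?J s"
        using Henstock_Kurzweil_Integration.integral_combine[OF _ _ int, of s] st by (simp add: algebra_simps)
      have e: "exp (-(t - s)) * exp (-s) = exp (-t)" "exp (s - t) = exp (-(t - s))" unfolding exp_add[symmetric] by simp_all
      have "(\<lambda>m. \<Sum>j<m. exp (r m j - t) *\<^sub>R (B (r m (Suc j)) \<omega> - B (r m j) \<omega>)) \<longlonglongrightarrow>
          B t \<omega> - exp (s - t) *\<^sub>R B s \<omega> - exp (-t) *\<^sub>R integral {s..t} (\<lambda>r. exp r *\<^sub>R B r \<omega>)"
        unfolding r_def using elim st by (intro ou_innovation_sum_tendsto) auto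
      then have "(\<lambda>m. sqrt 2 *\<^sub>R (\<Sum>j<m. exp (r m j - t) *\<^sub>R (B (r m (Suc j)) \<omega> - B (r m j) \<omega>))) \<longlonglongrightarrow>
          sqrt 2 *\<^sub>R (B t \<omega> - exp (s - t) *\<^sub>R B s \<omega> - exp (-t) *\<^sub>R integral {s..t} (\<lambda>r. exp r *\<^sub>R B r \<omega>))"
        by (intro tendsto_intros)
      moreover have "sqrt 2 *\<^sub>R (\<Sum>j<m. exp (r m j - t) *\<^sub>R (B (r m (Suc j)) \<omega> - B (r m j) \<omega>)) = ?\<xi> m \<omega>" for m
        by (simp add: scaleR_sum_right c_def)
      moreover have "sqrt 2 *\<^sub>R (B t \<omega> - exp (s - t) *\<^sub>R B s \<omega> - exp (-t) *\<^sub>R integral {s..t} (\<lambda>r. exp r *\<^sub>R B r \<omega>))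
          = X 0 t \<omega> - exp (-(t - s)) *\<^sub>R X 0 s \<omega>"
      proof -
        have X: "X 0 t \<omega> = sqrt 2 *\<^sub>R (B t \<omega> - exp (-t) *\<^sub>R ?J t)" "X 0 s \<omega> = sqrt 2 *\<^sub>R (B s \<omega> - exp (-s) *\<^sub>R ?J s)"
          using elim st by auto
        have "exp (-(t - s)) *\<^sub>R X 0 s \<omega> = sqrt 2 *\<^sub>R (exp (-(t - s)) *\<^sub>R B s \<omega> - exp (-t) *\<^sub>R ?J s)"
          unfolding X e(1)[symmetric] by (simp add: scaleR_right_diff_distrib mult_ac)
        then show ?thesis unfolding X(1) J e(2) by (simp add: algebra_simps)
      qed
      ultimately have "(\<lambda>m. ?\<xi> m \<omega>) \<longlonglongrightarrow> X 0 t \<omega> - exp (-(t - s)) *\<^sub>R X 0 s \<omega>" by simp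
      then show ?case by (rule LIMSEQ_Suc)
    qed
    have "(\<lambda>m. \<Sum>j<m. ((t - s) / real m) *\<^sub>R (2 * exp (2 * ((s + real j * ((t - s) / real m)) - t)))) \<longlonglongrightarrow> integral {s..t} (\<lambda>u. 2 * exp (2 * (u - t)))"
      using st by (intro riemann_sum_tendsto[where f="\<lambda>u. 2 * exp (2 * (u - t))"]) (auto intro!: continuous_intros)
    also have "integral {s..t} (\<lambda>u. 2 * exp (2 * (u - t))) = 1 - exp (-2 * (t - s))"
    proof -
      have "((\<lambda>u. 2 * exp (2 * (u - t))) has_integral (exp (2 * (t - t)) - exp (2 * (s - t)))) {s..t}"
        using st by (intro fundamental_theorem_of_calculus)
          (auto simp: has_real_derivative_iff_has_vector_derivative[symmetric] intro!: derivative_eq_intros)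
      then have "integral {s..t} (\<lambda>u. 2 * exp (2 * (u - t))) = exp (2 * (t - t)) - exp (2 * (s - t))"
        by (rule integral_unique)
      also have "\<dots> = 1 - exp (-2 * (t - s))" by (simp add: algebra_simps)
      finally show ?thesis .
    qed
    also have "(\<lambda>m. \<Sum>j<m. ((t - s) / real m) *\<^sub>R (2 * exp (2 * ((s + real j * ((t - s) / real m)) - t)))) = ?v"
    proof (intro ext sum.cong refl)
      fix m j
      have "(c m j)\<^sup>2 = 2 * exp (2 * (r m j - t))" by (simp only: c_def power_mult_distrib exp_double) simp
      moreover have "r m (Suc j) - r m j = (t - s) / real m" by (simp add: r_def algebra_simps add_divide_distrib diff_divide_distrib)
      ultimately show "((t - s) / real m) *\<^sub>R (2 * exp (2 * ((s + real j * ((t - s) / real m)) - t))) = (c m j)\<^sup>2 * (r m (Suc j) - r m j)"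
        by (simp add: r_def mult.commute)
    qed
    finally show "(\<lambda>k. ?v (Suc k)) \<longlonglongrightarrow> 1 - exp (-2 * (t - s))" by (rule LIMSEQ_Suc)
  qed
qed

end

section \<open>A Cameron-Martin formula on finite grids\<close>

context ou_family
begin

lemma nn_integral_X0:
  fixes \<psi> :: "real ^ 'n \<Rightarrow> ennreal"
  assumes [measurable]: "\<psi> \<in> borel_measurable borel" and s: "0 < s"
  shows "(\<integral>\<^sup>+\<omega>. \<psi> (X 0 s \<omega>) \<partial>M) = (\<integral>\<^sup>+w. \<psi> w \<partial>gauss (1 - exp (-2 * s)))"
proof -
  have [measurable]: "X 0 s \<in> borel_measurable M" "X 0 0 \<in> borel_measurable M"
    using s by (auto intro: X_measurable)
  have "(\<integral>\<^sup>+\<omega>. \<psi> (X 0 s \<omega>) \<partial>M) = (\<integral>\<^sup>+\<omega>. \<psi> (X 0 s \<omega> - exp (-(s - 0)) *\<^sub>R X 0 0 \<omega>) \<partial>M)"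
    by (intro nn_integral_cong_AE eventually_mono[OF AE_X0_0]) simp
  also have "\<dots> = (\<integral>\<^sup>+w. \<psi> w \<partial>gauss (1 - exp (-2 * (s - 0))))"
    by (rule nn_integral_indep_law_marginal[OF prob_space_axioms subalg[OF order_refl] indep_law_innovation[OF order_refl s] prob_space_gauss sets_gauss]) measurable
  finally show ?thesis by simp
qed

lemma exp_moment_X0:
  assumes s: "0 \<le> s"
  shows "(\<integral>\<^sup>+\<omega>. ennreal (exp (c * norm (X 0 s \<omega>))) \<partial>M) \<le> (\<integral>\<^sup>+z. ennreal (exp (\<bar>c\<bar> * norm z)) \<partial>(std_gaussian :: (real^'n) measure))"
proof (cases "s = 0")
  case True
  interpret \<gamma>: prob_space "std_gaussian :: (real^'n) measure" by (rule prob_space_std_gaussian)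
  have "(\<integral>\<^sup>+\<omega>. ennreal (exp (c * norm (X 0 s \<omega>))) \<partial>M) = (\<integral>\<^sup>+\<omega>. 1 \<partial>M)"
    using True by (intro nn_integral_cong_AE eventually_mono[OF AE_X0_0]) simp
  also have "\<dots> = (\<integral>\<^sup>+z. 1 \<partial>(std_gaussian :: (real^'n) measure))"
    using emeasure_space_1 \<gamma>.emeasure_space_1 by simp
  also have "\<dots> \<le> (\<integral>\<^sup>+z. ennreal (exp (\<bar>c\<bar> * norm z)) \<partial>(std_gaussian :: (real^'n) measure))"
    by (intro nn_integral_mono) (simp flip: ennreal_1 add: ennreal_leI)
  finally show ?thesis .
next
  case False
  then have s: "0 < s" using s by simp
  have "(\<integral>\<^sup>+\<omega>. ennreal (exp (c * norm (X 0 s \<omega>))) \<partial>M) = (\<integral>\<^sup>+z. ennreal (exp (c * norm (sqrt (1 - exp (-2 * s)) *\<^sub>R z))) \<partial>(std_gaussian :: (real^'n) measure))"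
    by (subst nn_integral_X0[OF _ s]) (auto simp: nn_integral_gauss)
  also have "\<dots> \<le> (\<integral>\<^sup>+z. ennreal (exp (\<bar>c\<bar> * norm z)) \<partial>(std_gaussian :: (real^'n) measure))"
  proof (intro nn_integral_mono ennreal_leI)
    fix z :: "real^'n"
    have "c * (sqrt (1 - exp (-2 * s)) * norm z) \<le> \<bar>c\<bar> * (1 * norm z)"
      using s by (intro mult_mono mult_right_mono) auto
    then show "exp (c * norm (sqrt (1 - exp (-2 * s)) *\<^sub>R z)) \<le> exp (\<bar>c\<bar> * norm z)"
      using s by simp
  qed
  finally show ?thesis .
qed

text \<open>Shifting the process by \<open>2 sinh(u) \<beta>\<close> amounts to weighting with \<open>Z\<close>, which depends on the path only
  through its last value.  The last point of the grid carries a separate function \<open>\<psi>\<close>, which is what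
  the induction on the number of grid points needs: integrating out the last innovation replaces \<open>\<psi>\<close> by
  a function of the value at the previous grid point.\<close>

lemma cameron_martin_grid:
  fixes s :: "nat \<Rightarrow> real" and \<beta> :: "real ^ 'n" and \<phi> :: "nat \<Rightarrow> real ^ 'n \<Rightarrow> ennreal"
  defines "k \<equiv> \<lambda>u. (2 * sinh u) *\<^sub>R \<beta>"
    and "Z \<equiv> \<lambda>u w. exp (exp u * (\<beta> \<bullet> w) - (norm \<beta>)\<^sup>2 * (exp (2 * u) - 1) / 2)"
  assumes s0: "s 0 = 0" and mono: "\<And>j. s j < s (Suc j)"
    and \<phi>[measurable]: "\<And>j. \<phi> j \<in> borel_measurable borel" and \<psi>: "\<psi> \<in> borel_measurable borel"
  shows "(\<integral>\<^sup>+\<omega>. (\<Prod>j<m. \<phi> j (X 0 (s j) \<omega> + k (s j))) * \<psi> (X 0 (s m) \<omega> + k (s m)) \<partial>M)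
       = (\<integral>\<^sup>+\<omega>. (\<Prod>j<m. \<phi> j (X 0 (s j) \<omega>)) * (\<psi> (X 0 (s m) \<omega>) * ennreal (Z (s m) (X 0 (s m) \<omega>))) \<partial>M)"
  using \<psi>
proof (induction m arbitrary: \<psi>)
  case 0
  show ?case
    by (intro nn_integral_cong_AE eventually_mono[OF AE_X0_0]) (simp add: s0 k_def Z_def)
next
  case (Suc m)
  let ?\<Pi>k = "\<lambda>\<omega>. \<Prod>j<Suc m. \<phi> j (X 0 (s j) \<omega> + k (s j))"
  let ?\<Pi> = "\<lambda>\<omega>. \<Prod>j<Suc m. \<phi> j (X 0 (s j) \<omega>)"
  have \<psi>[measurable]: "\<psi> \<in> borel_measurable borel" by fact
  have sm: "strict_mono s" using mono by (simp add: strict_mono_Suc_iff)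
  have s_le: "s i \<le> s j" if "i \<le> j" for i j using strict_mono_less_eq[OF sm] that by simp
  have s_nn: "0 \<le> s j" for j using s_le[of 0 j] s0 by simp
  define b \<tau> where "b = s m" and "\<tau> = s (Suc m)"
  define q v d where "q = exp (-(\<tau> - b))" and "v = 1 - exp (-2 * (\<tau> - b))" and "d = k \<tau> - q *\<^sub>R k b"
  have b\<tau>: "0 \<le> b" "b < \<tau>" using mono s_nn by (auto simp: b_def \<tau>_def)
  have v: "v > 0" using b\<tau> by (simp add: v_def)
  have v_q: "v = 1 - q\<^sup>2" by (simp add: v_def q_def exp_double[symmetric])
  have q_exp: "exp \<tau> * q = exp b" by (simp add: q_def exp_add[symmetric])
  (* d is the shift of the innovation; that it is exp tau times the variance v, up to the fixed
     vector beta, is what makes the weights of the innovations telescope to Z *)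
  have d: "d = (exp \<tau> * v) *\<^sub>R \<beta>"
  proof -
    have "exp (-\<tau>) = q * exp (- b)" by (simp add: q_def exp_add[symmetric])
    then have "2 * sinh \<tau> - q * (2 * sinh b) = exp \<tau> - q * exp b"
      by (simp add: sinh_def algebra_simps)
    also have "\<dots> = exp \<tau> * v" unfolding v_q q_exp[symmetric] by (simp add: algebra_simps power2_eq_square)
    finally show ?thesis
      by (simp add: d_def k_def scaleR_left_diff_distrib[symmetric])
  qed
  have Xm[measurable]: "X 0 (s j) \<in> borel_measurable (F b)" if "j \<le> m" for j
    using s_le[OF that] s_nn[of j] by (auto simp: b_def intro: X_adapted)
  have Xb[measurable]: "X 0 b \<in> borel_measurable (F b)" unfolding b_def[symmetric] using Xm[of m] by (simp add: b_def)
  have prod_meas: "(\<lambda>\<omega>. ?\<Pi>k \<omega>) \<in> borel_measurable (F b)"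
    "(\<lambda>\<omega>. ?\<Pi> \<omega>) \<in> borel_measurable (F b)"
  proof -
    have "(\<lambda>\<omega>. \<phi> j (X 0 (s j) \<omega> + k (s j))) \<in> borel_measurable (F b)" "(\<lambda>\<omega>. \<phi> j (X 0 (s j) \<omega>)) \<in> borel_measurable (F b)" if "j < Suc m" for j
    proof -
      have [measurable]: "X 0 (s j) \<in> borel_measurable (F b)" using Xm[of j] that by simp
      show "(\<lambda>\<omega>. \<phi> j (X 0 (s j) \<omega> + k (s j))) \<in> borel_measurable (F b)" "(\<lambda>\<omega>. \<phi> j (X 0 (s j) \<omega>)) \<in> borel_measurable (F b)"
        by measurable
    qed
    then show "(\<lambda>\<omega>. ?\<Pi>k \<omega>) \<in> borel_measurable (F b)"
      "(\<lambda>\<omega>. ?\<Pi> \<omega>) \<in> borel_measurable (F b)"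
      by (auto intro!: borel_measurable_prod_ennreal)
  qed
  note [measurable] = prod_meas
  interpret gv: prob_space "gauss v :: (real^'n) measure" by (rule prob_space_gauss)
  have D: "indep_law M (F b) (\<lambda>\<omega>. X 0 \<tau> \<omega> - q *\<^sub>R X 0 b \<omega>) (gauss v)"
    unfolding q_def v_def by (rule indep_law_innovation[OF b\<tau>])
  note freeze = nn_integral_indep_law[OF prob_space_axioms subalg[OF b\<tau>(1)] D prob_space_gauss sets_gauss]
  define \<psi>' where "\<psi>' y = (\<integral>\<^sup>+w. \<psi> (q *\<^sub>R y + w + d) \<partial>gauss v)" for y
  have [measurable]: "\<psi>' \<in> borel_measurable borel" unfolding \<psi>'_def by measurable
  have Z_meas[measurable]: "(\<lambda>w. ennreal (Z u w)) \<in> borel_measurable borel" for u unfolding Z_def by measurable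
  have \<psi>'_Z: "\<psi>' y * ennreal (Z b y) = (\<integral>\<^sup>+w. \<psi> (q *\<^sub>R y + w) * ennreal (Z \<tau> (q *\<^sub>R y + w)) \<partial>gauss v)" for y
  proof -
    have "\<psi>' y = (\<integral>\<^sup>+w. ennreal (exp (d \<bullet> w / v - (norm d)\<^sup>2 / (2 * v))) * \<psi> (q *\<^sub>R y + w) \<partial>gauss v)"
      unfolding \<psi>'_def using nn_integral_gauss_shift[of "\<lambda>w. \<psi> (q *\<^sub>R y + w)" v d] v by (simp add: add.assoc)
    then have "\<psi>' y * ennreal (Z b y) = (\<integral>\<^sup>+w. ennreal (exp (d \<bullet> w / v - (norm d)\<^sup>2 / (2 * v))) * \<psi> (q *\<^sub>R y + w) * ennreal (Z b y) \<partial>gauss v)"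
      by (simp add: nn_integral_multc)
    also have "\<dots> = (\<integral>\<^sup>+w. \<psi> (q *\<^sub>R y + w) * ennreal (Z \<tau> (q *\<^sub>R y + w)) \<partial>gauss v)"
    proof (intro nn_integral_cong)
      fix w :: "real^'n"
      have 1: "d \<bullet> w / v = exp \<tau> * (\<beta> \<bullet> w)" using v by (simp add: d)
      have 2: "(norm d)\<^sup>2 / (2 * v) = (norm \<beta>)\<^sup>2 * ((exp \<tau>)\<^sup>2 * v) / 2"
        using v by (simp add: d power_mult_distrib power2_eq_square)
      have 3: "(exp \<tau>)\<^sup>2 * v = exp (2 * \<tau>) - exp (2 * b)"
        unfolding v_q exp_double q_exp[symmetric] by (simp add: algebra_simps power_mult_distrib)
      have "exp (d \<bullet> w / v - (norm d)\<^sup>2 / (2 * v)) * Z b y = Z \<tau> (q *\<^sub>R y + w)"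
        unfolding Z_def exp_add[symmetric] 1 2 3
        by (simp add: inner_add_right q_exp[symmetric] algebra_simps diff_divide_distrib add_divide_distrib)
      then have "ennreal (exp (d \<bullet> w / v - (norm d)\<^sup>2 / (2 * v))) * ennreal (Z b y) = ennreal (Z \<tau> (q *\<^sub>R y + w))"
        by (simp add: ennreal_mult[symmetric] Z_def)
      then show "ennreal (exp (d \<bullet> w / v - (norm d)\<^sup>2 / (2 * v))) * \<psi> (q *\<^sub>R y + w) * ennreal (Z b y) = \<psi> (q *\<^sub>R y + w) * ennreal (Z \<tau> (q *\<^sub>R y + w))"
        by (metis mult.assoc mult.commute)
    qed
    finally show ?thesis .
  qed
  have "(\<integral>\<^sup>+\<omega>. ?\<Pi>k \<omega> * \<psi> (X 0 (s (Suc m)) \<omega> + k (s (Suc m))) \<partial>M)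
    = (\<integral>\<^sup>+\<omega>. ?\<Pi>k \<omega> * \<psi> (q *\<^sub>R X 0 b \<omega> + (X 0 \<tau> \<omega> - q *\<^sub>R X 0 b \<omega>) + k \<tau>) \<partial>M)"
    by (simp add: \<tau>_def)
  also have "\<dots> = (\<integral>\<^sup>+\<omega>. \<integral>\<^sup>+w. ?\<Pi>k \<omega> * \<psi> (q *\<^sub>R X 0 b \<omega> + w + k \<tau>) \<partial>gauss v \<partial>M)"
    by (rule freeze) measurable
  also have "\<dots> = (\<integral>\<^sup>+\<omega>. ?\<Pi>k \<omega> * \<psi>' (X 0 b \<omega> + k b) \<partial>M)"
  proof (intro nn_integral_cong)
    fix \<omega>
    have "q *\<^sub>R (X 0 b \<omega> + k b) + w + d = q *\<^sub>R X 0 b \<omega> + w + k \<tau>" for w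
      by (simp add: d_def scaleR_right_distrib)
    then show "(\<integral>\<^sup>+w. ?\<Pi>k \<omega> * \<psi> (q *\<^sub>R X 0 b \<omega> + w + k \<tau>) \<partial>gauss v)
        = ?\<Pi>k \<omega> * \<psi>' (X 0 b \<omega> + k b)"
      unfolding \<psi>'_def by (simp only: nn_integral_cmult[symmetric] \<psi>) (intro nn_integral_cmult, measurable)
  qed
  also have "\<dots> = (\<integral>\<^sup>+\<omega>. (\<Prod>j<m. \<phi> j (X 0 (s j) \<omega> + k (s j))) * (\<phi> m (X 0 (s m) \<omega> + k (s m)) * \<psi>' (X 0 (s m) \<omega> + k (s m))) \<partial>M)"
    by (simp add: b_def mult.assoc)
  also have "\<dots> = (\<integral>\<^sup>+\<omega>. (\<Prod>j<m. \<phi> j (X 0 (s j) \<omega>)) * ((\<phi> m (X 0 (s m) \<omega>) * \<psi>' (X 0 (s m) \<omega>)) * ennreal (Z (s m) (X 0 (s m) \<omega>))) \<partial>M)"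
    by (rule Suc.IH) measurable
  also have "\<dots> = (\<integral>\<^sup>+\<omega>. ?\<Pi> \<omega> * (\<psi>' (X 0 b \<omega>) * ennreal (Z b (X 0 b \<omega>))) \<partial>M)"
    by (simp add: b_def mult.assoc)
  also have "\<dots> = (\<integral>\<^sup>+\<omega>. \<integral>\<^sup>+w. ?\<Pi> \<omega> * (\<psi> (q *\<^sub>R X 0 b \<omega> + w) * ennreal (Z \<tau> (q *\<^sub>R X 0 b \<omega> + w))) \<partial>gauss v \<partial>M)"
    unfolding \<psi>'_Z by (intro nn_integral_cong nn_integral_cmult[symmetric]) measurable
  also have "\<dots> = (\<integral>\<^sup>+\<omega>. ?\<Pi> \<omega> * (\<psi> (q *\<^sub>R X 0 b \<omega> + (X 0 \<tau> \<omega> - q *\<^sub>R X 0 b \<omega>)) * ennreal (Z \<tau> (q *\<^sub>R X 0 b \<omega> + (X 0 \<tau> \<omega> - q *\<^sub>R X 0 b \<omega>)))) \<partial>M)"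
    by (rule freeze[symmetric]) measurable
  also have "\<dots> = (\<integral>\<^sup>+\<omega>. ?\<Pi> \<omega> * (\<psi> (X 0 (s (Suc m)) \<omega>) * ennreal (Z (s (Suc m)) (X 0 (s (Suc m)) \<omega>))) \<partial>M)"
    by (simp add: \<tau>_def)
  finally show ?case .
qed

end

section \<open>The Cameron-Martin formula for path functionals\<close>

text \<open>A process with continuous paths is jointly measurable, being the limit of its discretisations in
  time.\<close>

lemma borel_measurable_pair_continuous_paths:
  fixes f :: "real \<Rightarrow> 'a \<Rightarrow> 'b::metric_space"
  assumes f: "\<And>s. f s \<in> borel_measurable M"
    and cont: "\<And>\<omega>. \<omega> \<in> space M \<Longrightarrow> continuous_on UNIV (\<lambda>s. f s \<omega>)"
  shows "(\<lambda>p. f (fst p) (snd p)) \<in> borel_measurable (borel \<Otimes>\<^sub>M M)"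
proof (rule borel_measurable_LIMSEQ_metric)
  fix i
  have [measurable]: "f s \<in> borel_measurable M" for s by (rule f)
  let ?g = "\<lambda>p :: real \<times> 'a. \<lfloor>real (Suc i) * fst p\<rfloor>"
  show "(\<lambda>p. f (of_int (?g p) / real (Suc i)) (snd p)) \<in> borel_measurable (borel \<Otimes>\<^sub>M M)"
    by (rule measurable_compose_countable[where f="\<lambda>k p. f (of_int k / real (Suc i)) (snd p)" and g="?g"]) measurable
next
  fix p :: "real \<times> 'a" assume "p \<in> space (borel \<Otimes>\<^sub>M M)"
  then have \<omega>: "snd p \<in> space M" by (auto simp: space_pair_measure)
  have "(\<lambda>i. of_int \<lfloor>real (Suc i) * fst p\<rfloor> / real (Suc i)) \<longlonglongrightarrow> fst p"
  proof (rule LIMSEQ_I)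
    fix e :: real assume "0 < e"
    then obtain n0 where n0: "1 / real (Suc n0) < e" using nat_approx_posE by blast
    show "\<exists>no. \<forall>i\<ge>no. norm (of_int \<lfloor>real (Suc i) * fst p\<rfloor> / real (Suc i) - fst p) < e"
    proof (intro exI[of _ n0] allI impI)
      fix i assume i: "i \<ge> n0"
      have "\<bar>of_int \<lfloor>real (Suc i) * fst p\<rfloor> - real (Suc i) * fst p\<bar> \<le> 1" by linarith
      moreover have "of_int \<lfloor>real (Suc i) * fst p\<rfloor> / real (Suc i) - fst p = (of_int \<lfloor>real (Suc i) * fst p\<rfloor> - real (Suc i) * fst p) / real (Suc i)"
        by (simp add: diff_divide_distrib)
      ultimately have "norm (of_int \<lfloor>real (Suc i) * fst p\<rfloor> / real (Suc i) - fst p) \<le> 1 / real (Suc i)"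
        by (simp add: abs_divide divide_right_mono)
      also have "\<dots> \<le> 1 / real (Suc n0)" using i by (simp add: frac_le)
      finally show "norm (of_int \<lfloor>real (Suc i) * fst p\<rfloor> / real (Suc i) - fst p) < e" using n0 by linarith
    qed
  qed
  then show "(\<lambda>i. f (of_int \<lfloor>real (Suc i) * fst p\<rfloor> / real (Suc i)) (snd p)) \<longlonglongrightarrow> f (fst p) (snd p)"
    using cont[OF \<omega>] by (intro isCont_tendsto_compose[where g="\<lambda>s. f s (snd p)"]) (auto simp: continuous_on_eq_continuous_at)
qed

text \<open>Lebesgue measure on the time interval \<open>[0, t]\<close>.  Time integrals are taken with respect to this finite
  measure, so that they may be interchanged with expectations; for integrable functions they agree with
  the gauge integral.\<close>

definition leb :: "real \<Rightarrow> real measure" where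
  "leb t = restrict_space lborel {0..t}"

lemma space_leb [simp]: "space (leb t) = {0..t}"
  by (simp add: leb_def space_restrict_space)

lemma finite_measure_leb: "finite_measure (leb t)"
  by (intro finite_measureI) (cases "0 \<le> t"; simp add: leb_def emeasure_restrict_space)

lemma measure_leb: "0 \<le> t \<Longrightarrow> measure (leb t) {0..t} = t"
  by (simp add: leb_def measure_restrict_space)

lemma borel_measurable_leb: "f \<in> measurable borel N \<Longrightarrow> f \<in> measurable (leb t) N"
  unfolding leb_def by (intro measurable_restrict_space1) simp

lemma ident_leb: "(\<lambda>s. s) \<in> measurable (leb t) borel"
  by (rule borel_measurable_leb) simp

lemma integrable_leb_iff: "integrable (leb t) f \<longleftrightarrow> set_integrable lborel {0..t} f"
  for f :: "real \<Rightarrow> 'b::{banach, second_countable_topology}"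
  by (simp add: leb_def integrable_restrict_space set_integrable_def)

lemma integral_leb_eq: "integral\<^sup>L (leb t) f = (LINT s:{0..t}|lborel. f s)"
  for f :: "real \<Rightarrow> 'b::{banach, second_countable_topology}"
  by (simp add: leb_def integral_restrict_space set_lebesgue_integral_def)

lemma leb_HK:
  fixes f :: "real \<Rightarrow> 'b::euclidean_space"
  assumes "integrable (leb t) f"
  shows "f integrable_on {0..t}" "integral {0..t} f = (\<integral>s. f s \<partial>leb t)"
  using set_borel_integral_eq_integral[of "{0..t}" f] assms
  by (simp_all add: integrable_leb_iff integral_leb_eq)

lemma leb_continuous:
  fixes f :: "real \<Rightarrow> 'b::euclidean_space"
  assumes "continuous_on {0..t} f"
  shows "integrable (leb t) f" "integral {0..t} f = (\<integral>s. f s \<partial>leb t)"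
  using borel_integrable_atLeastAtMost'[OF assms] leb_HK(2)
  by (simp_all add: integrable_leb_iff)

context ou_family
begin

text \<open>The paths of \<open>X 0\<close> are continuous only almost surely.  The exceptional null set is removed, and the
  process is extended to negative times by its value at time \<open>0\<close>, so that all paths become continuous on
  the whole line.\<close>

lemma ex_regular_version:
  obtains N :: "real \<Rightarrow> 'a \<Rightarrow> real^'n"
  where "\<And>s. N s \<in> borel_measurable M"
    and "\<And>\<omega>. \<omega> \<in> space M \<Longrightarrow> continuous_on UNIV (\<lambda>s. N s \<omega>)"
    and "AE \<omega> in M. \<forall>s\<ge>0. N s \<omega> = X 0 s \<omega>"
proof -
  have "AE \<omega> in M. continuous_on {0..} (\<lambda>s. X 0 s \<omega>)" using AE_X_eq[of 0] by eventually_elim simp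
  then obtain E where E: "{\<omega> \<in> space M. \<not> continuous_on {0..} (\<lambda>s. X 0 s \<omega>)} \<subseteq> E" "E \<in> null_sets M"
    by (auto simp: eventually_ae_filter)
  define N where "N s \<omega> = (if \<omega> \<in> E then 0 else X 0 (max 0 s) \<omega>)" for s \<omega>
  show thesis
  proof
    show "N s \<in> borel_measurable M" for s
    proof -
      have [measurable]: "X 0 (max 0 s) \<in> borel_measurable M" by (rule X_measurable) simp
      have [measurable]: "E \<in> sets M" using E by auto
      show ?thesis unfolding N_def by measurable
    qed
    show "continuous_on UNIV (\<lambda>s. N s \<omega>)" if "\<omega> \<in> space M" for \<omega>
    proof (cases "\<omega> \<in> E")
      case False
      then have "continuous_on {0..} (\<lambda>s. X 0 s \<omega>)" using E that by auto
      moreover have "continuous_on UNIV (\<lambda>s::real. max 0 s)" by (intro continuous_intros)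
      ultimately have "continuous_on UNIV (\<lambda>s. X 0 (max 0 s) \<omega>)"
        by (rule continuous_on_compose2) auto
      then show ?thesis using False by (simp add: N_def)
    qed (simp add: N_def)
    show "AE \<omega> in M. \<forall>s\<ge>0. N s \<omega> = X 0 s \<omega>"
      using AE_not_in[OF E(2)] by eventually_elim (auto simp: N_def)
  qed
qed

end

text \<open>\<open>N\<close> is a version of \<open>X 0\<close> all of whose paths are continuous.\<close>

locale ou_regular = ou_family M F B X
  for M :: "'a measure" and F B and X :: "real ^ 'n \<Rightarrow> real \<Rightarrow> 'a \<Rightarrow> real ^ 'n" +
  fixes N :: "real \<Rightarrow> 'a \<Rightarrow> real^'n"
  assumes N_meas[measurable]: "\<And>s. N s \<in> borel_measurable M"
    and N_cont: "\<And>\<omega>. \<omega> \<in> space M \<Longrightarrow> continuous_on UNIV (\<lambda>s. N s \<omega>)"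
    and N_eq: "AE \<omega> in M. \<forall>s\<ge>0. N s \<omega> = X 0 s \<omega>"
begin

lemma N_eq_s: "0 \<le> s \<Longrightarrow> AE \<omega> in M. N s \<omega> = X 0 s \<omega>"
  using N_eq by eventually_elim simp

lemma N_pair: "(\<lambda>p. N (snd p) (fst p)) \<in> borel_measurable (M \<Otimes>\<^sub>M leb t)"
proof -
  have "(\<lambda>p. (snd p, fst p)) \<in> measurable (M \<Otimes>\<^sub>M leb t) (borel \<Otimes>\<^sub>M M)"
    by (intro measurable_Pair measurable_compose[OF measurable_snd ident_leb] measurable_fst)
  from measurable_compose[OF this borel_measurable_pair_continuous_paths[OF N_meas N_cont]]
  show ?thesis by simp
qed

text \<open>The expectation of a functional of the process started at \<open>x + z\<close>, expressed by the process started
  at \<open>x\<close>: the argument of \<open>g\<close> does not depend on \<open>z\<close> any more.\<close>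

lemma cameron_martin_path:
  fixes g V :: "real ^ 'n \<Rightarrow> real" and x z :: "real ^ 'n" and t C0 :: real
  defines "\<phi> \<equiv> \<lambda>s. sinh (t - s) / sinh t"
    and "\<kappa> \<equiv> exp (-t) / (1 - exp (-2 * t))" and "c2 \<equiv> exp (-2 * t) / (1 - exp (-2 * t))"
  assumes t: "0 < t" and V: "continuous_on UNIV V" and Vb: "\<And>y. - C0 \<le> V y"
    and g[measurable]: "g \<in> borel_measurable borel" and g_nn: "\<And>y. 0 \<le> g y"
    and fin: "(\<integral>\<^sup>+\<omega>. ennreal (g (exp (-t) *\<^sub>R (x + z) + N t \<omega>)) \<partial>M) < \<infinity>"
  shows "(\<integral>\<^sup>+\<omega>. ennreal (g (exp (-t) *\<^sub>R (x + z) + N t \<omega>) * exp (- (\<integral>s. V (exp (-s) *\<^sub>R (x + z) + N s \<omega>) \<partial>leb t))) \<partial>M)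
    = (\<integral>\<^sup>+\<omega>. ennreal (g (exp (-t) *\<^sub>R x + N t \<omega>) *
        exp (- (\<integral>s. V (exp (-s) *\<^sub>R x + N s \<omega> + \<phi> s *\<^sub>R z) \<partial>leb t) + \<kappa> * (z \<bullet> N t \<omega>) - c2 * (norm z)\<^sup>2 / 2)) \<partial>M)"
proof -
  let ?g1 = "\<lambda>\<omega>. g (exp (-t) *\<^sub>R (x + z) + N t \<omega>)"
  let ?g2 = "\<lambda>\<omega>. g (exp (-t) *\<^sub>R x + N t \<omega>)"
  let ?I1 = "\<lambda>\<omega>. \<integral>s. V (exp (-s) *\<^sub>R (x + z) + N s \<omega>) \<partial>leb t"
  let ?I2 = "\<lambda>\<omega>. \<integral>s. V (exp (-s) *\<^sub>R x + N s \<omega> + \<phi> s *\<^sub>R z) \<partial>leb t"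
  interpret leb: finite_measure "leb t" by (rule finite_measure_leb)
  (* the direction for which the shift 2 sinh(s) beta, added to phi(s) z, is exp(-s) z *)
  define \<beta> where "\<beta> = c2 *\<^sub>R z"
  define k where "k u = (2 * sinh u) *\<^sub>R \<beta>" for u
  define Z where "Z u w = exp (exp u * (\<beta> \<bullet> w) - (norm \<beta>)\<^sup>2 * (exp (2 * u) - 1) / 2)" for u w
  have sinh_t: "sinh t > 0" using t by simp
  have e2t: "1 - exp (-2 * t) > 0" using t by simp
  have c2_sinh: "2 * sinh t * c2 = exp (-t)"
  proof -
    have "2 * sinh t = exp t * (1 - exp (-2 * t))"
      by (simp add: sinh_def algebra_simps exp_add[symmetric])
    then have "2 * sinh t * c2 = exp t * exp (-2 * t)" using e2t by (simp add: c2_def)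
    then show ?thesis by (simp add: exp_add[symmetric])
  qed
  have shift_eq: "2 * sinh s * c2 + \<phi> s = exp (-s)" for s
  proof -
    have "sinh t * (2 * sinh s * c2 + \<phi> s) = sinh s * (2 * sinh t * c2) + sinh (t - s)"
      using sinh_t by (simp add: \<phi>_def distrib_left)
    also have "\<dots> = sinh t * cosh s - sinh s * (cosh t - exp (-t))"
      unfolding c2_sinh by (simp add: sinh_diff algebra_simps)
    also have "cosh t - exp (-t) = sinh t" by (simp add: cosh_def sinh_def field_simps)
    also have "sinh t * cosh s - sinh s * sinh t = sinh t * exp (-s)"
      by (simp add: cosh_minus_sinh[symmetric] algebra_simps)
    finally show ?thesis using sinh_t by simp
  qed
  have shift: "exp (-s) *\<^sub>R x + (w + k s) + \<phi> s *\<^sub>R z = exp (-s) *\<^sub>R (x + z) + w" for s w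
  proof -
    have "k s + \<phi> s *\<^sub>R z = (2 * sinh s * c2 + \<phi> s) *\<^sub>R z"
      by (simp add: k_def \<beta>_def scaleR_left_distrib)
    then show ?thesis unfolding shift_eq by (simp add: scaleR_right_distrib algebra_simps)
  qed
  have Zt: "Z t w = exp (\<kappa> * (z \<bullet> w) - c2 * (norm z)\<^sup>2 / 2)" for w
  proof -
    have 1: "exp t * c2 = \<kappa>" by (simp add: c2_def \<kappa>_def exp_add[symmetric])
    have 2: "c2 * (exp (2 * t) - 1) = 1"
    proof -
      have "exp (-2 * t) * (exp (2 * t) - 1) = 1 - exp (-2 * t)"
        by (simp add: right_diff_distrib exp_add[symmetric])
      then show ?thesis using e2t by (simp add: c2_def)
    qed
    have "exp t * (\<beta> \<bullet> w) = \<kappa> * (z \<bullet> w)" unfolding 1[symmetric] by (simp add: \<beta>_def)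
    moreover have "(norm \<beta>)\<^sup>2 * (exp (2 * t) - 1) = c2 * (norm z)\<^sup>2 * (c2 * (exp (2 * t) - 1))"
      by (simp add: \<beta>_def power_mult_distrib power2_eq_square)
    ultimately show ?thesis unfolding Z_def 2 by simp
  qed
  have \<phi>_cont: "continuous_on UNIV \<phi>" unfolding \<phi>_def using sinh_t by (intro continuous_intros) auto
  have [measurable]: "V \<in> borel_measurable borel" "\<phi> \<in> borel_measurable borel"
    using V \<phi>_cont by (auto intro: borel_measurable_continuous_onI)
  have [measurable]: "(\<lambda>p. N (snd p) (fst p)) \<in> borel_measurable (M \<Otimes>\<^sub>M leb t)" by (rule N_pair)
  have [measurable]: "snd \<in> borel_measurable (M \<Otimes>\<^sub>M leb t)"
    by (rule measurable_compose[OF measurable_snd ident_leb])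
  have I_meas[measurable]: "(\<lambda>\<omega>. \<integral>s. V (exp (-s) *\<^sub>R x + N s \<omega> + \<phi> s *\<^sub>R z) \<partial>leb t) \<in> borel_measurable M"
    "(\<lambda>\<omega>. \<integral>s. V (exp (-s) *\<^sub>R (x + z) + N s \<omega>) \<partial>leb t) \<in> borel_measurable M"
    by (rule leb.borel_measurable_lebesgue_integral; simp only: split_beta'; measurable)+
  define S where "S m j = real j * (t / real m)" for m j
  define R1 where "R1 m \<omega> = (\<Sum>j<m. (t / real m) * V (exp (- S m j) *\<^sub>R (x + z) + N (S m j) \<omega>))" for m \<omega>
  define R2 where "R2 m \<omega> = (\<Sum>j<m. (t / real m) * V (exp (- S m j) *\<^sub>R x + N (S m j) \<omega> + \<phi> (S m j) *\<^sub>R z))" for m \<omega>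
  have [measurable]: "R1 m \<in> borel_measurable M" "R2 m \<in> borel_measurable M" for m
    unfolding R1_def R2_def by measurable
  have Z_meas[measurable]: "Z u \<in> borel_measurable borel" for u unfolding Z_def by measurable
  have S_nn: "0 \<le> S m j" for m j using t by (simp add: S_def)
  have grid: "(\<integral>\<^sup>+\<omega>. ennreal (exp (- R1 m \<omega>) * ?g1 \<omega>) \<partial>M)
     = (\<integral>\<^sup>+\<omega>. ennreal (exp (- R2 m \<omega>) * (?g2 \<omega> * Z t (N t \<omega>))) \<partial>M)"
    if m: "m > 0" for m
  proof -
    define f where "f j w = ennreal (exp (- ((t / real m) * V (exp (- S m j) *\<^sub>R x + w + \<phi> (S m j) *\<^sub>R z))))" for j w
    define \<psi> where "\<psi> w = ennreal (g (exp (-t) *\<^sub>R x + w))" for w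
    have [measurable]: "f j \<in> borel_measurable borel" "\<psi> \<in> borel_measurable borel" for j
      unfolding f_def \<psi>_def by measurable
    have Sm: "S m m = t" using m by (simp add: S_def)
    have \<phi>t: "\<phi> t = 0" by (simp add: \<phi>_def)
    have g_shift: "exp (-t) *\<^sub>R x + (w + k t) = exp (-t) *\<^sub>R (x + z) + w" for w
      using shift[of t w] \<phi>t by simp
    have N_S: "AE \<omega> in M. \<forall>j. N (S m j) \<omega> = X 0 (S m j) \<omega>"
      using N_eq by eventually_elim (simp add: S_nn)
    have "(\<integral>\<^sup>+\<omega>. ennreal (exp (- R1 m \<omega>) * ?g1 \<omega>) \<partial>M)
      = (\<integral>\<^sup>+\<omega>. (\<Prod>j<m. f j (X 0 (S m j) \<omega> + k (S m j))) * \<psi> (X 0 (S m m) \<omega> + k (S m m)) \<partial>M)"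
    proof (rule nn_integral_cong_AE)
      show "AE \<omega> in M. ennreal (exp (- R1 m \<omega>) * ?g1 \<omega>)
        = (\<Prod>j<m. f j (X 0 (S m j) \<omega> + k (S m j))) * \<psi> (X 0 (S m m) \<omega> + k (S m m))"
        using N_S
      proof eventually_elim
        case (elim \<omega>)
        have 1: "(\<Prod>j<m. f j (X 0 (S m j) \<omega> + k (S m j))) = ennreal (exp (- R1 m \<omega>))"
          unfolding f_def R1_def shift by (subst prod_ennreal) (auto simp: elim exp_sum sum_negf[symmetric])
        have 2: "\<psi> (X 0 (S m m) \<omega> + k (S m m)) = ennreal (?g1 \<omega>)"
          unfolding \<psi>_def using elim[rule_format, of m] by (simp only: Sm g_shift)
        show ?case unfolding 1 2 by (simp add: ennreal_mult g_nn)
      qed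
    qed
    also have "\<dots> = (\<integral>\<^sup>+\<omega>. (\<Prod>j<m. f j (X 0 (S m j) \<omega>)) * (\<psi> (X 0 (S m m) \<omega>) * ennreal (Z (S m m) (X 0 (S m m) \<omega>))) \<partial>M)"
      unfolding k_def Z_def
      by (rule cameron_martin_grid) (use m t in \<open>auto simp: S_def divide_simps\<close>)
    also have "\<dots> = (\<integral>\<^sup>+\<omega>. ennreal (exp (- R2 m \<omega>) * (?g2 \<omega> * Z t (N t \<omega>))) \<partial>M)"
    proof (rule nn_integral_cong_AE)
      show "AE \<omega> in M. (\<Prod>j<m. f j (X 0 (S m j) \<omega>)) * (\<psi> (X 0 (S m m) \<omega>) * ennreal (Z (S m m) (X 0 (S m m) \<omega>)))
        = ennreal (exp (- R2 m \<omega>) * (?g2 \<omega> * Z t (N t \<omega>)))"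
        using N_S
      proof eventually_elim
        case (elim \<omega>)
        have 1: "(\<Prod>j<m. f j (X 0 (S m j) \<omega>)) = ennreal (exp (- R2 m \<omega>))"
          unfolding f_def R2_def by (subst prod_ennreal) (auto simp: elim exp_sum sum_negf[symmetric])
        have 2: "X 0 t \<omega> = N t \<omega>" using elim[rule_format, of m] by (simp add: Sm)
        show ?case unfolding 1 \<psi>_def Sm 2 by (simp add: ennreal_mult g_nn Z_def)
      qed
    qed
    finally show ?thesis .
  qed
  (* the case of the grid formula without potential *)
  have fin2: "(\<integral>\<^sup>+\<omega>. ennreal (?g2 \<omega> * Z t (N t \<omega>)) \<partial>M) < \<infinity>"
  proof -
    define \<psi> where "\<psi> w = ennreal (g (exp (-t) *\<^sub>R x + w))" for w
    have [measurable]: "\<psi> \<in> borel_measurable borel" unfolding \<psi>_def by measurable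
    have g_shift: "exp (-t) *\<^sub>R x + (w + k t) = exp (-t) *\<^sub>R (x + z) + w" for w
      using shift[of t w] by (simp add: \<phi>_def)
    have "(\<integral>\<^sup>+\<omega>. ennreal (?g2 \<omega> * Z t (N t \<omega>)) \<partial>M)
       = (\<integral>\<^sup>+\<omega>. \<psi> (X 0 t \<omega>) * ennreal (Z t (X 0 t \<omega>)) \<partial>M)"
      using N_eq_s[of t] t
      by (intro nn_integral_cong_AE) (auto simp: \<psi>_def ennreal_mult g_nn Z_def elim!: eventually_mono)
    also have "\<dots> = (\<integral>\<^sup>+\<omega>. \<psi> (X 0 t \<omega> + k t) \<partial>M)"
      using cameron_martin_grid[where s="\<lambda>j. real j * t" and \<phi>="\<lambda>_ _. 1" and \<psi>=\<psi> and m=1 and \<beta>=\<beta>] t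
      by (simp add: k_def Z_def)
    also have "\<dots> = (\<integral>\<^sup>+\<omega>. ennreal (?g1 \<omega>) \<partial>M)"
      using N_eq_s[of t] t unfolding \<psi>_def g_shift
      by (intro nn_integral_cong_AE) (auto elim!: eventually_mono)
    finally show ?thesis using fin by simp
  qed
  have R_lb: "- (C0 * t) \<le> (\<Sum>j<m. (t / real m) * V (y j))" if "m > 0" for m and y :: "nat \<Rightarrow> real^'n"
  proof -
    have "(\<Sum>j<m. (t / real m) * (- C0)) \<le> (\<Sum>j<m. (t / real m) * V (y j))"
      using t by (intro sum_mono mult_left_mono Vb) auto
    then show ?thesis using that by (simp add: mult.commute)
  qed
  have lim: "(\<lambda>i. \<Sum>j<Suc i. (t / real (Suc i)) * V (f (S (Suc i) j))) \<longlonglongrightarrow> (\<integral>s. V (f s) \<partial>leb t)"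
    if "continuous_on UNIV f" for f
  proof -
    have c: "continuous_on {0..t} (\<lambda>s. V (f s))"
      by (rule continuous_on_compose2[OF V]) (use that in \<open>auto intro: continuous_on_subset\<close>)
    have "(\<lambda>m. \<Sum>j<m. (t / real m) * V (f (S m j))) \<longlonglongrightarrow> (\<integral>s. V (f s) \<partial>leb t)"
      using riemann_sum_tendsto[OF c] t leb_continuous(2)[OF c] by (simp add: S_def)
    then show ?thesis by (rule LIMSEQ_Suc)
  qed
  have L1: "(\<lambda>i. \<integral>\<^sup>+\<omega>. ennreal (exp (- R1 (Suc i) \<omega>) * ?g1 \<omega>) \<partial>M)
    \<longlonglongrightarrow> (\<integral>\<^sup>+\<omega>. ennreal (exp (- ?I1 \<omega>) * ?g1 \<omega>) \<partial>M)"
  proof (rule nn_integral_dominated_convergence[where w="\<lambda>\<omega>. ennreal (exp (C0 * t)) * ennreal (?g1 \<omega>)"])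
    show "AE \<omega> in M. ennreal (exp (- R1 (Suc i) \<omega>) * ?g1 \<omega>) \<le> ennreal (exp (C0 * t)) * ennreal (?g1 \<omega>)" for i
      unfolding ennreal_mult[OF exp_ge_zero g_nn, symmetric] R1_def
    proof (intro AE_I2 ennreal_leI mult_right_mono g_nn)
      fix \<omega> show "exp (- (\<Sum>j<Suc i. (t / real (Suc i)) * V (exp (- S (Suc i) j) *\<^sub>R (x + z) + N (S (Suc i) j) \<omega>))) \<le> exp (C0 * t)"
        using R_lb[of "Suc i" "\<lambda>j. exp (- S (Suc i) j) *\<^sub>R (x + z) + N (S (Suc i) j) \<omega>"] by simp
    qed
    show "(\<integral>\<^sup>+\<omega>. ennreal (exp (C0 * t)) * ennreal (?g1 \<omega>) \<partial>M) < \<infinity>"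
      using fin by (simp add: nn_integral_cmult ennreal_mult_less_top)
    show "AE \<omega> in M. (\<lambda>i. ennreal (exp (- R1 (Suc i) \<omega>) * ?g1 \<omega>))
      \<longlonglongrightarrow> ennreal (exp (- ?I1 \<omega>) * ?g1 \<omega>)"
      unfolding R1_def
      by (intro AE_I2 tendsto_ennrealI tendsto_mult tendsto_exp tendsto_minus tendsto_const lim continuous_intros N_cont)
  qed measurable
  have L2: "(\<lambda>i. \<integral>\<^sup>+\<omega>. ennreal (exp (- R2 (Suc i) \<omega>) * (?g2 \<omega> * Z t (N t \<omega>))) \<partial>M)
    \<longlonglongrightarrow> (\<integral>\<^sup>+\<omega>. ennreal (exp (- ?I2 \<omega>) * (?g2 \<omega> * Z t (N t \<omega>))) \<partial>M)"
  proof (rule nn_integral_dominated_convergence[where w="\<lambda>\<omega>. ennreal (exp (C0 * t)) * ennreal (?g2 \<omega> * Z t (N t \<omega>))"])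
    have gZ: "0 \<le> ?g2 \<omega> * Z t (N t \<omega>)" for \<omega> by (simp add: g_nn Z_def)
    show "AE \<omega> in M. ennreal (exp (- R2 (Suc i) \<omega>) * (?g2 \<omega> * Z t (N t \<omega>))) \<le> ennreal (exp (C0 * t)) * ennreal (?g2 \<omega> * Z t (N t \<omega>))" for i
      unfolding ennreal_mult[OF exp_ge_zero gZ, symmetric] R2_def
    proof (intro AE_I2 ennreal_leI mult_right_mono gZ)
      fix \<omega> show "exp (- (\<Sum>j<Suc i. (t / real (Suc i)) * V (exp (- S (Suc i) j) *\<^sub>R x + N (S (Suc i) j) \<omega> + \<phi> (S (Suc i) j) *\<^sub>R z))) \<le> exp (C0 * t)"
        using R_lb[of "Suc i" "\<lambda>j. exp (- S (Suc i) j) *\<^sub>R x + N (S (Suc i) j) \<omega> + \<phi> (S (Suc i) j) *\<^sub>R z"] by simp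
    qed
    show "(\<integral>\<^sup>+\<omega>. ennreal (exp (C0 * t)) * ennreal (?g2 \<omega> * Z t (N t \<omega>)) \<partial>M) < \<infinity>"
      using fin2 by (simp add: nn_integral_cmult ennreal_mult_less_top)
    show "AE \<omega> in M. (\<lambda>i. ennreal (exp (- R2 (Suc i) \<omega>) * (?g2 \<omega> * Z t (N t \<omega>))))
      \<longlonglongrightarrow> ennreal (exp (- ?I2 \<omega>) * (?g2 \<omega> * Z t (N t \<omega>)))"
      unfolding R2_def
      by (intro AE_I2 tendsto_ennrealI tendsto_mult tendsto_exp tendsto_minus tendsto_const lim continuous_intros N_cont \<phi>_cont)
  qed measurable
  have "(\<integral>\<^sup>+\<omega>. ennreal (exp (- ?I1 \<omega>) * ?g1 \<omega>) \<partial>M)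
    = (\<integral>\<^sup>+\<omega>. ennreal (exp (- ?I2 \<omega>) * (?g2 \<omega> * Z t (N t \<omega>))) \<partial>M)"
    using L1 L2 unfolding grid[OF zero_less_Suc] by (rule LIMSEQ_unique)
  then show ?thesis
    unfolding Zt by (simp only: add_diff_eq[symmetric] exp_add mult_ac)
qed

end

section \<open>Random variables with all moments\<close>

text \<open>Random variables with finite absolute moments of all orders, an algebra of admissible factors for a
  square integrable variable.\<close>

definition all_moments :: "'a measure \<Rightarrow> ('a \<Rightarrow> real) \<Rightarrow> bool" where
  "all_moments M R \<longleftrightarrow> R \<in> borel_measurable M \<and> (\<forall>p::nat. integrable M (\<lambda>\<omega>. \<bar>R \<omega>\<bar> ^ p))"

lemma all_momentsD:
  assumes "all_moments M R"
  shows "R \<in> borel_measurable M" "integrable M (\<lambda>\<omega>. \<bar>R \<omega>\<bar> ^ p)"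
  using assms by (auto simp: all_moments_def)

lemma all_moments_bound:
  assumes R: "all_moments M R" and f: "f \<in> borel_measurable M"
    and le: "\<And>\<omega>. \<omega> \<in> space M \<Longrightarrow> \<bar>f \<omega>\<bar> \<le> \<bar>R \<omega>\<bar>"
  shows "all_moments M f"
  unfolding all_moments_def
proof (intro conjI allI f)
  fix p show "integrable M (\<lambda>\<omega>. \<bar>f \<omega>\<bar> ^ p)"
    by (rule Bochner_Integration.integrable_bound[OF all_momentsD(2)[OF R, of p]])
       (use f le in \<open>auto intro!: AE_I2 power_mono\<close>)
qed

lemma (in finite_measure) all_moments_const: "all_moments M (\<lambda>_. c)"
  by (simp add: all_moments_def)

lemma all_moments_add:
  assumes "all_moments M f" "all_moments M g"
  shows "all_moments M (\<lambda>\<omega>. f \<omega> + g \<omega>)"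
  unfolding all_moments_def
proof (intro conjI allI)
  note [measurable] = all_momentsD(1)[OF assms(1)] all_momentsD(1)[OF assms(2)]
  show "(\<lambda>\<omega>. f \<omega> + g \<omega>) \<in> borel_measurable M" by measurable
  fix p
  have "integrable M (\<lambda>\<omega>. 2 ^ p * (\<bar>f \<omega>\<bar> ^ p + \<bar>g \<omega>\<bar> ^ p))"
    using assms by (auto simp: all_moments_def)
  then show "integrable M (\<lambda>\<omega>. \<bar>f \<omega> + g \<omega>\<bar> ^ p)"
  proof (rule Bochner_Integration.integrable_bound)
    show "AE \<omega> in M. norm (\<bar>f \<omega> + g \<omega>\<bar> ^ p) \<le> norm (2 ^ p * (\<bar>f \<omega>\<bar> ^ p + \<bar>g \<omega>\<bar> ^ p))"
    proof (rule AE_I2)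
      fix \<omega>
      have "\<bar>f \<omega> + g \<omega>\<bar> \<le> 2 * max \<bar>f \<omega>\<bar> \<bar>g \<omega>\<bar>" by linarith
      then have "\<bar>f \<omega> + g \<omega>\<bar> ^ p \<le> (2 * max \<bar>f \<omega>\<bar> \<bar>g \<omega>\<bar>) ^ p" by (rule power_mono) simp
      also have "\<dots> = 2 ^ p * max \<bar>f \<omega>\<bar> \<bar>g \<omega>\<bar> ^ p" by (rule power_mult_distrib)
      also have "max \<bar>f \<omega>\<bar> \<bar>g \<omega>\<bar> ^ p \<le> \<bar>f \<omega>\<bar> ^ p + \<bar>g \<omega>\<bar> ^ p" by (simp add: max_def)
      finally show "norm (\<bar>f \<omega> + g \<omega>\<bar> ^ p) \<le> norm (2 ^ p * (\<bar>f \<omega>\<bar> ^ p + \<bar>g \<omega>\<bar> ^ p))" by simp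
    qed
  qed measurable
qed

lemma all_moments_mult:
  assumes "all_moments M f" "all_moments M g"
  shows "all_moments M (\<lambda>\<omega>. f \<omega> * g \<omega>)"
  unfolding all_moments_def
proof (intro conjI allI)
  note [measurable] = all_momentsD(1)[OF assms(1)] all_momentsD(1)[OF assms(2)]
  show "(\<lambda>\<omega>. f \<omega> * g \<omega>) \<in> borel_measurable M" by measurable
  fix p
  have "integrable M (\<lambda>\<omega>. \<bar>f \<omega>\<bar> ^ (2 * p) + \<bar>g \<omega>\<bar> ^ (2 * p))"
    using all_momentsD(2)[OF assms(1), of "2*p"] all_momentsD(2)[OF assms(2), of "2*p"] by (rule Bochner_Integration.integrable_add)
  then show "integrable M (\<lambda>\<omega>. \<bar>f \<omega> * g \<omega>\<bar> ^ p)"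
  proof (rule Bochner_Integration.integrable_bound)
    show "AE \<omega> in M. norm (\<bar>f \<omega> * g \<omega>\<bar> ^ p) \<le> norm (\<bar>f \<omega>\<bar> ^ (2 * p) + \<bar>g \<omega>\<bar> ^ (2 * p))"
    proof (rule AE_I2)
      fix \<omega>
      have "2 * (\<bar>f \<omega>\<bar> ^ p * \<bar>g \<omega>\<bar> ^ p) \<le> (\<bar>f \<omega>\<bar> ^ p)\<^sup>2 + (\<bar>g \<omega>\<bar> ^ p)\<^sup>2"
        using sum_squares_bound[of "\<bar>f \<omega>\<bar> ^ p" "\<bar>g \<omega>\<bar> ^ p"] by (simp add: mult.assoc)
      moreover have "0 \<le> \<bar>f \<omega>\<bar> ^ p * \<bar>g \<omega>\<bar> ^ p" by simp
      ultimately have "\<bar>f \<omega>\<bar> ^ p * \<bar>g \<omega>\<bar> ^ p \<le> (\<bar>f \<omega>\<bar> ^ p)\<^sup>2 + (\<bar>g \<omega>\<bar> ^ p)\<^sup>2" by linarith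
      then show "norm (\<bar>f \<omega> * g \<omega>\<bar> ^ p) \<le> norm (\<bar>f \<omega>\<bar> ^ (2 * p) + \<bar>g \<omega>\<bar> ^ (2 * p))"
        by (simp add: abs_mult power_mult_distrib power_even_eq abs_of_nonneg)
    qed
  qed measurable
qed

lemma integrable_L2_all_moments:
  assumes [measurable]: "G \<in> borel_measurable M" and G2: "integrable M (\<lambda>\<omega>. (G \<omega>)\<^sup>2 :: real)" and R: "all_moments M R"
  shows "integrable M (\<lambda>\<omega>. G \<omega> * R \<omega>)"
proof -
  note [measurable] = all_momentsD(1)[OF R]
  have "integrable M (\<lambda>\<omega>. (G \<omega>)\<^sup>2 + \<bar>R \<omega>\<bar> ^ 2)"
    using G2 all_momentsD(2)[OF R, of 2] by (rule Bochner_Integration.integrable_add)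
  then show ?thesis
  proof (rule Bochner_Integration.integrable_bound)
    show "AE \<omega> in M. norm (G \<omega> * R \<omega>) \<le> norm ((G \<omega>)\<^sup>2 + \<bar>R \<omega>\<bar> ^ 2)"
    proof (rule AE_I2)
      fix \<omega>
      have "2 * (\<bar>G \<omega>\<bar> * \<bar>R \<omega>\<bar>) \<le> (G \<omega>)\<^sup>2 + \<bar>R \<omega>\<bar>\<^sup>2"
        using sum_squares_bound[of "\<bar>G \<omega>\<bar>" "\<bar>R \<omega>\<bar>"] by (simp add: mult.assoc)
      moreover have "0 \<le> \<bar>G \<omega>\<bar> * \<bar>R \<omega>\<bar>" by simp
      ultimately have "\<bar>G \<omega>\<bar> * \<bar>R \<omega>\<bar> \<le> (G \<omega>)\<^sup>2 + \<bar>R \<omega>\<bar>\<^sup>2" by linarith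
      then show "norm (G \<omega> * R \<omega>) \<le> norm ((G \<omega>)\<^sup>2 + \<bar>R \<omega>\<bar> ^ 2)" by (simp add: abs_mult)
    qed
  qed measurable
qed

lemma poly_growth_exp_bound:
  assumes "poly_growth f"
  obtains C where "0 \<le> C" "\<And>x. \<bar>f x\<bar> \<le> C * exp (norm x)"
proof -
  obtain C N where *: "\<And>x. \<bar>f x\<bar> \<le> C * (1 + norm x) ^ N" using assms unfolding poly_growth_def by metis
  have pow: "(1 + r) ^ N \<le> real (Suc N) ^ N * exp 1 * exp r" if "0 \<le> r" for r :: real
  proof -
    have "(1 + r) / real (Suc N) \<le> exp ((1 + r) / real (Suc N))"
      using exp_ge_add_one_self[of "(1 + r) / real (Suc N)"] by linarith
    then have "((1 + r) / real (Suc N)) ^ N \<le> exp ((1 + r) / real (Suc N)) ^ N"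
      using that by (intro power_mono) auto
    also have "\<dots> = exp (real N * ((1 + r) / real (Suc N)))" by (rule exp_of_nat_mult[symmetric])
    also have "\<dots> \<le> exp (1 + r)"
      using that by (simp add: divide_simps)
    finally have "(1 + r) ^ N \<le> exp (1 + r) * real (Suc N) ^ N"
      by (simp add: power_divide divide_simps)
    then show ?thesis by (simp add: exp_add mult_ac)
  qed
  show thesis
  proof (rule that[of "\<bar>C\<bar> * (real (Suc N) ^ N * exp 1)"])
    fix x
    have "\<bar>f x\<bar> \<le> \<bar>C\<bar> * (1 + norm x) ^ N" using *[of x] by (rule order_trans) (simp add: mult_right_mono)
    also have "\<dots> \<le> \<bar>C\<bar> * (real (Suc N) ^ N * exp 1 * exp (norm x))" by (intro mult_left_mono pow) auto
    finally show "\<bar>f x\<bar> \<le> \<bar>C\<bar> * (real (Suc N) ^ N * exp 1) * exp (norm x)" by (simp add: mult_ac)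
  qed simp
qed

text \<open>Jensen's inequality for the normalised time integral.\<close>

lemma leb_power_le:
  fixes f :: "real \<Rightarrow> real"
  assumes t: "0 < t" and f: "continuous_on {0..t} f" and pos: "\<And>s. 0 < f s"
  shows "(\<integral>s. f s \<partial>leb t) ^ p \<le> t ^ p / t * (\<integral>s. f s ^ p \<partial>leb t)"
proof -
  define P where "P = density (leb t) (\<lambda>_. ennreal (1 / t))"
  have fin: "emeasure (leb t) {0..t} = ennreal t" using t by (simp add: leb_def emeasure_restrict_space)
  have P: "prob_space P"
  proof
    have "emeasure P (space P) = ennreal (1 / t) * emeasure (leb t) {0..t}"
      unfolding P_def by (subst emeasure_density) (use sets.top[of "leb t"] in \<open>auto simp: nn_integral_cmult_indicator\<close>)
    then show "emeasure P (space P) = 1" using t by (simp add: fin ennreal_mult[symmetric])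
  qed
  interpret P: prob_space P by fact
  have int: "integrable (leb t) f" "integrable (leb t) (\<lambda>s. f s ^ p)"
    using f by (auto intro!: leb_continuous(1) continuous_intros)
  then have intP: "integrable P f" "integrable P (\<lambda>s. f s ^ p)"
    unfolding P_def using t by (auto simp: integrable_density)
  have conv: "convex_on {0<..} (\<lambda>x::real. x ^ p)"
  proof (cases "even p")
    case True then show ?thesis by (rule convex_on_subset[OF convex_power_even]) auto
  next
    case False then show ?thesis by (rule convex_on_subset[OF convex_power_odd]) auto
  qed
  have "(\<integral>s. f s \<partial>P) ^ p \<le> (\<integral>s. f s ^ p \<partial>P)"
    by (rule P.jensens_inequality[where I="{0<..}" and a=0]) (use intP conv pos in auto)
  moreover have "(\<integral>s. f s \<partial>P) = (1 / t) * (\<integral>s. f s \<partial>leb t)" "(\<integral>s. f s ^ p \<partial>P) = (1 / t) * (\<integral>s. f s ^ p \<partial>leb t)"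
    unfolding P_def using t int by (simp_all add: integral_density)
  ultimately show ?thesis using t by (simp add: power_divide divide_simps power_mult_distrib mult_ac)
qed

section \<open>Differentiation of exponential path functionals\<close>

text \<open>The abstract setting for differentiating the shifted functional.  \<open>Y\<close> is a process on \<open>[0, t]\<close> with
  exponential moments, \<open>G\<close> a square integrable payoff, \<open>N0\<close> the Gaussian vector in the Cameron-Martin
  weight, and \<open>\<phi>\<close> the profile in time of the perturbation of the path.\<close>

locale path_functional = prob_space M for M :: "'a measure" +
  fixes Y :: "real \<Rightarrow> 'a \<Rightarrow> real^'n" and G :: "'a \<Rightarrow> real" and N0 :: "'a \<Rightarrow> real^'n"
    and V :: "real^'n \<Rightarrow> real" and \<phi> :: "real \<Rightarrow> real" and \<kappa> c2 t C0 :: real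
  assumes t: "0 < t"
    and Y_pair[measurable]: "(\<lambda>p. Y (snd p) (fst p)) \<in> borel_measurable (M \<Otimes>\<^sub>M leb t)"
    and Y_cont: "\<And>\<omega>. \<omega> \<in> space M \<Longrightarrow> continuous_on {0..t} (\<lambda>s. Y s \<omega>)"
    and Y_exp: "\<And>c. \<exists>K<\<infinity>. \<forall>s\<in>{0..t}. (\<integral>\<^sup>+\<omega>. ennreal (exp (c * norm (Y s \<omega>))) \<partial>M) \<le> K"
    and N0_meas[measurable]: "N0 \<in> borel_measurable M"
    and N0_exp: "\<And>c. (\<integral>\<^sup>+\<omega>. ennreal (exp (c * norm (N0 \<omega>))) \<partial>M) < \<infinity>"
    and G_meas[measurable]: "G \<in> borel_measurable M"
    and G2: "integrable M (\<lambda>\<omega>. (G \<omega>)\<^sup>2)"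
    and V: "V \<in> D_class (Suc (Suc 0))"
    and V_lb: "\<And>y. - C0 \<le> V y"
    and \<phi>_cont: "continuous_on UNIV \<phi>"
    and \<phi>_le: "\<And>s. s \<in> {0..t} \<Longrightarrow> \<bar>\<phi> s\<bar> \<le> 1"
    and \<kappa>: "0 \<le> \<kappa>" and c2: "0 \<le> c2"
begin

sublocale leb: finite_measure "leb t" by (rule finite_measure_leb)
sublocale pair: pair_sigma_finite M "leb t" ..

text \<open>This time integral dominates, up to constants, the integrals of all functions of polynomial growth
  along the path.\<close>

definition J :: "'a \<Rightarrow> real" where
  "J \<omega> = (\<integral>s. exp (norm (Y s \<omega>)) \<partial>leb t)"

lemma J_nonneg: "0 \<le> J \<omega>" unfolding J_def by simp

lemma J_meas[measurable]: "J \<in> borel_measurable M"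
  unfolding J_def by (rule leb.borel_measurable_lebesgue_integral) (simp only: split_beta', measurable)

lemma exp_Y_cont: "\<omega> \<in> space M \<Longrightarrow> continuous_on {0..t} (\<lambda>s. exp (norm (Y s \<omega>)))"
  using Y_cont by (intro continuous_intros) auto

lemma all_moments_J: "all_moments M J"
  unfolding all_moments_def
proof (intro conjI allI J_meas)
  fix p
  obtain K where K: "K < \<infinity>" "\<And>s. s \<in> {0..t} \<Longrightarrow> (\<integral>\<^sup>+\<omega>. ennreal (exp (real p * norm (Y s \<omega>))) \<partial>M) \<le> K"
    using Y_exp[of "real p"] by auto
  show "integrable M (\<lambda>\<omega>. \<bar>J \<omega>\<bar> ^ p)"
  proof (rule integrableI_bounded)
    have "(\<integral>\<^sup>+\<omega>. ennreal (norm (\<bar>J \<omega>\<bar> ^ p)) \<partial>M) \<le> (\<integral>\<^sup>+\<omega>. ennreal (t ^ p / t) * (\<integral>\<^sup>+s. ennreal (exp (real p * norm (Y s \<omega>))) \<partial>leb t) \<partial>M)"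
    proof (rule nn_integral_mono)
      fix \<omega> assume \<omega>: "\<omega> \<in> space M"
      have "J \<omega> ^ p \<le> t ^ p / t * (\<integral>s. exp (norm (Y s \<omega>)) ^ p \<partial>leb t)"
        unfolding J_def by (rule leb_power_le[OF t exp_Y_cont[OF \<omega>]]) simp
      moreover have "integrable (leb t) (\<lambda>s. exp (norm (Y s \<omega>)) ^ p)"
        using exp_Y_cont[OF \<omega>] by (intro leb_continuous(1) continuous_on_power)
      ultimately show "ennreal (norm (\<bar>J \<omega>\<bar> ^ p)) \<le> ennreal (t ^ p / t) * (\<integral>\<^sup>+s. ennreal (exp (real p * norm (Y s \<omega>))) \<partial>leb t)"
        using t J_nonneg[of \<omega>]
        by (simp add: exp_of_nat_mult nn_integral_eq_integral ennreal_mult[symmetric] ennreal_leI)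
    qed
    also have "\<dots> = ennreal (t ^ p / t) * (\<integral>\<^sup>+\<omega>. (\<integral>\<^sup>+s. ennreal (exp (real p * norm (Y s \<omega>))) \<partial>leb t) \<partial>M)"
      by (rule nn_integral_cmult, rule leb.borel_measurable_nn_integral) (simp only: split_beta', measurable)
    also have "(\<integral>\<^sup>+\<omega>. (\<integral>\<^sup>+s. ennreal (exp (real p * norm (Y s \<omega>))) \<partial>leb t) \<partial>M) = (\<integral>\<^sup>+s. (\<integral>\<^sup>+\<omega>. ennreal (exp (real p * norm (Y s \<omega>))) \<partial>M) \<partial>leb t)"
      by (rule pair.Fubini'[symmetric]) (simp only: split_beta', measurable)
    also have "\<dots> \<le> (\<integral>\<^sup>+s. K \<partial>leb t)"
      by (rule nn_integral_mono) (use K in simp)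
    also have "ennreal (t ^ p / t) * (\<integral>\<^sup>+s. K \<partial>leb t) < \<infinity>"
    proof -
      have "emeasure (leb t) {0..t} < \<top>" by (metis leb.emeasure_finite infinity_ennreal_def top.not_eq_extremum)
      then show ?thesis using K(1) by (simp add: ennreal_mult_less_top)
    qed
    finally show "(\<integral>\<^sup>+\<omega>. ennreal (norm (\<bar>J \<omega>\<bar> ^ p)) \<partial>M) < \<infinity>"
      by (simp add: mult_left_mono)
  qed measurable
qed

lemma all_moments_exp_N0: "all_moments M (\<lambda>\<omega>. exp (c * norm (N0 \<omega>)))"
  unfolding all_moments_def
proof (intro conjI allI)
  fix p
  show "integrable M (\<lambda>\<omega>. \<bar>exp (c * norm (N0 \<omega>))\<bar> ^ p)"
    by (rule integrableI_bounded)
       (use N0_exp[of "real p * c"] in \<open>simp_all add: exp_of_nat_mult[symmetric] mult.assoc\<close>)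
qed measurable

lemma all_moments_N0: "all_moments M (\<lambda>\<omega>. norm (N0 \<omega>))"
proof (rule all_moments_bound[OF all_moments_exp_N0[of 1]])
  fix \<omega> show "\<bar>norm (N0 \<omega>)\<bar> \<le> \<bar>exp (1 * norm (N0 \<omega>))\<bar>"
  proof -
    have "norm (N0 \<omega>) \<le> exp (norm (N0 \<omega>))" using exp_ge_add_one_self[of "norm (N0 \<omega>)"] by linarith
    then show ?thesis by simp
  qed
qed measurable

text \<open>The weighted time integral of \<open>W\<close> along the path \<open>Y + \<phi> z\<close>.\<close>

definition pint :: "(real \<Rightarrow> real) \<Rightarrow> (real^'n \<Rightarrow> real) \<Rightarrow> real^'n \<Rightarrow> 'a \<Rightarrow> real" where
  "pint w W z \<omega> = (\<integral>s. w s * W (Y s \<omega> + \<phi> s *\<^sub>R z) \<partial>leb t)"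

lemma cont_path:
  fixes W :: "real^'n \<Rightarrow> real"
  assumes "continuous_on UNIV w" "continuous_on UNIV W" "\<omega> \<in> space M"
  shows "continuous_on {0..t} (\<lambda>s. w s * W (Y s \<omega> + \<phi> s *\<^sub>R z))"
proof -
  have "continuous_on {0..t} w" "continuous_on {0..t} \<phi>"
    using assms(1) \<phi>_cont by (auto intro: continuous_on_subset)
  moreover from this have "continuous_on {0..t} (\<lambda>s. W (Y s \<omega> + \<phi> s *\<^sub>R z))"
    by (intro continuous_on_compose2[OF assms(2)] continuous_intros Y_cont assms(3)) auto
  ultimately show ?thesis by (intro continuous_intros)
qed

lemma pint_integrable:
  fixes W :: "real^'n \<Rightarrow> real"
  assumes "continuous_on UNIV w" "continuous_on UNIV W" "\<omega> \<in> space M"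
  shows "integrable (leb t) (\<lambda>s. w s * W (Y s \<omega> + \<phi> s *\<^sub>R z))"
  by (rule leb_continuous(1)[OF cont_path[OF assms]])

lemma pint_pair_meas:
  fixes W :: "real^'n \<Rightarrow> real"
  assumes "continuous_on UNIV w" "continuous_on UNIV W"
  shows "(\<lambda>p. w (snd p) * W (Y (snd p) (fst p) + \<phi> (snd p) *\<^sub>R z)) \<in> borel_measurable (M \<Otimes>\<^sub>M leb t)"
proof -
  have [measurable]: "w \<in> borel_measurable borel" "W \<in> borel_measurable borel" "\<phi> \<in> borel_measurable borel"
    using assms \<phi>_cont by (auto intro: borel_measurable_continuous_onI)
  have [measurable]: "snd \<in> borel_measurable (M \<Otimes>\<^sub>M leb t)"
    by (rule measurable_compose[OF measurable_snd ident_leb])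
  show ?thesis by measurable
qed

lemma pint_meas:
  fixes W :: "real^'n \<Rightarrow> real"
  assumes "continuous_on UNIV w" "continuous_on UNIV W"
  shows "pint w W z \<in> borel_measurable M"
  unfolding pint_def using pint_pair_meas[OF assms]
  by (intro leb.borel_measurable_lebesgue_integral) (simp add: split_beta')

lemma exp_norm_shift:
  assumes "s \<in> {0..t}"
  shows "exp (norm (Y s \<omega> + \<phi> s *\<^sub>R z)) \<le> exp (norm z) * exp (norm (Y s \<omega>))"
proof -
  have "\<bar>\<phi> s\<bar> * norm z \<le> 1 * norm z" using \<phi>_le[OF assms] by (rule mult_right_mono) simp
  then have "norm (Y s \<omega> + \<phi> s *\<^sub>R z) \<le> norm z + norm (Y s \<omega>)"
    using norm_triangle_ineq[of "Y s \<omega>" "\<phi> s *\<^sub>R z"] by simp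
  then show ?thesis by (simp add: exp_add[symmetric])
qed

lemma pint_bound:
  assumes w: "continuous_on UNIV w" "\<And>s. s \<in> {0..t} \<Longrightarrow> \<bar>w s\<bar> \<le> 1"
    and W: "continuous_on UNIV W" "\<And>y. \<bar>W y\<bar> \<le> C * exp (norm y)" and \<omega>: "\<omega> \<in> space M"
  shows "\<bar>pint w W z \<omega>\<bar> \<le> C * exp (norm z) * J \<omega>"
proof -
  have C: "0 \<le> C" using W(2)[of 0] by simp
  have "\<bar>pint w W z \<omega>\<bar> \<le> (\<integral>s. C * exp (norm z) * exp (norm (Y s \<omega>)) \<partial>leb t)"
    unfolding pint_def real_norm_def[symmetric]
  proof (rule Bochner_Integration.integral_norm_bound_integral[OF pint_integrable[OF w(1) W(1) \<omega>]])
    show "integrable (leb t) (\<lambda>s. C * exp (norm z) * exp (norm (Y s \<omega>)))"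
      using leb_continuous(1)[OF exp_Y_cont[OF \<omega>]] by simp
    fix s assume "s \<in> space (leb t)"
    then have s: "s \<in> {0..t}" by simp
    have "norm (w s * W (Y s \<omega> + \<phi> s *\<^sub>R z)) \<le> 1 * (C * exp (norm (Y s \<omega> + \<phi> s *\<^sub>R z)))"
      unfolding real_norm_def abs_mult by (intro mult_mono w(2)[OF s] W(2)) auto
    also have "\<dots> \<le> C * (exp (norm z) * exp (norm (Y s \<omega>)))"
      using mult_left_mono[OF exp_norm_shift[OF s] C] by simp
    finally show "norm (w s * W (Y s \<omega> + \<phi> s *\<^sub>R z)) \<le> C * exp (norm z) * exp (norm (Y s \<omega>))"
      by (simp add: mult.assoc)
  qed
  then show ?thesis by (simp add: J_def)
qed

text \<open>Each differentiation in \<open>z\<close> produces a factor \<open>\<phi>\<close> in the weight.\<close>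

lemma pint_has_derivative:
  assumes w: "continuous_on UNIV w" "\<And>s. s \<in> {0..t} \<Longrightarrow> \<bar>w s\<bar> \<le> 1"
    and W: "W \<in> D_class (Suc 0)" and \<omega>: "\<omega> \<in> space M"
  shows "((\<lambda>z. pint w W z \<omega>) has_derivative (\<lambda>v. (\<chi> i. pint (\<lambda>s. w s * \<phi> s) (partial_deriv i W) z0 \<omega>) \<bullet> v)) (at z0)"
proof -
  have diff: "\<And>x. W differentiable (at x)" and dc: "\<And>i. continuous_on UNIV (partial_deriv i W)"
    and dg: "\<And>i. poly_growth (partial_deriv i W)"
    using W by auto
  have Wc: "continuous_on UNIV W" using D_class_SucD[OF W] by simp
  have "\<exists>C. \<forall>i. 0 \<le> C i \<and> (\<forall>x. \<bar>partial_deriv i W x\<bar> \<le> C i * exp (norm x))"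
    using poly_growth_exp_bound[OF dg] by (intro choice) metis
  then obtain C where C: "\<And>i. 0 \<le> C i" "\<And>i x. \<bar>partial_deriv i W x\<bar> \<le> C i * exp (norm x)" by blast
  have grad_bound: "norm (grad W y) \<le> (\<Sum>i\<in>UNIV. C i) * exp (norm y)" for y
  proof -
    have "norm (grad W y) \<le> (\<Sum>i\<in>UNIV. \<bar>grad W y $ i\<bar>)" by (rule norm_le_l1_cart)
    also have "\<dots> \<le> (\<Sum>i\<in>UNIV. C i * exp (norm y))" by (intro sum_mono) (simp add: grad_def C)
    finally show ?thesis by (simp add: sum_distrib_right)
  qed
  have grad_cont: "continuous_on UNIV (grad W)"
    unfolding grad_def by (intro continuous_on_vec_lambda dc)
  let ?G = "\<lambda>z s. (w s * \<phi> s) *\<^sub>R grad W (Y s \<omega> + \<phi> s *\<^sub>R z)"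
  have cs: "continuous_on {0..t} w" "continuous_on {0..t} \<phi>"
    using w(1) \<phi>_cont by (auto intro: continuous_on_subset)
  have G_cont: "continuous_on {0..t} (?G z)" for z
    using cs Y_cont[OF \<omega>]
    by (intro continuous_intros continuous_on_compose2[OF grad_cont]) auto
  have G_meas: "?G z0 \<in> borel_measurable (leb t)"
    using leb_continuous(1)[OF G_cont] by (rule borel_measurable_integrable)
  let ?D = "\<lambda>s. (\<Sum>i\<in>UNIV. C i) * exp (norm z0 + 1) * exp (norm (Y s \<omega>))"
  have D: "integrable (leb t) ?D"
    using leb_continuous(1)[OF exp_Y_cont[OF \<omega>]] by simp
  have main: "((\<lambda>z. \<integral>s. w s * W (Y s \<omega> + \<phi> s *\<^sub>R z) \<partial>leb t) has_derivative (\<lambda>v. (\<integral>s. ?G z0 s \<partial>leb t) \<bullet> v)) (at z0)"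
  proof (rule has_derivative_integral_dominated(2)[where r=1 and D="?D" and G="?G" and f="\<lambda>z s. w s * W (Y s \<omega> + \<phi> s *\<^sub>R z)", OF zero_less_one _ _ G_meas _ D])
    fix z s assume z: "z \<in> ball z0 1"
    show "integrable (leb t) (\<lambda>s. w s * W (Y s \<omega> + \<phi> s *\<^sub>R z))"
      by (rule pint_integrable[OF w(1) Wc \<omega>])
    assume s: "s \<in> space (leb t)"
    have "((\<lambda>z. W (Y s \<omega> + \<phi> s *\<^sub>R z)) has_derivative (\<lambda>v. grad W (Y s \<omega> + \<phi> s *\<^sub>R z) \<bullet> (\<phi> s *\<^sub>R v))) (at z)"
      by (rule has_derivative_compose[OF _ has_derivative_grad[OF diff]]) (auto intro!: derivative_eq_intros)
    then show "((\<lambda>z. w s * W (Y s \<omega> + \<phi> s *\<^sub>R z)) has_derivative (\<lambda>v. ?G z s \<bullet> v)) (at z)"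
      using has_derivative_mult_right[of "\<lambda>z. W (Y s \<omega> + \<phi> s *\<^sub>R z)" _ "at z" "w s"] by (simp add: mult.assoc)
    have "\<bar>w s\<bar> * \<bar>\<phi> s\<bar> \<le> 1 * 1" using s w(2)[of s] \<phi>_le[of s] by (intro mult_mono) auto
    then have "norm (?G z s) \<le> 1 * norm (grad W (Y s \<omega> + \<phi> s *\<^sub>R z))"
      by (simp only: norm_scaleR abs_mult) (rule mult_right_mono, auto)
    also have "\<dots> \<le> (\<Sum>i\<in>UNIV. C i) * exp (norm (Y s \<omega> + \<phi> s *\<^sub>R z))" using grad_bound by simp
    also have "\<dots> \<le> (\<Sum>i\<in>UNIV. C i) * (exp (norm z) * exp (norm (Y s \<omega>)))"
      using s C(1) by (intro mult_left_mono exp_norm_shift sum_nonneg) auto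
    also have "\<dots> \<le> (\<Sum>i\<in>UNIV. C i) * (exp (norm z0 + 1) * exp (norm (Y s \<omega>)))"
    proof (intro mult_left_mono mult_right_mono sum_nonneg C(1))
      have "norm z \<le> norm z0 + 1" using z norm_triangle_ineq2[of z z0] by (simp add: dist_norm norm_minus_commute)
      then show "exp (norm z) \<le> exp (norm z0 + 1)" by simp
    qed auto
    finally show "norm (?G z s) \<le> ?D s" by (simp add: mult.assoc)
  qed
  moreover have "(\<integral>s. ?G z0 s \<partial>leb t) = (\<chi> i. pint (\<lambda>s. w s * \<phi> s) (partial_deriv i W) z0 \<omega>)"
  proof (rule vec_eq_iff[THEN iffD2], rule allI)
    fix i
    have "(\<integral>s. ?G z0 s \<partial>leb t) $ i = (\<integral>s. ?G z0 s $ i \<partial>leb t)"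
      by (rule integral_bounded_linear[OF bounded_linear_vec_nth leb_continuous(1)[OF G_cont], symmetric])
    then show "(\<integral>s. ?G z0 s \<partial>leb t) $ i = (\<chi> i. pint (\<lambda>s. w s * \<phi> s) (partial_deriv i W) z0 \<omega>) $ i"
      by (simp add: pint_def grad_def)
  qed
  ultimately show ?thesis unfolding pint_def by simp
qed

end

lemma borel_measurable_vec_lambda:
  fixes f :: "'n::finite \<Rightarrow> 'a \<Rightarrow> real"
  assumes "\<And>i. f i \<in> borel_measurable M"
  shows "(\<lambda>\<omega>. \<chi> i. f i \<omega>) \<in> borel_measurable M"
  by (subst borel_measurable_euclidean_space) (use assms in \<open>auto simp: Basis_vec_def inner_axis\<close>)

lemma integral_vec_nth:
  fixes f :: "'a \<Rightarrow> 'b::euclidean_space^'n"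
  shows "integrable M f \<Longrightarrow> (\<integral>\<omega>. f \<omega> \<partial>M) $ i = (\<integral>\<omega>. f \<omega> $ i \<partial>M)"
  by (rule integral_bounded_linear[OF bounded_linear_vec_nth, symmetric])

context path_functional
begin

text \<open>The exponent, as a function of the displacement \<open>z\<close>, its gradient \<open>DL\<close>, and the \<open>j\<close>-th row \<open>D2L j\<close> of
  derivatives of the \<open>j\<close>-th component of the gradient; \<open>E\<close> is the payoff weighted with the exponential.\<close>

definition L :: "real^'n \<Rightarrow> 'a \<Rightarrow> real" where
  "L z \<omega> = - pint (\<lambda>_. 1) V z \<omega> + \<kappa> * (z \<bullet> N0 \<omega>) - c2 * (norm z)\<^sup>2 / 2"

definition DL :: "real^'n \<Rightarrow> 'a \<Rightarrow> real^'n" where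
  "DL z \<omega> = (\<chi> j. - pint \<phi> (partial_deriv j V) z \<omega> + \<kappa> * N0 \<omega> $ j - c2 * z $ j)"

text \<open>The entries of the Hessian of the potential.\<close>

abbreviation HV :: "'n \<Rightarrow> 'n \<Rightarrow> real^'n \<Rightarrow> real" where
  "HV i j \<equiv> partial_deriv i (partial_deriv j V)"

definition D2L :: "'n \<Rightarrow> real^'n \<Rightarrow> 'a \<Rightarrow> real^'n" where
  "D2L j z \<omega> = (\<chi> i. - pint (\<lambda>s. \<phi> s * \<phi> s) (HV i j) z \<omega> - c2 * (if i = j then 1 else 0))"

definition E :: "real^'n \<Rightarrow> 'a \<Rightarrow> real" where
  "E z \<omega> = G \<omega> * exp (L z \<omega>)"

lemma V1: "partial_deriv j V \<in> D_class (Suc 0)" and V0: "V \<in> D_class (Suc 0)"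
  and V2: "HV i j \<in> D_class 0"
proof -
  show *: "partial_deriv j V \<in> D_class (Suc 0)" for j by (rule D_class_partial_deriv[OF V])
  show "V \<in> D_class (Suc 0)" by (rule D_class_SucD[OF V])
  show "HV i j \<in> D_class 0" by (rule D_class_partial_deriv[OF *])
qed

lemma D_class_cont: "W \<in> D_class k \<Longrightarrow> continuous_on UNIV W" for W :: "real^'n \<Rightarrow> real"
  by (induction k) (auto dest!: D_class_SucD simp del: D_class.simps(2))

lemma V_conts: "continuous_on UNIV V" "continuous_on UNIV (partial_deriv j V)"
  "continuous_on UNIV (HV i j)"
  by (rule D_class_cont[OF V] D_class_cont[OF V1] D_class_cont[OF V2])+

lemma \<phi>2_cont: "continuous_on UNIV (\<lambda>s. \<phi> s * \<phi> s)"
  using \<phi>_cont by (intro continuous_intros)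

lemma \<phi>2_le: "s \<in> {0..t} \<Longrightarrow> \<bar>\<phi> s * \<phi> s\<bar> \<le> 1"
  using \<phi>_le[of s] mult_mono[of "\<bar>\<phi> s\<bar>" 1 "\<bar>\<phi> s\<bar>" 1] by (simp add: abs_mult)

lemma L_meas[measurable]: "L z \<in> borel_measurable M"
  and DL_meas[measurable]: "DL z \<in> borel_measurable M"
  and D2L_meas[measurable]: "D2L j z \<in> borel_measurable M"
proof -
  have [measurable]: "pint (\<lambda>_. 1) V z \<in> borel_measurable M"
    "pint \<phi> (partial_deriv k V) z \<in> borel_measurable M"
    "pint (\<lambda>s. \<phi> s * \<phi> s) (HV i k) z \<in> borel_measurable M" for i k
    by (intro pint_meas V_conts \<phi>_cont \<phi>2_cont continuous_on_const)+
  have [measurable]: "(\<lambda>\<omega>. N0 \<omega> $ k) \<in> borel_measurable M" for k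
    by (rule measurable_compose[OF N0_meas]) (intro borel_measurable_continuous_onI continuous_intros)
  show "L z \<in> borel_measurable M" unfolding L_def by measurable
  show "DL z \<in> borel_measurable M" unfolding DL_def by (rule borel_measurable_vec_lambda) measurable
  show "D2L j z \<in> borel_measurable M" unfolding D2L_def by (rule borel_measurable_vec_lambda) measurable
qed

lemma E_meas[measurable]: "E z \<in> borel_measurable M"
  unfolding E_def by measurable

lemma L_has_derivative:
  assumes \<omega>: "\<omega> \<in> space M"
  shows "((\<lambda>z. L z \<omega>) has_derivative (\<lambda>v. DL z \<omega> \<bullet> v)) (at z)"
proof -
  have 1: "((\<lambda>z. pint (\<lambda>_. 1) V z \<omega>) has_derivative (\<lambda>v. (\<chi> i. pint (\<lambda>s. 1 * \<phi> s) (partial_deriv i V) z \<omega>) \<bullet> v)) (at z)"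
    by (rule pint_has_derivative[OF continuous_on_const _ V0 \<omega>]) simp
  have "((\<lambda>z. - pint (\<lambda>_. 1) V z \<omega> + \<kappa> * (z \<bullet> N0 \<omega>) - (c2 / 2) * (z \<bullet> z)) has_derivative
     (\<lambda>v. - ((\<chi> i. pint (\<lambda>s. 1 * \<phi> s) (partial_deriv i V) z \<omega>) \<bullet> v) + \<kappa> * (v \<bullet> N0 \<omega>) - (c2 / 2) * (z \<bullet> v + v \<bullet> z))) (at z)"
    by (intro has_derivative_add has_derivative_diff has_derivative_minus 1 has_derivative_mult_right
        has_derivative_inner_left has_derivative_inner has_derivative_ident)
  moreover have "- ((\<chi> i. pint (\<lambda>s. 1 * \<phi> s) (partial_deriv i V) z \<omega>) \<bullet> v) + \<kappa> * (v \<bullet> N0 \<omega>) - (c2 / 2) * (z \<bullet> v + v \<bullet> z) = DL z \<omega> \<bullet> v" for v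
    by (simp add: DL_def inner_vec_def algebra_simps sum_distrib_left sum.distrib sum_subtractf sum_negf)
  ultimately show ?thesis by (simp add: L_def[abs_def] power2_norm_eq_inner)
qed

lemma DL_has_derivative:
  assumes \<omega>: "\<omega> \<in> space M"
  shows "((\<lambda>z. DL z \<omega> $ j) has_derivative (\<lambda>v. D2L j z \<omega> \<bullet> v)) (at z)"
proof -
  have 1: "((\<lambda>z. pint \<phi> (partial_deriv j V) z \<omega>) has_derivative (\<lambda>v. (\<chi> i. pint (\<lambda>s. \<phi> s * \<phi> s) (HV i j) z \<omega>) \<bullet> v)) (at z)"
    by (rule pint_has_derivative[OF \<phi>_cont \<phi>_le V1 \<omega>])
  have "((\<lambda>z. - pint \<phi> (partial_deriv j V) z \<omega> + \<kappa> * N0 \<omega> $ j - c2 * z $ j) has_derivative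
     (\<lambda>v. - ((\<chi> i. pint (\<lambda>s. \<phi> s * \<phi> s) (HV i j) z \<omega>) \<bullet> v) + 0 - c2 * v $ j)) (at z)"
    by (intro has_derivative_add has_derivative_diff has_derivative_minus 1 has_derivative_mult_right
        has_derivative_const bounded_linear.has_derivative[OF bounded_linear_vec_nth] has_derivative_ident)
  moreover have "- ((\<chi> i. pint (\<lambda>s. \<phi> s * \<phi> s) (HV i j) z \<omega>) \<bullet> v) + 0 - c2 * v $ j = D2L j z \<omega> \<bullet> v" for v
  proof -
    have "(\<Sum>i\<in>UNIV. c2 * (if i = j then 1 else 0) * v $ i) = c2 * v $ j"
      by (simp add: if_distrib[of "\<lambda>x. c2 * x * _"] cong: if_cong)
    then show ?thesis
      by (simp add: D2L_def inner_vec_def left_diff_distrib sum_subtractf sum_negf)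
  qed
  ultimately show ?thesis by (simp add: DL_def)
qed

lemma E_has_derivative:
  assumes \<omega>: "\<omega> \<in> space M"
  shows "((\<lambda>z. E z \<omega>) has_derivative (\<lambda>v. (E z \<omega> *\<^sub>R DL z \<omega>) \<bullet> v)) (at z)"
proof -
  have "((\<lambda>z. G \<omega> * exp (L z \<omega>)) has_derivative (\<lambda>v. G \<omega> * ((DL z \<omega> \<bullet> v) * exp (L z \<omega>)))) (at z)"
    by (intro has_derivative_mult_right has_derivative_exp L_has_derivative \<omega>)
  then show ?thesis by (simp add: E_def mult_ac)
qed

lemma EDL_has_derivative:
  assumes \<omega>: "\<omega> \<in> space M"
  shows "((\<lambda>z. E z \<omega> * DL z \<omega> $ j) has_derivative
    (\<lambda>v. (E z \<omega> *\<^sub>R (DL z \<omega> $ j *\<^sub>R DL z \<omega> + D2L j z \<omega>)) \<bullet> v)) (at z)"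
proof -
  have "((\<lambda>z. E z \<omega> * DL z \<omega> $ j) has_derivative
    (\<lambda>v. E z \<omega> * (D2L j z \<omega> \<bullet> v) + ((E z \<omega> *\<^sub>R DL z \<omega>) \<bullet> v) * DL z \<omega> $ j)) (at z)"
    by (intro has_derivative_mult E_has_derivative DL_has_derivative \<omega>)
  then show ?thesis by (simp add: inner_add_left algebra_simps)
qed

text \<open>Displacements up to norm 2 are allowed since derivatives are taken at displacements of norm less than
  1 and domination is needed on unit balls around these.\<close>

lemma ex_dominating:
  obtains S where "all_moments M S" "\<And>\<omega>. 0 \<le> S \<omega>"
    "\<And>z \<omega> j. norm z \<le> 2 \<Longrightarrow> \<omega> \<in> space M \<Longrightarrow> \<bar>DL z \<omega> $ j\<bar> \<le> S \<omega>"
    "\<And>z \<omega> i j. norm z \<le> 2 \<Longrightarrow> \<omega> \<in> space M \<Longrightarrow> \<bar>D2L j z \<omega> $ i\<bar> \<le> S \<omega>"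
proof -
  have pg: "poly_growth (partial_deriv j V)" "poly_growth (HV i j)" for i j
    using V1[of j] V2[of i j] by auto
  have "\<exists>C. \<forall>j. 0 \<le> C j \<and> (\<forall>x. \<bar>partial_deriv j V x\<bar> \<le> C j * exp (norm x))"
    using poly_growth_exp_bound[OF pg(1)] by (intro choice) metis
  then obtain C where C: "\<And>j. 0 \<le> C j" "\<And>j x. \<bar>partial_deriv j V x\<bar> \<le> C j * exp (norm x)" by blast
  have "\<exists>C. \<forall>p. 0 \<le> C p \<and> (\<forall>x. \<bar>HV (fst p) (snd p) x\<bar> \<le> C p * exp (norm x))"
    using poly_growth_exp_bound[OF pg(2)] by (intro choice) metis
  then obtain C' where C': "\<And>p. 0 \<le> C' p" "\<And>p x. \<bar>HV (fst p) (snd p) x\<bar> \<le> C' p * exp (norm x)" by blast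
  define K where "K = (\<Sum>j\<in>UNIV. C j) + (\<Sum>p\<in>UNIV. C' p)"
  have K: "C j \<le> K" "C' (i, j) \<le> K" "0 \<le> K" for i j
  proof -
    have "C j \<le> (\<Sum>j\<in>UNIV. C j)" "C' (i, j) \<le> (\<Sum>p\<in>UNIV. C' p)"
      using C(1) C'(1) by (auto intro!: member_le_sum)
    moreover have "0 \<le> (\<Sum>j\<in>UNIV. C j)" "0 \<le> (\<Sum>p\<in>UNIV. C' p)" using C(1) C'(1) by (auto intro!: sum_nonneg)
    ultimately show "C j \<le> K" "C' (i, j) \<le> K" "0 \<le> K" by (simp_all add: K_def)
  qed
  define S where "S \<omega> = K * exp 2 * J \<omega> + \<kappa> * norm (N0 \<omega>) + 2 * c2" for \<omega>
  have KJ: "c * exp (norm z) * J \<omega> \<le> K * exp 2 * J \<omega>" if "norm z \<le> 2" "c \<le> K" "0 \<le> c" for c z \<omega>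
    using that K by (intro mult_right_mono mult_mono J_nonneg) auto
  show thesis
  proof
    show "all_moments M S" unfolding S_def
      by (intro all_moments_add all_moments_mult all_moments_const all_moments_J all_moments_N0)
    show "0 \<le> S \<omega>" for \<omega> unfolding S_def
      using K \<kappa> c2 by (intro add_nonneg_nonneg mult_nonneg_nonneg J_nonneg) auto
    fix z :: "real^'n" and \<omega> i j assume z: "norm z \<le> 2" and \<omega>: "\<omega> \<in> space M"
    have "\<bar>pint \<phi> (partial_deriv j V) z \<omega>\<bar> \<le> K * exp 2 * J \<omega>"
      using pint_bound[OF \<phi>_cont \<phi>_le V_conts(2) C(2)\<omega>, where z=z] KJ[OF z K(1) C(1)] by (rule order_trans)
    moreover have "\<bar>\<kappa> * N0 \<omega> $ j\<bar> \<le> \<kappa> * norm (N0 \<omega>)"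
      using \<kappa> component_le_norm_cart[of "N0 \<omega>" j] by (simp add: abs_mult mult_left_mono)
    moreover have "\<bar>c2 * z $ j\<bar> \<le> 2 * c2"
      using c2 order_trans[OF component_le_norm_cart z, of j] by (simp add: abs_mult mult_left_mono mult.commute)
    ultimately show "\<bar>DL z \<omega> $ j\<bar> \<le> S \<omega>" by (simp add: DL_def S_def)
    have "\<bar>pint (\<lambda>s. \<phi> s * \<phi> s) (HV i j) z \<omega>\<bar> \<le> K * exp 2 * J \<omega>"
      using pint_bound[OF \<phi>2_cont \<phi>2_le V_conts(3) C'(2)[of "(i,j)", simplified]\<omega>, where z=z] KJ[OF z K(2) C'(1)] by (rule order_trans)
    moreover have "\<bar>c2 * (if i = j then 1 else 0)\<bar> \<le> 2 * c2" using c2 by simp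
    moreover have "0 \<le> \<kappa> * norm (N0 \<omega>)" using \<kappa> by simp
    ultimately show "\<bar>D2L j z \<omega> $ i\<bar> \<le> S \<omega>" by (simp add: D2L_def S_def)
  qed
qed

text \<open>A bound for the exponential of \<open>L z\<close>, valid when \<open>z\<close> has norm at most 2; it uses that the potential is
  bounded below by \<open>-C0\<close>.\<close>

definition majorant :: "'a \<Rightarrow> real" where
  "majorant \<omega> = exp (C0 * t + 2 * \<kappa> * norm (N0 \<omega>))"

lemma all_moments_majorant: "all_moments M majorant"
  unfolding majorant_def exp_add by (intro all_moments_mult all_moments_const all_moments_exp_N0)

lemma exp_L_le:
  assumes z: "norm z \<le> 2" and \<omega>: "\<omega> \<in> space M"
  shows "exp (L z \<omega>) \<le> majorant \<omega>"
proof -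
  have "(\<integral>s. - C0 \<partial>leb t) \<le> pint (\<lambda>_. 1) V z \<omega>"
    unfolding pint_def
    by (rule integral_mono[OF _ pint_integrable[OF continuous_on_const V_conts(1) \<omega>]]) (use V_lb in auto)
  then have "- pint (\<lambda>_. 1) V z \<omega> \<le> C0 * t" using t by (simp add: measure_leb mult.commute)
  moreover have "\<kappa> * (z \<bullet> N0 \<omega>) \<le> \<kappa> * (2 * norm (N0 \<omega>))"
    using \<kappa> norm_cauchy_schwarz[of z "N0 \<omega>"] mult_right_mono[OF z, of "norm (N0 \<omega>)"] by (intro mult_left_mono) auto
  moreover have "0 \<le> c2 * (norm z)\<^sup>2 / 2" using c2 by simp
  ultimately show ?thesis unfolding L_def majorant_def by simp
qed

lemma integrable_E_mult:
  assumes z: "norm z \<le> 2" and R: "all_moments M R" and f: "f \<in> borel_measurable M"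
    and le: "\<And>\<omega>. \<omega> \<in> space M \<Longrightarrow> \<bar>f \<omega>\<bar> \<le> R \<omega>"
  shows "integrable M (\<lambda>\<omega>. E z \<omega> * f \<omega>)"
proof -
  note [measurable] = f
  have "all_moments M (\<lambda>\<omega>. majorant \<omega> * R \<omega>)" by (intro all_moments_mult all_moments_majorant R)
  then have "all_moments M (\<lambda>\<omega>. exp (L z \<omega>) * f \<omega>)"
  proof (rule all_moments_bound)
    fix \<omega> assume \<omega>: "\<omega> \<in> space M"
    have "\<bar>exp (L z \<omega>) * f \<omega>\<bar> \<le> majorant \<omega> * R \<omega>"
      unfolding abs_mult using exp_L_le[OF z \<omega>] le[OF \<omega>] by (intro mult_mono) (auto simp: majorant_def)
    then show "\<bar>exp (L z \<omega>) * f \<omega>\<bar> \<le> \<bar>majorant \<omega> * R \<omega>\<bar>" by linarith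
  qed measurable
  from integrable_L2_all_moments[OF G_meas G2 this] show ?thesis by (simp add: E_def mult.assoc)
qed

lemma integrable_E: "norm z \<le> 2 \<Longrightarrow> integrable M (E z)"
  using integrable_E_mult[of z "\<lambda>_. 1" "\<lambda>_. 1"] all_moments_const[of 1] by simp

lemma nth_meas: "f \<in> borel_measurable M \<Longrightarrow> (\<lambda>\<omega>. f \<omega> $ j) \<in> borel_measurable M" for f :: "'a \<Rightarrow> real^'n"
  by (rule measurable_compose) (auto intro!: borel_measurable_continuous_onI continuous_intros)

lemma integrable_E_DL: "norm z \<le> 2 \<Longrightarrow> integrable M (\<lambda>\<omega>. E z \<omega> * DL z \<omega> $ j)"
  and integrable_E_DL2: "norm z \<le> 2 \<Longrightarrow> integrable M (\<lambda>\<omega>. E z \<omega> * (DL z \<omega> $ i * DL z \<omega> $ j))"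
  and integrable_E_D2L: "norm z \<le> 2 \<Longrightarrow> integrable M (\<lambda>\<omega>. E z \<omega> * D2L j z \<omega> $ i)"
proof -
  obtain S where S: "all_moments M S" "\<And>\<omega>. 0 \<le> S \<omega>"
    "\<And>z \<omega> j. norm z \<le> 2 \<Longrightarrow> \<omega> \<in> space M \<Longrightarrow> \<bar>DL z \<omega> $ j\<bar> \<le> S \<omega>"
    "\<And>z \<omega> i j. norm z \<le> 2 \<Longrightarrow> \<omega> \<in> space M \<Longrightarrow> \<bar>D2L j z \<omega> $ i\<bar> \<le> S \<omega>"
    using ex_dominating by blast
  have m: "(\<lambda>\<omega>. DL z \<omega> $ j) \<in> borel_measurable M" "(\<lambda>\<omega>. D2L j z \<omega> $ i) \<in> borel_measurable M" for i j
    by (intro nth_meas DL_meas D2L_meas)+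
  assume z: "norm z \<le> 2"
  show "integrable M (\<lambda>\<omega>. E z \<omega> * DL z \<omega> $ j)"
    by (rule integrable_E_mult[OF z S(1) m(1) S(3)[OF z]])
  show "integrable M (\<lambda>\<omega>. E z \<omega> * D2L j z \<omega> $ i)"
    by (rule integrable_E_mult[OF z S(1) m(2) S(4)[OF z]])
  show "integrable M (\<lambda>\<omega>. E z \<omega> * (DL z \<omega> $ i * DL z \<omega> $ j))"
    by (rule integrable_E_mult[OF z all_moments_mult[OF S(1) S(1)]])
       (auto simp: abs_mult intro!: borel_measurable_times m mult_mono S z)
qed

text \<open>The first two derivatives of the expectation of \<open>E z\<close> with respect to \<open>z\<close>.\<close>

lemma integral_E_has_derivative:
  assumes z: "norm z < 1"
  shows "((\<lambda>z. \<integral>\<omega>. E z \<omega> \<partial>M) has_derivative (\<lambda>v. (\<chi> j. \<integral>\<omega>. E z \<omega> * DL z \<omega> $ j \<partial>M) \<bullet> v)) (at z)"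
    and integral_EDL_has_derivative: "((\<lambda>z. \<integral>\<omega>. E z \<omega> * DL z \<omega> $ j \<partial>M) has_derivative
      (\<lambda>v. (\<chi> i. (\<integral>\<omega>. E z \<omega> * (DL z \<omega> $ i * DL z \<omega> $ j) \<partial>M) + (\<integral>\<omega>. E z \<omega> * D2L j z \<omega> $ i \<partial>M)) \<bullet> v)) (at z)"
proof -
  obtain S where S: "all_moments M S" "\<And>\<omega>. 0 \<le> S \<omega>"
    "\<And>z \<omega> j. norm z \<le> 2 \<Longrightarrow> \<omega> \<in> space M \<Longrightarrow> \<bar>DL z \<omega> $ j\<bar> \<le> S \<omega>"
    "\<And>z \<omega> i j. norm z \<le> 2 \<Longrightarrow> \<omega> \<in> space M \<Longrightarrow> \<bar>D2L j z \<omega> $ i\<bar> \<le> S \<omega>"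
    using ex_dominating by blast
  note [measurable] = all_momentsD(1)[OF S(1)]
  define n where "n = real CARD('n)"
  have l1: "norm u \<le> n * b" if "\<And>i. \<bar>u $ i\<bar> \<le> b" for u :: "real^'n" and b
    using norm_le_l1_cart[of u] sum_bounded_above[of UNIV "\<lambda>i. \<bar>u $ i\<bar>" b] that by (simp add: n_def)
  have ball: "norm y \<le> 2" if "y \<in> ball z 1" for y
    using that z norm_triangle_ineq2[of y z] by (simp add: dist_norm norm_minus_commute)
  have E_le: "\<bar>E y \<omega>\<bar> \<le> \<bar>G \<omega>\<bar> * majorant \<omega>" if "y \<in> ball z 1" "\<omega> \<in> space M" for y \<omega>
    unfolding E_def abs_mult using exp_L_le[OF ball[OF that(1)] that(2)] by (simp add: mult_left_mono)
  have dom: "integrable M (\<lambda>\<omega>. \<bar>G \<omega>\<bar> * majorant \<omega> * R \<omega>)" if "all_moments M R" for R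
    using integrable_L2_all_moments[of "\<lambda>\<omega>. \<bar>G \<omega>\<bar>" M "\<lambda>\<omega>. majorant \<omega> * R \<omega>"] all_moments_mult[OF all_moments_majorant that] G2
    by (simp add: mult.assoc)
  have DLn: "norm (DL y \<omega>) \<le> n * S \<omega>" if "y \<in> ball z 1" "\<omega> \<in> space M" for y \<omega>
    by (rule l1) (rule S(3)[OF ball[OF that(1)] that(2)])
  let ?G1 = "\<lambda>y \<omega>. E y \<omega> *\<^sub>R DL y \<omega>"
  have D1: "integrable M (\<lambda>\<omega>. \<bar>G \<omega>\<bar> * majorant \<omega> * (n * S \<omega>))"
    by (intro dom all_moments_mult all_moments_const S(1))
  have b1: "norm (?G1 y \<omega>) \<le> \<bar>G \<omega>\<bar> * majorant \<omega> * (n * S \<omega>)" if "y \<in> ball z 1" "\<omega> \<in> space M" for y \<omega>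
    unfolding norm_scaleR using E_le[OF that] DLn[OF that] by (intro mult_mono) (auto simp: majorant_def)
  note dui1 = has_derivative_integral_dominated[where f=E and G="?G1" and ?z0.0=z and M=M,
      OF zero_less_one E_has_derivative integrable_E[OF ball] _ b1 D1]
  have "integrable M (?G1 z)" by (rule dui1(1)) measurable
  then have "(\<integral>\<omega>. ?G1 z \<omega> \<partial>M) = (\<chi> j. \<integral>\<omega>. E z \<omega> * DL z \<omega> $ j \<partial>M)"
    by (simp add: vec_eq_iff integral_vec_nth)
  moreover have "((\<lambda>z. \<integral>\<omega>. E z \<omega> \<partial>M) has_derivative (\<lambda>v. (\<integral>\<omega>. ?G1 z \<omega> \<partial>M) \<bullet> v)) (at z)"
    by (rule dui1(2)) measurable
  ultimately show "((\<lambda>z. \<integral>\<omega>. E z \<omega> \<partial>M) has_derivative (\<lambda>v. (\<chi> j. \<integral>\<omega>. E z \<omega> * DL z \<omega> $ j \<partial>M) \<bullet> v)) (at z)"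
    by simp
  let ?G2 = "\<lambda>y \<omega>. E y \<omega> *\<^sub>R (DL y \<omega> $ j *\<^sub>R DL y \<omega> + D2L j y \<omega>)"
  have D2: "integrable M (\<lambda>\<omega>. \<bar>G \<omega>\<bar> * majorant \<omega> * (S \<omega> * (n * S \<omega>) + n * S \<omega>))"
    by (intro dom all_moments_mult all_moments_add all_moments_const S(1))
  have b2: "norm (?G2 y \<omega>) \<le> \<bar>G \<omega>\<bar> * majorant \<omega> * (S \<omega> * (n * S \<omega>) + n * S \<omega>)" if "y \<in> ball z 1" "\<omega> \<in> space M" for y \<omega>
  proof -
    have "norm (DL y \<omega> $ j *\<^sub>R DL y \<omega>) \<le> S \<omega> * (n * S \<omega>)"
      unfolding norm_scaleR by (intro mult_mono S(3)[OF ball[OF that(1)] that(2)] DLn that S(2)) auto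
    moreover have "norm (D2L j y \<omega>) \<le> n * S \<omega>" by (rule l1) (rule S(4)[OF ball[OF that(1)] that(2)])
    ultimately have "norm (DL y \<omega> $ j *\<^sub>R DL y \<omega> + D2L j y \<omega>) \<le> S \<omega> * (n * S \<omega>) + n * S \<omega>" by (rule norm_triangle_mono)
    then show ?thesis unfolding norm_scaleR[of "E y \<omega>"] using E_le[OF that] by (intro mult_mono) (auto simp: majorant_def)
  qed
  have [measurable]: "(\<lambda>\<omega>. DL z \<omega> $ j) \<in> borel_measurable M" by (intro nth_meas DL_meas)
  note dui2 = has_derivative_integral_dominated[where f="\<lambda>z \<omega>. E z \<omega> * DL z \<omega> $ j" and G="?G2" and ?z0.0=z and M=M,
      OF zero_less_one EDL_has_derivative integrable_E_DL[OF ball] _ b2 D2]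
  have "integrable M (?G2 z)" by (rule dui2(1)) measurable
  moreover have "(\<integral>\<omega>. E z \<omega> * (DL z \<omega> $ j * DL z \<omega> $ i + D2L j z \<omega> $ i) \<partial>M)
     = (\<integral>\<omega>. E z \<omega> * (DL z \<omega> $ i * DL z \<omega> $ j) \<partial>M) + (\<integral>\<omega>. E z \<omega> * D2L j z \<omega> $ i \<partial>M)" for i
    using integrable_E_DL2[of z i j] integrable_E_D2L[of z j i] z
    by (subst Bochner_Integration.integral_add[symmetric]) (auto simp: algebra_simps)
  ultimately have "(\<integral>\<omega>. ?G2 z \<omega> \<partial>M) = (\<chi> i. (\<integral>\<omega>. E z \<omega> * (DL z \<omega> $ i * DL z \<omega> $ j) \<partial>M) + (\<integral>\<omega>. E z \<omega> * D2L j z \<omega> $ i \<partial>M))"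
    by (simp add: vec_eq_iff integral_vec_nth)
  moreover have "((\<lambda>z. \<integral>\<omega>. E z \<omega> * DL z \<omega> $ j \<partial>M) has_derivative (\<lambda>v. (\<integral>\<omega>. ?G2 z \<omega> \<partial>M) \<bullet> v)) (at z)"
    by (rule dui2(2)) measurable
  ultimately show "((\<lambda>z. \<integral>\<omega>. E z \<omega> * DL z \<omega> $ j \<partial>M) has_derivative
      (\<lambda>v. (\<chi> i. (\<integral>\<omega>. E z \<omega> * (DL z \<omega> $ i * DL z \<omega> $ j) \<partial>M) + (\<integral>\<omega>. E z \<omega> * D2L j z \<omega> $ i \<partial>M)) \<bullet> v)) (at z)"
    by simp
qed

lemma integrable_E_Hess:
  assumes s: "s \<in> {0..t}"
  shows "integrable M (\<lambda>\<omega>. E 0 \<omega> * HV i j (Y s \<omega>))"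
proof -
  let ?W = "HV i j"
  have "poly_growth ?W" using V2[of i j] by simp
  then obtain C where C: "0 \<le> C" "\<And>x. \<bar>?W x\<bar> \<le> C * exp (norm x)" using poly_growth_exp_bound by metis
  have Ys: "Y s \<in> borel_measurable M"
  proof -
    have "(\<lambda>\<omega>. (\<omega>, s)) \<in> measurable M (M \<Otimes>\<^sub>M leb t)" using s by (intro measurable_Pair) auto
    from measurable_compose[OF this Y_pair] show ?thesis by simp
  qed
  have "all_moments M (\<lambda>\<omega>. exp (1 * norm (Y s \<omega>)))"
    unfolding all_moments_def
  proof (intro conjI allI)
    note [measurable] = Ys
    show "(\<lambda>\<omega>. exp (1 * norm (Y s \<omega>))) \<in> borel_measurable M" by measurable
    fix p
    obtain K where K: "K < \<infinity>" "(\<integral>\<^sup>+\<omega>. ennreal (exp (real p * norm (Y s \<omega>))) \<partial>M) \<le> K"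
      using Y_exp[of "real p"] s by auto
    then show "integrable M (\<lambda>\<omega>. \<bar>exp (1 * norm (Y s \<omega>))\<bar> ^ p)"
      by (intro integrableI_bounded) (auto simp: exp_of_nat_mult[symmetric] intro: le_less_trans)
  qed
  then have R: "all_moments M (\<lambda>\<omega>. C * exp (norm (Y s \<omega>)))"
    using all_moments_mult[OF all_moments_const[of C]] by simp
  have W: "?W \<in> borel_measurable borel" by (rule borel_measurable_continuous_onI[OF V_conts(3)])
  show ?thesis
    by (rule integrable_E_mult[OF _ R measurable_compose[OF Ys W] C(2)]) simp
qed

text \<open>The expectation of the second derivative of the potential term, as a time integral of
  expectations.\<close>

lemma fubini_E_Hess:
  fixes i j
  defines "H \<equiv> \<lambda>s. \<phi> s * \<phi> s * (\<integral>\<omega>. E 0 \<omega> * HV i j (Y s \<omega>) \<partial>M)"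
  shows "integrable (leb t) H"
    and "(\<integral>s. H s \<partial>leb t) = (\<integral>\<omega>. E 0 \<omega> * pint (\<lambda>s. \<phi> s * \<phi> s) (HV i j) 0 \<omega> \<partial>M)"
proof -
  let ?W = "HV i j"
  let ?f = "\<lambda>p. E 0 (fst p) * (\<phi> (snd p) * \<phi> (snd p) * ?W (Y (snd p) (fst p)))"
  have "poly_growth ?W" using V2[of i j] by simp
  then obtain C where C: "0 \<le> C" "\<And>x. \<bar>?W x\<bar> \<le> C * exp (norm x)" using poly_growth_exp_bound by metis
  have mW: "(\<lambda>p. \<phi> (snd p) * \<phi> (snd p) * ?W (Y (snd p) (fst p))) \<in> borel_measurable (M \<Otimes>\<^sub>M leb t)"
    using pint_pair_meas[OF \<phi>2_cont V_conts(3), where z=0] by simp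
  have f_meas: "?f \<in> borel_measurable (M \<Otimes>\<^sub>M leb t)"
    by (intro borel_measurable_times mW measurable_compose[OF measurable_fst E_meas])
  have absW: "continuous_on UNIV (\<lambda>x. \<bar>?W x\<bar>)" using V_conts(3) by (intro continuous_intros)
  have f_int: "integrable (M \<Otimes>\<^sub>M leb t) ?f"
  proof (rule pair.Fubini_integrable[OF f_meas])
    have 1: "(\<integral>s. norm (?f (\<omega>, s)) \<partial>leb t) = \<bar>E 0 \<omega>\<bar> * pint (\<lambda>s. \<phi> s * \<phi> s) (\<lambda>x. \<bar>?W x\<bar>) 0 \<omega>" for \<omega>
      by (simp add: pint_def abs_mult)
    have "integrable M (\<lambda>\<omega>. E 0 \<omega> * pint (\<lambda>s. \<phi> s * \<phi> s) (\<lambda>x. \<bar>?W x\<bar>) 0 \<omega>)"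
    proof (rule integrable_E_mult[where R="\<lambda>\<omega>. C * exp (norm (0::real^'n)) * J \<omega>"])
      show "all_moments M (\<lambda>\<omega>. C * exp (norm (0::real^'n)) * J \<omega>)"
        by (intro all_moments_mult all_moments_const all_moments_J)
      show "pint (\<lambda>s. \<phi> s * \<phi> s) (\<lambda>x. \<bar>?W x\<bar>) 0 \<in> borel_measurable M"
        by (rule pint_meas[OF \<phi>2_cont absW])
      show "\<bar>pint (\<lambda>s. \<phi> s * \<phi> s) (\<lambda>x. \<bar>?W x\<bar>) 0 \<omega>\<bar> \<le> C * exp (norm (0::real^'n)) * J \<omega>" if "\<omega> \<in> space M" for \<omega>
        by (rule pint_bound[OF \<phi>2_cont \<phi>2_le absW _ that]) (use C in simp_all)
    qed simp
    then have "integrable M (\<lambda>\<omega>. \<bar>E 0 \<omega> * pint (\<lambda>s. \<phi> s * \<phi> s) (\<lambda>x. \<bar>?W x\<bar>) 0 \<omega>\<bar>)" by (rule integrable_abs)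
    moreover have "0 \<le> pint (\<lambda>s. \<phi> s * \<phi> s) (\<lambda>x. \<bar>?W x\<bar>) 0 \<omega>" for \<omega>
      unfolding pint_def by (intro integral_nonneg_AE AE_I2) simp
    ultimately show "integrable M (\<lambda>\<omega>. \<integral>s. norm (?f (\<omega>, s)) \<partial>leb t)"
      unfolding 1 by (simp add: abs_mult)
    show "AE \<omega> in M. integrable (leb t) (\<lambda>s. ?f (\<omega>, s))"
      using pint_integrable[OF \<phi>2_cont V_conts(3), where z=0] by (intro AE_I2) simp
  qed
  have H: "H s = (\<integral>\<omega>. ?f (\<omega>, s) \<partial>M)" for s
    unfolding H_def by (subst integral_mult_right_zero[symmetric]) (simp add: mult_ac)
  show "integrable (leb t) H"
    unfolding H using pair.integrable_snd[of "\<lambda>\<omega> s. ?f (\<omega>, s)"] f_int by (simp add: split_beta')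
  have "(\<integral>s. H s \<partial>leb t) = (\<integral>\<omega>. \<integral>s. ?f (\<omega>, s) \<partial>leb t \<partial>M)"
    unfolding H using pair.Fubini_integral[of "\<lambda>\<omega> s. ?f (\<omega>, s)"] f_int by (simp add: split_beta')
  then show "(\<integral>s. H s \<partial>leb t) = (\<integral>\<omega>. E 0 \<omega> * pint (\<lambda>s. \<phi> s * \<phi> s) ?W 0 \<omega> \<partial>M)"
    by (simp add: pint_def)
qed

end

section \<open>Completions and vector-valued integrals\<close>

lemma completion_measurable_AE:
  fixes f :: "'a \<Rightarrow> 'b::topological_space"
  assumes g: "g \<in> borel_measurable M" and eq: "AE \<omega> in M. f \<omega> = g \<omega>"
  shows "f \<in> borel_measurable (completion M)"
proof -
  obtain N where N: "{\<omega> \<in> space M. f \<omega> \<noteq> g \<omega>} \<subseteq> N" "N \<in> null_sets M"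
    using eq by (auto simp: eventually_ae_filter)
  show ?thesis
  proof (rule measurableI)
    fix A :: "'b set" assume A: "A \<in> sets borel"
    have "f -` A \<inter> space (completion M) = (g -` A \<inter> space M - N) \<union> (f -` A \<inter> space M \<inter> N)"
      using N(1) by auto
    moreover have "g -` A \<inter> space M - N \<in> sets M" using measurable_sets[OF g A] N(2) by auto
    then have "g -` A \<inter> space M - N \<in> sets (completion M)" by (rule sets_completionI_sets)
    moreover have "f -` A \<inter> space M \<inter> N \<in> null_sets (completion M)"
      by (rule null_sets_completion_subset[OF _ null_sets_completionI[OF N(2)]]) auto
    ultimately show "f -` A \<inter> space (completion M) \<in> sets (completion M)"
      by (metis null_setsD2 sets.Un)
  qed auto
qed

lemma completion_integral_AE:
  fixes f :: "'a \<Rightarrow> real"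
  assumes g: "g \<in> borel_measurable M" and eq: "AE \<omega> in M. f \<omega> = g \<omega>"
  shows "integrable (completion M) f \<longleftrightarrow> integrable M g"
    and "(\<integral>\<omega>. f \<omega> \<partial>completion M) = (\<integral>\<omega>. g \<omega> \<partial>M)"
proof -
  have fm: "f \<in> borel_measurable (completion M)" by (rule completion_measurable_AE[OF g eq])
  have gm: "g \<in> borel_measurable (completion M)" using g by (rule measurable_completion)
  have eq': "AE \<omega> in completion M. f \<omega> = g \<omega>" using eq by (rule AE_completion)
  show "integrable (completion M) f \<longleftrightarrow> integrable M g"
    using integrable_cong_AE[OF fm gm eq'] integrable_completion[OF g] by simp
  show "(\<integral>\<omega>. f \<omega> \<partial>completion M) = (\<integral>\<omega>. g \<omega> \<partial>M)"
    using integral_cong_AE[OF fm gm eq'] integral_completion[OF g] by simp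
qed

lemma integrable_euclideanI:
  fixes f :: "'a \<Rightarrow> 'b::euclidean_space"
  assumes "\<And>b. b \<in> Basis \<Longrightarrow> integrable M (\<lambda>\<omega>. f \<omega> \<bullet> b)"
  shows "integrable M f"
proof -
  have "integrable M (\<lambda>\<omega>. \<Sum>b\<in>Basis. (f \<omega> \<bullet> b) *\<^sub>R b)"
    using assms by (intro Bochner_Integration.integrable_sum integrable_scaleR_left) auto
  then show ?thesis by (simp add: euclidean_representation)
qed

lemma integrable_vecI:
  fixes f :: "'a \<Rightarrow> real^'n"
  assumes "\<And>i. integrable M (\<lambda>\<omega>. f \<omega> $ i)"
  shows "integrable M f"
  by (rule integrable_euclideanI) (use assms in \<open>auto simp: Basis_vec_def inner_axis\<close>)

lemma integrable_matI:
  fixes f :: "'a \<Rightarrow> real^'n^'m"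
  assumes "\<And>i j. integrable M (\<lambda>\<omega>. f \<omega> $ i $ j)"
  shows "integrable M f"
  by (rule integrable_euclideanI) (use assms in \<open>auto simp: Basis_vec_def inner_axis\<close>)

lemma integral_mat_nth:
  fixes f :: "'a \<Rightarrow> real^'n^'m"
  assumes "integrable M f"
  shows "(\<integral>\<omega>. f \<omega> \<partial>M) $ i $ j = (\<integral>\<omega>. f \<omega> $ i $ j \<partial>M)"
  using integral_vec_nth[OF assms, of i] integral_vec_nth[OF integrable_bounded_linear[OF bounded_linear_vec_nth assms], of i j]
  by simp

lemma outer_product_nth: "(u \<otimes>\<^sub>o v) $ i $ j = u $ i * v $ j"
  by (simp add: outer_product_def matrix_matrix_mult_def columnvector_def rowvector_def)

section \<open>The Feynman-Kac semigroup\<close>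

text \<open>The data of the theorem, with \<open>-C0\<close> a lower bound of the potential and \<open>x\<close> the point at which the
  Hessian is computed.\<close>

locale ou_setting = ou_regular M F B X N
  for M :: "'a measure" and F B and X :: "real ^ 'n \<Rightarrow> real \<Rightarrow> 'a \<Rightarrow> real ^ 'n" and N +
  fixes h f :: "real ^ 'n \<Rightarrow> real" and t C0 :: real and x :: "real ^ 'n"
  assumes h: "h \<in> D_class 4"
    and V_lb: "\<And>y. - C0 \<le> V_of h y"
    and f_L2: "f \<in> L2_fun (mu_h h)"
    and f_nn: "AE y in mu_h h. 0 \<le> f y"
    and f_nz: "\<not> (AE y in mu_h h. f y = 0)"
    and t: "0 < t"
begin

text \<open>The payoff \<open>exp(W/2) f\<close>, made non-negative everywhere.  This modification on a null set does
  not affect expectations of \<open>g(X\<^sub>t\<^sup>y)\<close>, as \<open>X\<^sub>t\<^sup>y\<close> has a density.\<close>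

definition g :: "real^'n \<Rightarrow> real" where
  "g y = exp (W_of h y / 2) * max 0 (f y)"

text \<open>The profile of the perturbation and the constants of the Cameron-Martin weight.\<close>

definition \<phi> :: "real \<Rightarrow> real" where "\<phi> s = sinh (t - s) / sinh t"
definition \<kappa> :: real where "\<kappa> = exp (-t) / (1 - exp (-2 * t))"
definition c2 :: real where "c2 = exp (-2 * t) / (1 - exp (-2 * t))"

lemma h': "h \<in> D_class (Suc (Suc (Suc (Suc 0))))"
  using h by (simp add: eval_nat_numeral del: D_class.simps)

lemma h_diff: "h differentiable (at y)" and h_partial_diff: "partial_deriv i h differentiable (at y)"
proof -
  show "h differentiable (at y)" using h' by (simp del: D_class.simps add: D_class.simps(2)[of "Suc (Suc (Suc 0))"])
  have "partial_deriv i h \<in> D_class (Suc (Suc (Suc 0)))" by (rule D_class_partial_deriv[OF h'])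
  then show "partial_deriv i h differentiable (at y)" by (simp del: D_class.simps add: D_class.simps(2)[of "Suc (Suc 0)"])
qed

lemma h_cont: "continuous_on UNIV h"
  using h_diff by (intro continuous_at_imp_continuous_on ballI differentiable_imp_continuous_within)

lemma h_meas[measurable]: "h \<in> borel_measurable borel"
  by (rule borel_measurable_continuous_onI[OF h_cont])

lemma W_meas[measurable]: "W_of h \<in> borel_measurable borel"
  unfolding W_of_def by measurable

lemma f_meas[measurable]: "f \<in> borel_measurable borel"
  using f_L2 by (simp add: L2_fun_def mu_h_def)

lemma g_meas[measurable]: "g \<in> borel_measurable borel"
  unfolding g_def by measurable

lemma g_nonneg: "0 \<le> g y" by (simp add: g_def)

lemma AE_mu_h: "(AE y in mu_h h. P y) \<longleftrightarrow> (AE y in lborel. P y)"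
  unfolding mu_h_def by (subst AE_density) auto

lemma V_D_class: "V_of h \<in> D_class (Suc (Suc 0))"
  by (rule V_of_D_class[OF h'])

lemma V_cont: "continuous_on UNIV (V_of h)"
  using D_class_SucD[OF D_class_SucD[OF V_D_class]] by simp

text \<open>A version of \<open>X y\<close> with continuous paths.\<close>

abbreviation Y :: "real^'n \<Rightarrow> real \<Rightarrow> 'a \<Rightarrow> real^'n" where
  "Y y s \<omega> \<equiv> exp (-s) *\<^sub>R y + N s \<omega>"

lemma AE_X_N: "AE \<omega> in M. \<forall>s\<ge>0. X y s \<omega> = Y y s \<omega>"
  using AE_X_eq[of y] N_eq by eventually_elim simp

text \<open>The standard deviation of \<open>X\<^sub>t\<^sup>y\<close> in every direction.\<close>

definition \<sigma> :: real where "\<sigma> = sqrt (1 - exp (-2 * t))"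

lemma \<sigma>_pos: "\<sigma> > 0" using t by (simp add: \<sigma>_def)

text \<open>The Lebesgue density of \<open>X\<^sub>t\<^sup>y\<close>.\<close>

abbreviation dens :: "real^'n \<Rightarrow> real^'n \<Rightarrow> real" where
  "dens y w \<equiv> gauss_const TYPE('n) / \<sigma> ^ CARD('n) * exp (- (norm (w - exp (-t) *\<^sub>R y))\<^sup>2 / (2 * \<sigma>\<^sup>2))"

lemma nn_integral_OU_law:
  fixes \<psi> :: "real^'n \<Rightarrow> ennreal"
  assumes [measurable]: "\<psi> \<in> borel_measurable borel"
  shows "(\<integral>\<^sup>+\<omega>. \<psi> (Y y t \<omega>) \<partial>M)
    = (\<integral>\<^sup>+w. ennreal (dens y w) * \<psi> w \<partial>lborel)"
proof -
  have "(\<integral>\<^sup>+\<omega>. \<psi> (Y y t \<omega>) \<partial>M) = (\<integral>\<^sup>+\<omega>. \<psi> (exp (-t) *\<^sub>R y + X 0 t \<omega>) \<partial>M)"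
    using N_eq_s[of t] t by (intro nn_integral_cong_AE) (auto elim!: eventually_mono)
  also have "\<dots> = (\<integral>\<^sup>+w. \<psi> (exp (-t) *\<^sub>R y + w) \<partial>gauss (1 - exp (-2 * t)))"
    using t by (intro nn_integral_X0) measurable
  also have "\<dots> = (\<integral>\<^sup>+z. \<psi> (exp (-t) *\<^sub>R y + \<sigma> *\<^sub>R z) \<partial>std_gaussian)"
    by (subst nn_integral_gauss) (auto simp: \<sigma>_def)
  also have "\<dots> = (\<integral>\<^sup>+w. ennreal (dens y w) * \<psi> w \<partial>lborel)"
    by (rule nn_integral_std_gaussian_affine[OF _ \<sigma>_pos]) measurable
  finally show ?thesis .
qed

lemma OU_density_pos: "dens y w > 0"
  for w y :: "real^'n"
  using gauss_const_pos[where 'n='n] \<sigma>_pos by simp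

lemma AE_OU_law_iff:
  assumes [measurable]: "Measurable.pred borel P"
  shows "(AE \<omega> in M. P (Y y t \<omega>)) \<longleftrightarrow> (AE w in lborel. P w)"
proof -
  let ?I = "\<lambda>w. if P w then 0 else 1 :: ennreal"
  have I: "(\<lambda>w. ?I w) \<in> borel_measurable borel" by measurable
  have "(AE \<omega> in M. P (Y y t \<omega>)) \<longleftrightarrow> (\<integral>\<^sup>+\<omega>. ?I (Y y t \<omega>) \<partial>M) = 0"
    by (subst nn_integral_0_iff_AE) auto
  also have "\<dots> \<longleftrightarrow> (\<integral>\<^sup>+w. ennreal (dens y w) * ?I w \<partial>lborel) = 0"
    unfolding nn_integral_OU_law[OF I] ..
  also have "\<dots> \<longleftrightarrow> (AE w in lborel. ennreal (dens y w) * ?I w = 0)"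
    by (rule nn_integral_0_iff_AE) measurable
  also have "\<dots> \<longleftrightarrow> (AE w in lborel. P w)"
  proof (rule AE_cong)
    fix w show "(ennreal (dens y w) * ?I w = 0) = P w"
      using OU_density_pos[of w y] by (cases "P w") (auto simp: ennreal_eq_0_iff simp del: not_less)
  qed
  finally show ?thesis .
qed

lemma g_square_integrable: "integrable M (\<lambda>\<omega>. (g (Y y t \<omega>))\<^sup>2)"
proof (rule integrableI_bounded)
  define K where "K = gauss_const TYPE('n) / \<sigma> ^ CARD('n) * exp ((norm y)\<^sup>2 / 2)"
  have K: "0 \<le> K" unfolding K_def using gauss_const_pos[where 'n='n] \<sigma>_pos by simp
  have "(\<integral>\<^sup>+\<omega>. ennreal (norm ((g (Y y t \<omega>))\<^sup>2)) \<partial>M)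
    = (\<integral>\<^sup>+w. ennreal (dens y w) * ennreal (norm ((g w)\<^sup>2)) \<partial>lborel)"
    by (rule nn_integral_OU_law[of "\<lambda>w. ennreal (norm ((g w)\<^sup>2))"]) measurable
  also have "\<dots> \<le> (\<integral>\<^sup>+w. ennreal K * (ennreal (exp (- h w)) * ennreal ((f w)\<^sup>2)) \<partial>lborel)"
  proof (rule nn_integral_mono)
    fix w :: "real^'n"
    let ?q = "exp (-t)"
    have q: "\<sigma>\<^sup>2 = 1 - ?q\<^sup>2" using t by (simp add: \<sigma>_def exp_double[symmetric])
    (* completing the square; this uses that the variance is 1 - q^2 and the mean is q y, and it
       bounds the density of the law relative to the standard Gaussian measure *)
    have key: "- (norm (w - ?q *\<^sub>R y))\<^sup>2 / (2 * \<sigma>\<^sup>2) + (norm w)\<^sup>2 / 2 \<le> (norm y)\<^sup>2 / 2"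
    proof -
      have "(norm w)\<^sup>2 * \<sigma>\<^sup>2 - (norm (w - ?q *\<^sub>R y))\<^sup>2 = (norm y)\<^sup>2 * \<sigma>\<^sup>2 - (norm (?q *\<^sub>R w - y))\<^sup>2"
        unfolding q power2_norm_eq_inner by (simp add: inner_diff inner_commute algebra_simps power2_eq_square)
      also have "\<dots> \<le> (norm y)\<^sup>2 * \<sigma>\<^sup>2" by simp
      finally have "((norm w)\<^sup>2 * \<sigma>\<^sup>2 - (norm (w - ?q *\<^sub>R y))\<^sup>2) / (2 * \<sigma>\<^sup>2) \<le> ((norm y)\<^sup>2 * \<sigma>\<^sup>2) / (2 * \<sigma>\<^sup>2)"
        by (rule divide_right_mono) simp
      then show ?thesis using \<sigma>_pos by (simp add: diff_divide_distrib)
    qed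
    have "(g w)\<^sup>2 = exp (W_of h w) * (max 0 (f w))\<^sup>2"
      by (simp add: g_def power_mult_distrib exp_double[symmetric])
    also have "\<dots> \<le> exp (W_of h w) * (f w)\<^sup>2"
      by (intro mult_left_mono) (auto simp: max_def)
    also have "exp (W_of h w) = exp ((norm w)\<^sup>2 / 2) * exp (- h w)"
      by (simp add: W_of_def exp_add[symmetric])
    finally have g2: "(g w)\<^sup>2 \<le> exp ((norm w)\<^sup>2 / 2) * (exp (- h w) * (f w)\<^sup>2)"
      by (simp only: mult.assoc)
    have "dens y w * (g w)\<^sup>2
      \<le> dens y w * (exp ((norm w)\<^sup>2 / 2) * (exp (- h w) * (f w)\<^sup>2))"
      by (rule mult_left_mono[OF g2 less_imp_le[OF OU_density_pos]])
    also have "\<dots> = gauss_const TYPE('n) / \<sigma> ^ CARD('n) * exp (- (norm (w - ?q *\<^sub>R y))\<^sup>2 / (2 * \<sigma>\<^sup>2) + (norm w)\<^sup>2 / 2) * (exp (- h w) * (f w)\<^sup>2)"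
      by (simp only: exp_add mult.assoc)
    also have "\<dots> \<le> K * (exp (- h w) * (f w)\<^sup>2)"
      unfolding K_def using key gauss_const_pos[where 'n='n] \<sigma>_pos
      by (intro mult_right_mono mult_left_mono) auto
    finally show "ennreal (dens y w) * ennreal (norm ((g w)\<^sup>2))
       \<le> ennreal K * (ennreal (exp (- h w)) * ennreal ((f w)\<^sup>2))"
      using K OU_density_pos[of w y]
      by (simp add: ennreal_mult[symmetric] ennreal_leI)
  qed
  also have "\<dots> = ennreal K * (\<integral>\<^sup>+w. ennreal ((f w)\<^sup>2) \<partial>mu_h h)"
    unfolding mu_h_def by (simp add: nn_integral_cmult nn_integral_density)
  also have "\<dots> < \<infinity>"
    using f_L2 by (auto simp: L2_fun_def integrable_iff_bounded ennreal_mult_less_top)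
  finally show "(\<integral>\<^sup>+\<omega>. ennreal (norm ((g (Y y t \<omega>))\<^sup>2)) \<partial>M) < \<infinity>" .
qed measurable

text \<open>The displaced processes fit the abstract setting, for any starting point.\<close>

lemma path_functional_OU:
  "path_functional M (Y y) (\<lambda>\<omega>. g (Y y t \<omega>)) (N t) (V_of h) \<phi> \<kappa> c2 t C0"
proof unfold_locales
  have sinh_t: "sinh t > 0" using t by simp
  have [measurable]: "(\<lambda>p. N (snd p) (fst p)) \<in> borel_measurable (M \<Otimes>\<^sub>M leb t)" by (rule N_pair)
  have [measurable]: "snd \<in> borel_measurable (M \<Otimes>\<^sub>M leb t)"
    by (rule measurable_compose[OF measurable_snd ident_leb])
  show "(\<lambda>p. exp (- snd p) *\<^sub>R y + N (snd p) (fst p)) \<in> borel_measurable (M \<Otimes>\<^sub>M leb t)" by measurable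
  show "continuous_on {0..t} (\<lambda>s. Y y s \<omega>)" if "\<omega> \<in> space M" for \<omega>
    using continuous_on_subset[OF N_cont[OF that]] by (intro continuous_intros) auto
  have mom: "(\<integral>\<^sup>+\<omega>. ennreal (exp (c * norm (N s \<omega>))) \<partial>M) \<le> (\<integral>\<^sup>+z. ennreal (exp (\<bar>c\<bar> * norm z)) \<partial>(std_gaussian :: (real^'n) measure))" if "0 \<le> s" for c s
  proof -
    have "(\<integral>\<^sup>+\<omega>. ennreal (exp (c * norm (N s \<omega>))) \<partial>M) = (\<integral>\<^sup>+\<omega>. ennreal (exp (c * norm (X 0 s \<omega>))) \<partial>M)"
      by (intro nn_integral_cong_AE eventually_mono[OF N_eq_s[OF that]]) simp
    then show ?thesis using exp_moment_X0[OF that] by simp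
  qed
  show "(\<integral>\<^sup>+\<omega>. ennreal (exp (c * norm (N t \<omega>))) \<partial>M) < \<infinity>" for c
    using mom[of t c] nn_integral_exp_norm_std_gaussian[of "\<bar>c\<bar>"] t by (auto intro: le_less_trans)
  show "\<exists>K<\<infinity>. \<forall>s\<in>{0..t}. (\<integral>\<^sup>+\<omega>. ennreal (exp (c * norm (Y y s \<omega>))) \<partial>M) \<le> K" for c
  proof (intro exI conjI ballI)
    let ?K = "ennreal (exp (\<bar>c\<bar> * norm y)) * (\<integral>\<^sup>+z. ennreal (exp (\<bar>\<bar>c\<bar>\<bar> * norm z)) \<partial>(std_gaussian :: (real^'n) measure))"
    show "?K < \<infinity>" using nn_integral_exp_norm_std_gaussian[where 'n='n, of "\<bar>c\<bar>"] by (simp add: ennreal_mult_less_top)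
    fix s assume s: "s \<in> {0..t}"
    have "(\<integral>\<^sup>+\<omega>. ennreal (exp (c * norm (Y y s \<omega>))) \<partial>M) \<le> (\<integral>\<^sup>+\<omega>. ennreal (exp (\<bar>c\<bar> * norm y)) * ennreal (exp (\<bar>c\<bar> * norm (N s \<omega>))) \<partial>M)"
    proof (rule nn_integral_mono)
      fix \<omega>
      have "norm (exp (-s) *\<^sub>R y) \<le> 1 * norm y" unfolding norm_scaleR using s by (intro mult_right_mono) auto
      then have "norm (Y y s \<omega>) \<le> norm y + norm (N s \<omega>)"
        using norm_triangle_ineq[of "exp (-s) *\<^sub>R y" "N s \<omega>"] by simp
      then have "c * norm (Y y s \<omega>) \<le> \<bar>c\<bar> * (norm y + norm (N s \<omega>))"
        by (intro mult_mono) auto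
      then have "exp (c * norm (Y y s \<omega>)) \<le> exp (\<bar>c\<bar> * norm y) * exp (\<bar>c\<bar> * norm (N s \<omega>))"
        by (simp add: exp_add[symmetric] distrib_left)
      then show "ennreal (exp (c * norm (Y y s \<omega>))) \<le> ennreal (exp (\<bar>c\<bar> * norm y)) * ennreal (exp (\<bar>c\<bar> * norm (N s \<omega>)))"
        by (simp add: ennreal_mult[symmetric] ennreal_leI)
    qed
    also have "\<dots> = ennreal (exp (\<bar>c\<bar> * norm y)) * (\<integral>\<^sup>+\<omega>. ennreal (exp (\<bar>c\<bar> * norm (N s \<omega>))) \<partial>M)"
      by (rule nn_integral_cmult) measurable
    also have "\<dots> \<le> ?K" using mom[of s "\<bar>c\<bar>"] s by (intro mult_left_mono) auto
    finally show "(\<integral>\<^sup>+\<omega>. ennreal (exp (c * norm (Y y s \<omega>))) \<partial>M) \<le> ?K" .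
  qed
  show "continuous_on UNIV \<phi>" unfolding \<phi>_def[abs_def] using sinh_t by (intro continuous_intros) auto
  show "\<bar>\<phi> s\<bar> \<le> 1" if "s \<in> {0..t}" for s
    using that sinh_t by (simp add: \<phi>_def abs_divide)
  show "0 \<le> \<kappa>" "0 \<le> c2" using t by (simp_all add: \<kappa>_def c2_def)
qed (use t V_D_class V_lb g_square_integrable in \<open>auto simp del: D_class.simps\<close>)

sublocale P: path_functional M "Y x" "\<lambda>\<omega>. g (Y x t \<omega>)" "N t" "V_of h" \<phi> \<kappa> c2 t C0
  by (rule path_functional_OU)

text \<open>The payoff before its modification on a null set.\<close>

abbreviation "g0 \<equiv> \<lambda>y. exp (W_of h y / 2) * f y"

lemma AE_g: "AE \<omega> in M. g0 (Y y t \<omega>) = g (Y y t \<omega>)"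
  by (subst AE_OU_law_iff[where P="\<lambda>w. g0 w = g w"])
     (use f_nn in \<open>auto simp: AE_mu_h g_def elim!: eventually_mono\<close>)

lemma AE_FK_density:
  "AE \<omega> in M. FK_density X (V_of h) t g0 y \<omega> = g (Y y t \<omega>) * exp (- (\<integral>s. V_of h (Y y s \<omega>) \<partial>leb t))"
  using AE_X_N[of y] AE_g[of y] AE_space
proof eventually_elim
  case (elim \<omega>)
  have "continuous_on {0..t} (\<lambda>s. Y y s \<omega>)"
    using continuous_on_subset[OF N_cont[OF elim(3)]] by (intro continuous_intros) auto
  then have "continuous_on {0..t} (\<lambda>s. V_of h (Y y s \<omega>))"
    by (rule continuous_on_compose2[OF V_cont]) auto
  from leb_continuous(2)[OF this]
  have "integral {0..t} (\<lambda>s. V_of h (X y s \<omega>)) = (\<integral>s. V_of h (Y y s \<omega>) \<partial>leb t)"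
    using elim(1) by (subst integral_cong[where g="\<lambda>s. V_of h (Y y s \<omega>)"]) auto
  moreover have "g0 (X y t \<omega>) = g (Y y t \<omega>)" using elim t by simp
  ultimately show ?case unfolding FK_density_def by simp
qed

text \<open>The Feynman-Kac semigroup applied to the payoff.\<close>

abbreviation u :: "real^'n \<Rightarrow> real" where
  "u \<equiv> FK_semigroup M X (V_of h) t g0"

text \<open>The change of measure moves all starting points \<open>y\<close> to \<open>x\<close>.\<close>

lemma u_eq: "u y = (\<integral>\<omega>. P.E (y - x) \<omega> \<partial>M)"
proof -
  interpret Q: path_functional M "Y y" "\<lambda>\<omega>. g (Y y t \<omega>)" "N t" "V_of h" \<phi> \<kappa> c2 t C0
    by (rule path_functional_OU)
  have QE: "Q.E 0 \<omega> = g (Y y t \<omega>) * exp (- (\<integral>s. V_of h (Y y s \<omega>) \<partial>leb t))" for \<omega>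
    by (simp add: Q.E_def Q.L_def Q.pint_def)
  have PE: "P.E z \<omega> = g (Y x t \<omega>) * exp (- (\<integral>s. V_of h (Y x s \<omega> + \<phi> s *\<^sub>R z) \<partial>leb t) + \<kappa> * (z \<bullet> N t \<omega>) - c2 * (norm z)\<^sup>2 / 2)" for z \<omega>
    by (simp add: P.E_def P.L_def P.pint_def)
  have "u y = (\<integral>\<omega>. Q.E 0 \<omega> \<partial>M)"
    unfolding FK_semigroup_def by (rule completion_integral_AE(2)[OF Q.E_meas]) (use AE_FK_density[of y] in \<open>simp add: QE\<close>)
  also have "\<dots> = enn2real (\<integral>\<^sup>+\<omega>. ennreal (Q.E 0 \<omega>) \<partial>M)"
    by (rule integral_eq_nn_integral[OF Q.E_meas]) (simp add: QE g_nonneg)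
  also have "(\<integral>\<^sup>+\<omega>. ennreal (Q.E 0 \<omega>) \<partial>M) = (\<integral>\<^sup>+\<omega>. ennreal (P.E (y - x) \<omega>) \<partial>M)"
  proof -
    have y: "x + (y - x) = y" by simp
    have "integrable M (\<lambda>\<omega>. g (Y y t \<omega>))"
      using integrable_L2_all_moments[OF _ g_square_integrable, of y "\<lambda>_. 1"] all_moments_const[of 1] by simp
    then have "(\<integral>\<^sup>+\<omega>. ennreal (g (exp (-t) *\<^sub>R (x + (y - x)) + N t \<omega>)) \<partial>M) < \<infinity>"
      unfolding y by (simp add: nn_integral_eq_integral g_nonneg)
    from cameron_martin_path[OF t V_cont V_lb g_meas g_nonneg this]
    show ?thesis unfolding QE PE unfolding y \<phi>_def \<kappa>_def c2_def .
  qed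
  also have "enn2real \<dots> = (\<integral>\<omega>. P.E (y - x) \<omega> \<partial>M)"
    by (rule integral_eq_nn_integral[OF P.E_meas, symmetric]) (simp add: PE g_nonneg)
  finally show ?thesis .
qed

lemma E_nonneg: "0 \<le> P.E z \<omega>"
  by (simp add: P.E_def g_nonneg)

lemma u_pos: "0 < u x"
proof -
  have "\<not> (AE \<omega> in M. P.E 0 \<omega> = 0)"
  proof
    assume "AE \<omega> in M. P.E 0 \<omega> = 0"
    then have "AE \<omega> in M. g (Y x t \<omega>) = 0" by (simp add: P.E_def)
    then have "AE w in lborel. g w = 0" by (subst (asm) AE_OU_law_iff[where P="\<lambda>w. g w = 0"]) auto
    then have "AE w in lborel. f w = 0" using f_nn unfolding AE_mu_h
      by eventually_elim (auto simp: g_def)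
    then show False using f_nz by (simp add: AE_mu_h)
  qed
  then have "(\<integral>\<omega>. P.E 0 \<omega> \<partial>M) \<noteq> 0"
    using integral_nonneg_eq_0_iff_AE[OF P.integrable_E[of 0]] E_nonneg by simp
  moreover have "0 \<le> (\<integral>\<omega>. P.E 0 \<omega> \<partial>M)" using E_nonneg by simp
  ultimately show ?thesis by (simp add: u_eq)
qed

end

section \<open>The Hessian of the logarithm of the semigroup\<close>

context ou_setting
begin

text \<open>The first partial derivatives of \<open>u\<close>, and its second ones at \<open>x\<close>.\<close>

definition u1 :: "'n \<Rightarrow> real^'n \<Rightarrow> real" where
  "u1 j y = (\<integral>\<omega>. P.E (y - x) \<omega> * P.DL (y - x) \<omega> $ j \<partial>M)"

definition u2 :: "'n \<Rightarrow> 'n \<Rightarrow> real" where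
  "u2 i j = (\<integral>\<omega>. P.E 0 \<omega> * (P.DL 0 \<omega> $ i * P.DL 0 \<omega> $ j) \<partial>M) + (\<integral>\<omega>. P.E 0 \<omega> * P.D2L j 0 \<omega> $ i \<partial>M)"

lemma u_has_derivative:
  assumes "dist x y < 1"
  shows "(u has_derivative (\<lambda>v. (\<chi> j. u1 j y) \<bullet> v)) (at y)"
proof -
  have n: "norm (y - x) < 1" using assms by (simp add: dist_norm norm_minus_commute)
  have shift: "((\<lambda>y. y - x) has_derivative (\<lambda>v. v)) (at y)" by (auto intro!: derivative_eq_intros)
  have "((\<lambda>y. \<integral>\<omega>. P.E (y - x) \<omega> \<partial>M) has_derivative (\<lambda>v. (\<chi> j. \<integral>\<omega>. P.E (y - x) \<omega> * P.DL (y - x) \<omega> $ j \<partial>M) \<bullet> v)) (at y)"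
    by (rule has_derivative_compose[OF shift P.integral_E_has_derivative(1)[OF n]])
  then show ?thesis by (simp add: u1_def u_eq[abs_def])
qed

lemma u1_has_derivative: "(u1 j has_derivative (\<lambda>v. (\<chi> i. u2 i j) \<bullet> v)) (at x)"
proof -
  have n: "norm (x - x) < 1" by simp
  have shift: "((\<lambda>y. y - x) has_derivative (\<lambda>v. v)) (at x)" by (auto intro!: derivative_eq_intros)
  have "((\<lambda>y. \<integral>\<omega>. P.E (y - x) \<omega> * P.DL (y - x) \<omega> $ j \<partial>M) has_derivative
     (\<lambda>v. (\<chi> i. (\<integral>\<omega>. P.E (x - x) \<omega> * (P.DL (x - x) \<omega> $ i * P.DL (x - x) \<omega> $ j) \<partial>M) + (\<integral>\<omega>. P.E (x - x) \<omega> * P.D2L j (x - x) \<omega> $ i \<partial>M)) \<bullet> v)) (at x)"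
    by (rule has_derivative_compose[OF shift P.integral_EDL_has_derivative[OF n]])
  then show ?thesis by (simp add: u1_def[abs_def] u2_def)
qed

lemma ex_radius: obtains r where "0 < r" "r \<le> 1" "\<forall>y\<in>ball x r. 0 < u y"
proof -
  have "isCont u x" using u_has_derivative[of x] has_derivative_continuous by fastforce
  then have "\<forall>\<^sub>F y in nhds x. u y > 0"
    using u_pos order_tendstoD(1)[of u "u x" "nhds x" 0] by (simp add: continuous_at_imp_continuous_at_within isCont_def tendsto_at_iff_tendsto_nhds)
  then obtain r where r: "0 < r" "\<And>y. dist y x < r \<Longrightarrow> 0 < u y"
    unfolding eventually_nhds_metric by blast
  show thesis by (rule that[of "min r 1"]) (use r in \<open>auto simp: dist_commute\<close>)
qed

text \<open>The logarithm of the semigroup generated by \<open>\<Delta> - \<nabla>h \<bullet> \<nabla>\<close>.\<close>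

abbreviation lnP :: "real^'n \<Rightarrow> real" where
  "lnP \<equiv> \<lambda>y. ln (P_semigroup M X h t f y)"

lemma Hess_lnP:
  shows "twice_differentiable_at lnP x"
    and "Hess lnP x $ i $ j = - (1 / 2) * ((if i = j then 1 else 0) - partial_deriv i (partial_deriv j h) x)
      + u2 i j / u x - u1 i x * u1 j x / (u x)\<^sup>2"
proof -
  obtain r where r: "0 < r" "r \<le> 1" "\<forall>y\<in>ball x r. 0 < u y" by (rule ex_radius)
  have x: "x \<in> ball x r" using r by simp
  have lnP: "lnP y = - (1 / 2) * W_of h y + ln (u y)" if "y \<in> ball x r" for y
    using r(3)[rule_format, OF that] by (simp add: P_semigroup_def ln_mult)
  define gl where "gl y = (\<chi> j. - (1 / 2) * (y $ j - partial_deriv j h y) + u1 j y / u y)" for y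
  have lnP_der: "(lnP has_derivative (\<lambda>v. gl y \<bullet> v)) (at y)" if y: "y \<in> ball x r" for y
  proof -
    have du: "(u has_derivative (\<lambda>v. (\<chi> j. u1 j y) \<bullet> v)) (at y)"
      using y r by (intro u_has_derivative) auto
    have ln_der: "(ln has_derivative (*) (inverse (u y))) (at (u y))"
      using DERIV_ln[OF r(3)[rule_format, OF y]] by (simp add: has_field_derivative_def)
    have inv_mult: "inverse b * a = a / b" for a b :: real by (simp add: divide_inverse)
    from has_derivative_compose[OF du ln_der]
    have dln: "((\<lambda>y. ln (u y)) has_derivative (\<lambda>v. ((\<chi> j. u1 j y) \<bullet> v) / u y)) (at y)"
      by (simp only: inv_mult)
    have "((\<lambda>y. - (1 / 2) * ((1 / 2) * (y \<bullet> y) - h y) + ln (u y)) has_derivative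
      (\<lambda>v. - (1 / 2) * ((1 / 2) * (y \<bullet> v + v \<bullet> y) - grad h y \<bullet> v) + ((\<chi> j. u1 j y) \<bullet> v) / u y)) (at y)"
      by (intro has_derivative_add has_derivative_mult_right has_derivative_diff has_derivative_grad[OF h_diff]
          has_derivative_inner[OF has_derivative_ident has_derivative_ident] dln)
    moreover have "- (1 / 2) * ((1 / 2) * (y \<bullet> v + v \<bullet> y) - grad h y \<bullet> v) + ((\<chi> j. u1 j y) \<bullet> v) / u y = gl y \<bullet> v" for v
    proof -
      have "gl y = - (1 / 2) *\<^sub>R (y - grad h y) + (1 / u y) *\<^sub>R (\<chi> j. u1 j y)"
        by (simp add: gl_def vec_eq_iff grad_def)
      then show ?thesis by (simp add: inner_add_left inner_diff_left inner_diff_right inner_commute)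
    qed
    ultimately have "((\<lambda>y. - (1 / 2) * W_of h y + ln (u y)) has_derivative (\<lambda>v. gl y \<bullet> v)) (at y)"
      by (simp add: W_of_def[abs_def] power2_norm_eq_inner)
    then show ?thesis
      by (rule has_derivative_transform_within_open[OF _ open_ball y]) (simp add: lnP)
  qed
  have partial: "partial_deriv j lnP y = gl y $ j" if "y \<in> ball x r" for j y
    using partial_deriv_eqI[OF lnP_der[OF that]] by (simp add: inner_axis)
  have du: "(u has_derivative (\<lambda>v. (\<chi> j. u1 j x) \<bullet> v)) (at x)"
    by (rule u_has_derivative) simp
  define D where "D j v = - (1 / 2) * (v $ j - grad (partial_deriv j h) x \<bullet> v)
      + ((((\<chi> i. u2 i j) \<bullet> v) * u x - u1 j x * ((\<chi> i. u1 i x) \<bullet> v)) / (u x * u x))" for j v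
  have gl_der: "((\<lambda>y. gl y $ j) has_derivative D j) (at x)" for j
    unfolding D_def[abs_def] gl_def vec_lambda_beta
    by (intro has_derivative_add has_derivative_mult_right has_derivative_diff has_derivative_grad h_partial_diff
        bounded_linear.has_derivative[OF bounded_linear_vec_nth] has_derivative_ident
        has_derivative_divide'[OF u1_has_derivative du]) (use u_pos in simp)
  have partial_der: "(partial_deriv j lnP has_derivative D j) (at x)" for j
    by (rule has_derivative_transform_within_open[OF gl_der open_ball x]) (simp add: partial)
  have "grad lnP differentiable (at x)"
  proof (subst differentiable_componentwise_within, intro ballI)
    fix b :: "real^'n" assume "b \<in> Basis"
    then obtain j where b: "b = axis j 1" by (auto simp: Basis_vec_def)
    have "(\<lambda>y. grad lnP y \<bullet> b) = partial_deriv j lnP" by (rule ext) (simp add: b inner_axis grad_def)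
    then show "(\<lambda>y. grad lnP y \<bullet> b) differentiable (at x)"
      using partial_der[of j] by (auto simp: differentiable_def)
  qed
  moreover have "\<forall>\<^sub>F y in nhds x. lnP differentiable (at y)"
    using eventually_nhds_in_open[OF open_ball x]
    by eventually_elim (use lnP_der in \<open>auto simp: differentiable_def\<close>)
  ultimately show "twice_differentiable_at lnP x" by (simp add: twice_differentiable_at_def)
  have "Hess lnP x $ i $ j = D j (axis i 1)"
    by (simp add: Hess_def partial_deriv_eqI[OF partial_der])
  also have "\<dots> = - (1 / 2) * ((if i = j then 1 else 0) - partial_deriv i (partial_deriv j h) x)
      + (u2 i j * u x - u1 j x * u1 i x) / (u x * u x)"
  proof -
    have "(axis i 1 :: real^'n) $ j = (if i = j then 1 else 0)" by (simp add: axis_def)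
    then show ?thesis unfolding D_def inner_axis by (simp add: grad_def)
  qed
  also have "(u2 i j * u x - u1 j x * u1 i x) / (u x * u x) = u2 i j / u x - u1 i x * u1 j x / (u x)\<^sup>2"
    using u_pos by (simp add: diff_divide_distrib power2_eq_square)
  finally show "Hess lnP x $ i $ j = - (1 / 2) * ((if i = j then 1 else 0) - partial_deriv i (partial_deriv j h) x)
      + u2 i j / u x - u1 i x * u1 j x / (u x)\<^sup>2" by simp
qed

text \<open>The tilted measure and the random vector whose covariance under it enters the formula.\<close>

abbreviation Q :: "'a measure" where "Q \<equiv> QW_measure M X h t f x"
abbreviation A :: "'a \<Rightarrow> real^'n" where "A \<equiv> A_var X (V_of h) t x"

text \<open>The unnormalised density of the tilted measure; it is only measurable for the completion, and equals
  \<open>P.E 0\<close> almost surely.\<close>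

abbreviation FK :: "'a \<Rightarrow> real" where "FK \<equiv> FK_density X (V_of h) t g0 x"

lemma AE_FK: "AE \<omega> in M. FK \<omega> = P.E 0 \<omega>"
  using AE_FK_density[of x] by (simp add: P.E_def P.L_def P.pint_def)

lemma Q_eq: "Q = density (completion M) (\<lambda>\<omega>. ennreal (FK \<omega> / u x))"
  by (simp add: QW_measure_def Q_measure_def)

lemma dens_meas: "(\<lambda>\<omega>. FK \<omega> / u x) \<in> borel_measurable (completion M)"
proof (rule completion_measurable_AE)
  show "(\<lambda>\<omega>. P.E 0 \<omega> / u x) \<in> borel_measurable M" by measurable
  show "AE \<omega> in M. FK \<omega> / u x = P.E 0 \<omega> / u x"
    using AE_FK by eventually_elim simp
qed

text \<open>Expectations under the tilted measure are computed from a version \<open>\<psi>'\<close> of the integrand that is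
  measurable for \<open>M\<close> itself.\<close>

lemma Q_integral:
  fixes \<psi> \<psi>' :: "'a \<Rightarrow> real"
  assumes [measurable]: "\<psi>' \<in> borel_measurable M" and eq: "AE \<omega> in M. \<psi> \<omega> = \<psi>' \<omega>"
    and int: "integrable M (\<lambda>\<omega>. P.E 0 \<omega> * \<psi>' \<omega>)"
  shows "integrable Q \<psi>" and "(\<integral>\<omega>. \<psi> \<omega> \<partial>Q) = (\<integral>\<omega>. P.E 0 \<omega> * \<psi>' \<omega> \<partial>M) / u x"
proof -
  have \<psi>: "\<psi> \<in> borel_measurable (completion M)" by (rule completion_measurable_AE[OF _ eq]) measurable
  have nn: "AE \<omega> in completion M. 0 \<le> FK \<omega> / u x"
    using AE_completion[OF AE_FK] by eventually_elim (use E_nonneg u_pos in simp)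
  have eq': "AE \<omega> in M. (FK \<omega> / u x) *\<^sub>R \<psi> \<omega> = P.E 0 \<omega> * \<psi>' \<omega> / u x"
    using AE_FK eq by eventually_elim simp
  have m: "(\<lambda>\<omega>. P.E 0 \<omega> * \<psi>' \<omega> / u x) \<in> borel_measurable M" by measurable
  show "integrable Q \<psi>"
    unfolding Q_eq integrable_density[OF \<psi> dens_meas nn] completion_integral_AE(1)[OF m eq']
    using int by simp
  show "(\<integral>\<omega>. \<psi> \<omega> \<partial>Q) = (\<integral>\<omega>. P.E 0 \<omega> * \<psi>' \<omega> \<partial>M) / u x"
    unfolding Q_eq integral_density[OF \<psi> dens_meas nn] completion_integral_AE(2)[OF m eq'] by simp
qed

lemma prob_space_Q: "prob_space Q"
proof
  have "emeasure Q (space Q) = (\<integral>\<^sup>+\<omega>. ennreal (FK \<omega> / u x) \<partial>completion M)"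
  proof -
    have "emeasure Q (space Q) = (\<integral>\<^sup>+\<omega>. ennreal (FK \<omega> / u x) * indicator (space (completion M)) \<omega> \<partial>completion M)"
      unfolding Q_eq using dens_meas by (subst emeasure_density) auto
    also have "\<dots> = (\<integral>\<^sup>+\<omega>. ennreal (FK \<omega> / u x) \<partial>completion M)"
      by (rule nn_integral_cong) simp
    finally show ?thesis .
  qed
  also have "\<dots> = (\<integral>\<^sup>+\<omega>. ennreal (P.E 0 \<omega> / u x) \<partial>M)"
    unfolding nn_integral_completion using AE_FK by (intro nn_integral_cong_AE) (auto elim!: eventually_mono)
  also have "\<dots> = ennreal (\<integral>\<omega>. P.E 0 \<omega> / u x \<partial>M)"
    using P.integrable_E[of 0] E_nonneg u_pos by (intro nn_integral_eq_integral) auto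
  also have "(\<integral>\<omega>. P.E 0 \<omega> / u x \<partial>M) = 1" using u_pos by (simp add: u_eq[of x])
  finally show "emeasure Q (space Q) = 1" by simp
qed

text \<open>The random vector \<open>A\<close> is the gradient of the exponent at displacement zero.\<close>

lemma AE_A: "AE \<omega> in M. A \<omega> = P.DL 0 \<omega>"
  using AE_X_N[of x] AE_space
proof eventually_elim
  case (elim \<omega>)
  let ?g = "\<lambda>s. (sinh (t - s) / sinh t) *\<^sub>R grad (V_of h) (Y x s \<omega>)"
  have gc: "continuous_on UNIV (grad (V_of h))"
    unfolding grad_def by (intro continuous_on_vec_lambda P.V_conts)
  have "continuous_on {0..t} (\<lambda>s. Y x s \<omega>)" by (rule P.Y_cont[OF elim(2)])
  then have "continuous_on {0..t} (\<lambda>s. grad (V_of h) (Y x s \<omega>))"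
    by (rule continuous_on_compose2[OF gc]) auto
  moreover have "continuous_on {0..t} (\<lambda>s. sinh (t - s) / sinh t)"
    using t by (intro continuous_intros) auto
  ultimately have c: "continuous_on {0..t} ?g" by (intro continuous_on_scaleR)
  have "integral {0..t} (\<lambda>s. (sinh (t - s) / sinh t) *\<^sub>R grad (V_of h) (X x s \<omega>)) = integral {0..t} ?g"
    using elim(1) by (intro integral_cong) auto
  also have "\<dots> = (\<integral>s. ?g s \<partial>leb t)" by (rule leb_continuous(2)[OF c])
  finally have I: "integral {0..t} (\<lambda>s. (sinh (t - s) / sinh t) *\<^sub>R grad (V_of h) (X x s \<omega>)) $ j
      = P.pint \<phi> (partial_deriv j (V_of h)) 0 \<omega>" for j
    using integral_vec_nth[OF leb_continuous(1)[OF c], of j] by (simp add: P.pint_def \<phi>_def grad_def)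
  have Xt: "X x t \<omega> - exp (-t) *\<^sub>R x = N t \<omega>" using elim(1) t by simp
  show ?case unfolding A_var_def Xt \<kappa>_def[symmetric] by (simp add: vec_eq_iff P.DL_def I)
qed

lemma integral_A:
  shows "integrable Q A" and "(\<integral>\<omega>. A \<omega> \<partial>Q) $ j = u1 j x / u x"
    and "integrable Q (\<lambda>\<omega>. A \<omega> \<otimes>\<^sub>o A \<omega>)"
    and "(\<integral>\<omega>. A \<omega> \<otimes>\<^sub>o A \<omega> \<partial>Q) $ i $ j = (\<integral>\<omega>. P.E 0 \<omega> * (P.DL 0 \<omega> $ i * P.DL 0 \<omega> $ j) \<partial>M) / u x"
proof -
  have m[measurable]: "(\<lambda>\<omega>. P.DL 0 \<omega> $ j) \<in> borel_measurable M" for j by (intro P.nth_meas P.DL_meas)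
  have e: "AE \<omega> in M. A \<omega> $ j = P.DL 0 \<omega> $ j" for j using AE_A by eventually_elim simp
  have i0: "norm (0::real^'n) \<le> 2" by simp
  note 1 = Q_integral[OF m e P.integrable_E_DL[OF i0]]
  show A: "integrable Q A" by (rule integrable_vecI) (rule 1(1))
  show "(\<integral>\<omega>. A \<omega> \<partial>Q) $ j = u1 j x / u x"
    using 1(2)[of j] by (simp add: integral_vec_nth[OF A] u1_def)
  have e2: "AE \<omega> in M. (A \<omega> \<otimes>\<^sub>o A \<omega>) $ i $ j = P.DL 0 \<omega> $ i * P.DL 0 \<omega> $ j" for i j
    using AE_A by eventually_elim (simp add: outer_product_nth)
  have m2: "(\<lambda>\<omega>. P.DL 0 \<omega> $ i * P.DL 0 \<omega> $ j) \<in> borel_measurable M" for i j by measurable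
  note 2 = Q_integral[OF m2 e2 P.integrable_E_DL2[OF i0]]
  show AA: "integrable Q (\<lambda>\<omega>. A \<omega> \<otimes>\<^sub>o A \<omega>)" by (rule integrable_matI) (rule 2(1))
  show "(\<integral>\<omega>. A \<omega> \<otimes>\<^sub>o A \<omega> \<partial>Q) $ i $ j = (\<integral>\<omega>. P.E 0 \<omega> * (P.DL 0 \<omega> $ i * P.DL 0 \<omega> $ j) \<partial>M) / u x"
    using 2(2)[of i j] by (simp add: integral_mat_nth[OF AA])
qed

lemma integral_Hess_V:
  assumes s: "s \<in> {0..t}"
  shows "integrable Q (\<lambda>\<omega>. Hess (V_of h) (X x s \<omega>))"
    and "(\<integral>\<omega>. Hess (V_of h) (X x s \<omega>) \<partial>Q) $ i $ j
      = (\<integral>\<omega>. P.E 0 \<omega> * P.HV i j (Y x s \<omega>) \<partial>M) / u x"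
proof -
  have Wm[measurable]: "P.HV i j \<in> borel_measurable borel" for i j
    by (rule borel_measurable_continuous_onI[OF P.V_conts(3)])
  have m: "(\<lambda>\<omega>. P.HV i j (Y x s \<omega>)) \<in> borel_measurable M" for i j
    by measurable
  have e: "AE \<omega> in M. Hess (V_of h) (X x s \<omega>) $ i $ j = P.HV i j (Y x s \<omega>)" for i j
    using AE_X_N[of x] by eventually_elim (use s in \<open>simp add: Hess_def\<close>)
  note 1 = Q_integral[OF m e P.integrable_E_Hess[OF s]]
  show H: "integrable Q (\<lambda>\<omega>. Hess (V_of h) (X x s \<omega>))" by (rule integrable_matI) (rule 1(1))
  show "(\<integral>\<omega>. Hess (V_of h) (X x s \<omega>) \<partial>Q) $ i $ j
      = (\<integral>\<omega>. P.E 0 \<omega> * P.HV i j (Y x s \<omega>) \<partial>M) / u x"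
    using 1(2)[of i j] by (simp add: integral_mat_nth[OF H])
qed

lemma time_integral_Hess_V:
  defines "Hs \<equiv> \<lambda>s. (sinh (t - s) / sinh t)\<^sup>2 *\<^sub>R (\<integral>\<omega>. Hess (V_of h) (X x s \<omega>) \<partial>Q)"
  shows "Hs integrable_on {0..t}"
    and "integral {0..t} Hs $ i $ j
      = (\<integral>\<omega>. P.E 0 \<omega> * P.pint (\<lambda>s. \<phi> s * \<phi> s) (P.HV i j) 0 \<omega> \<partial>M) / u x"
proof -
  define K where "K i j s = \<phi> s * \<phi> s * (\<integral>\<omega>. P.E 0 \<omega> * P.HV i j (Y x s \<omega>) \<partial>M)" for i j s
  have Hs: "Hs s $ i $ j = K i j s / u x" if "s \<in> {0..t}" for s i j
    unfolding Hs_def K_def using integral_Hess_V(2)[OF that, of i j]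
    by (simp add: \<phi>_def power2_eq_square)
  have K: "integrable (leb t) (K i j)" "(\<integral>s. K i j s \<partial>leb t) = (\<integral>\<omega>. P.E 0 \<omega> * P.pint (\<lambda>s. \<phi> s * \<phi> s) (P.HV i j) 0 \<omega> \<partial>M)" for i j
    unfolding K_def by (rule P.fubini_E_Hess)+
  have Hint: "integrable (leb t) Hs"
  proof (rule integrable_matI)
    fix i j
    have "integrable (leb t) (\<lambda>s. K i j s / u x)" using K(1) by simp
    then show "integrable (leb t) (\<lambda>s. Hs s $ i $ j)"
      by (rule Bochner_Integration.integrable_cong[THEN iffD1, rotated -1]) (simp_all add: Hs)
  qed
  show "Hs integrable_on {0..t}" by (rule leb_HK(1)[OF Hint])
  have "integral {0..t} Hs $ i $ j = (\<integral>s. Hs s $ i $ j \<partial>leb t)"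
    unfolding leb_HK(2)[OF Hint] by (rule integral_mat_nth[OF Hint])
  also have "\<dots> = (\<integral>s. K i j s / u x \<partial>leb t)" by (rule Bochner_Integration.integral_cong) (simp_all add: Hs)
  also have "\<dots> = (\<integral>s. K i j s \<partial>leb t) / u x" by simp
  finally show "integral {0..t} Hs $ i $ j
      = (\<integral>\<omega>. P.E 0 \<omega> * P.pint (\<lambda>s. \<phi> s * \<phi> s) (P.HV i j) 0 \<omega> \<partial>M) / u x"
    unfolding K(2) .
qed

lemma c_coef_sq: "(c_coef t)\<^sup>2 = c2"
  using t by (simp add: c_coef_def c2_def power_divide exp_double[symmetric])

lemma Hess_formula:
  "Hess lnP x =
      - (1 / 2) *\<^sub>R (mat 1 - Hess h x)
      + (\<integral>\<omega>. A \<omega> \<otimes>\<^sub>o A \<omega> \<partial>Q)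
      - (\<integral>\<omega>. A \<omega> \<partial>Q) \<otimes>\<^sub>o (\<integral>\<omega>. A \<omega> \<partial>Q)
      - (c_coef t)\<^sup>2 *\<^sub>R mat 1
      - integral {0..t} (\<lambda>s. (sinh (t - s) / sinh t)\<^sup>2 *\<^sub>R (\<integral>\<omega>. Hess (V_of h) (X x s \<omega>) \<partial>Q))"
  (is "_ = ?R")
proof (rule vec_eq_iff[THEN iffD2], rule allI, rule vec_eq_iff[THEN iffD2], rule allI)
  fix i j
  let ?p = "P.pint (\<lambda>s. \<phi> s * \<phi> s) (P.HV i j) 0"
  let ?\<delta> = "if i = j then 1 else 0 :: real"
  have uE: "(\<integral>\<omega>. P.E 0 \<omega> \<partial>M) = u x" by (simp add: u_eq[of x])
  have iE: "integrable M (P.E 0)" by (rule P.integrable_E) simp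
  have D2L: "P.E 0 \<omega> * P.D2L j 0 \<omega> $ i = - (P.E 0 \<omega> * ?p \<omega>) - c2 * ?\<delta> * P.E 0 \<omega>" for \<omega>
    by (simp only: P.D2L_def vec_lambda_beta right_diff_distrib mult_minus_right mult.commute[of "P.E 0 \<omega>" "c2 * ?\<delta>"])
  have "integrable M (\<lambda>\<omega>. P.E 0 \<omega> * P.D2L j 0 \<omega> $ i)" by (rule P.integrable_E_D2L) simp
  then have "integrable M (\<lambda>\<omega>. - (P.E 0 \<omega> * P.D2L j 0 \<omega> $ i) - c2 * ?\<delta> * P.E 0 \<omega>)"
    using iE by (intro Bochner_Integration.integrable_diff Bochner_Integration.integrable_minus integrable_mult_right) auto
  then have ip: "integrable M (\<lambda>\<omega>. P.E 0 \<omega> * ?p \<omega>)" unfolding D2L by simp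
  have "(\<integral>\<omega>. P.E 0 \<omega> * P.D2L j 0 \<omega> $ i \<partial>M) = - (\<integral>\<omega>. P.E 0 \<omega> * ?p \<omega> \<partial>M) - c2 * ?\<delta> * u x"
    unfolding D2L using ip iE uE by (subst Bochner_Integration.integral_diff) auto
  then have u2: "u2 i j / u x = (\<integral>\<omega>. P.E 0 \<omega> * (P.DL 0 \<omega> $ i * P.DL 0 \<omega> $ j) \<partial>M) / u x
      - (\<integral>\<omega>. P.E 0 \<omega> * ?p \<omega> \<partial>M) / u x - c2 * ?\<delta>"
    unfolding u2_def using u_pos by (simp add: add_divide_distrib diff_divide_distrib)
  have R: "?R $ i $ j = - (1 / 2) * (?\<delta> - partial_deriv i (partial_deriv j h) x)
     + (\<integral>\<omega>. P.E 0 \<omega> * (P.DL 0 \<omega> $ i * P.DL 0 \<omega> $ j) \<partial>M) / u x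
     - (u1 i x / u x) * (u1 j x / u x) - c2 * ?\<delta>
     - (\<integral>\<omega>. P.E 0 \<omega> * ?p \<omega> \<partial>M) / u x"
    unfolding vector_minus_component vector_add_component vector_scaleR_component integral_A(4) outer_product_nth integral_A(2) c_coef_sq time_integral_Hess_V(2)
    by (simp add: mat_def Hess_def)
  show "Hess lnP x $ i $ j = ?R $ i $ j"
    unfolding R Hess_lnP(2) u2 by (simp add: power2_eq_square)
qed

end

theorem theorem2p2:
  fixes M :: "'a measure"
    and F :: "real \<Rightarrow> 'a measure"
    and B :: "real \<Rightarrow> 'a \<Rightarrow> real ^ 'n"
    and X :: "real ^ 'n \<Rightarrow> real \<Rightarrow> 'a \<Rightarrow> real ^ 'n"
    and h f :: "real ^ 'n \<Rightarrow> real"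
    and t :: real
    and x :: "real ^ 'n"
  assumes "filtered_prob_space M F"
    and "standard_brownian_motion M F B"
    and "\<And>y. OU_process M F B y (X y)"
    and "h \<in> D_class 4"
    and "bdd_below (range (V_of h))"
    and "f \<in> L2_fun (mu_h h)"
    and "AE y in mu_h h. 0 \<le> f y"
    and "\<not> (AE y in mu_h h. f y = 0)"
    and "0 < t"
  defines "Q \<equiv> QW_measure M X h t f x"
    and "A \<equiv> A_var X (V_of h) t x"
  shows "prob_space Q \<and>
    integrable Q A \<and>
    integrable Q (\<lambda>\<omega>. A \<omega> \<otimes>\<^sub>o A \<omega>) \<and>
    (\<forall>s\<in>{0..t}. integrable Q (\<lambda>\<omega>. Hess (V_of h) (X x s \<omega>))) \<and>
    (\<lambda>s. (sinh (t - s) / sinh t)\<^sup>2 *\<^sub>R (\<integral>\<omega>. Hess (V_of h) (X x s \<omega>) \<partial>Q))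
      integrable_on {0..t} \<and>
    twice_differentiable_at (\<lambda>y. ln (P_semigroup M X h t f y)) x \<and>
    Hess (\<lambda>y. ln (P_semigroup M X h t f y)) x =
      - (1 / 2) *\<^sub>R (mat 1 - Hess h x)
      + (\<integral>\<omega>. A \<omega> \<otimes>\<^sub>o A \<omega> \<partial>Q)
      - (\<integral>\<omega>. A \<omega> \<partial>Q) \<otimes>\<^sub>o (\<integral>\<omega>. A \<omega> \<partial>Q)
      - (c_coef t)\<^sup>2 *\<^sub>R mat 1
      - integral {0..t} (\<lambda>s. (sinh (t - s) / sinh t)\<^sup>2 *\<^sub>R (\<integral>\<omega>. Hess (V_of h) (X x s \<omega>) \<partial>Q))"
proof -
  interpret O: ou_family M F B X using assms(1-3) by unfold_locales
  obtain N where N: "\<And>s. N s \<in> borel_measurable M"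
    "\<And>\<omega>. \<omega> \<in> space M \<Longrightarrow> continuous_on UNIV (\<lambda>s. N s \<omega>)"
    "AE \<omega> in M. \<forall>s\<ge>0. N s \<omega> = X 0 s \<omega>"
    using O.ex_regular_version by blast
  obtain c where c: "\<And>y. c \<le> V_of h y"
    using assms(5) by (auto simp: bdd_below_def)
  interpret S: ou_setting M F B X N h f t "- c" x
    using assms N c by unfold_locales auto
  show ?thesis
    unfolding Q_def A_def
    by (intro conjI ballI S.prob_space_Q S.integral_A S.integral_Hess_V S.time_integral_Hess_V S.Hess_lnP S.Hess_formula)
qed

end
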